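(* Let $\alpha\in\mathbb{R}$, $0<p<\infty$, and let $X$ be a ball quasi-Banach function space on $\mathbb{R}^n$ such that, for some $s$ with $0<s<p$, $X^{1/s}$ is a ball Banach function space and the Hardy–Littlewood maximal operator $M$ is bounded on the associate space $(X^{1/s})'$. Suppose $(X^{1/s})'=(X^{1/s})^*$ and $-n\delta_{X^{1/s}}<s\alpha<n\delta_{(X^{1/s})'}$. Let $T$ be an operator satisfying, for any given $w\in A_1(\mathbb{R}^n)$ and any $f\in L^s_w(\mathbb{R}^n)$, $$\|T(f)\|_{L^s_w}\le C\|f\|_{L^s_w},$$ where the constant $C$ is independent of $f$, but depends on $s$ and $[w]_{A_1}$. Then there is a constant $C'>0$ such that for any $f\in\dot{K}^{\alpha,p}_X(\mathbb{R}^n)$, $$\|T(f)\|_{\dot{K}^{\alpha,p}_X}\le C'\|f\|_{\dot{K}^{\alpha,p}_X}.$$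
   Context: $\mathcal{M}(\mathbb{R}^n)$ denotes the Lebesgue measurable functions on $\mathbb{R}^n$. A ball quasi-Banach function space is a quasi-Banach space $X\subseteq\mathcal{M}(\mathbb{R}^n)$ such that: (i) $\|f\|_X=0$ implies $f=0$ a.e.; (ii) $|g|\le|f|$ a.e. implies $\|g\|_X\le\|f\|_X$; (iii) $0\le f_m\uparrow f$ a.e. implies $\|f_m\|_X\uparrow\|f\|_X$; (iv) $\chi_B\in X$ for every ball $B\subset\mathbb{R}^n$. It is a ball Banach function space if moreover $\|f+g\|_X\le\|f\|_X+\|g\|_X$ for all $f,g\in X$ and, for every ball $B$, there is $C(B)>0$ with $\int_B|f(x)|\,dx\le C(B)\|f\|_X$ for all $f\in X$. For $r\in(0,\infty)$, the $r$-convexification is $X^r=\{f\in\mathcal{M}(\mathbb{R}^n):|f|^r\in X\}$ with $\|f\|_{X^r}=\||f|^r\|_X^{1/r}$. The associate space of a ball Banach function space $Y$ is $Y'=\{f\in\mathcal{M}(\mathbb{R}^n):\|f\|_{Y'}=\sup_{\|g\|_Y\le 1}\|fg\|_{L^1(\mathbb{R}^n)}<\infty\}$; it is again a ball Banach function space. $Y'=Y^*$ means that the topological dual of $Y$ is identified with $Y'$ via the pairing $\int fg$. For a ball Banach function space $Y$, $\delta_Y$ denotes a constant with $0<\delta_Y<1$ for which there is $C>0$ such that $\|\chi_E\|_Y/\|\chi_B\|_Y\le C(|E|/|B|)^{\delta_Y}$ for all balls $B$ and all measurable $E\subseteq B$ (such a constant exists whenever $M$ is bounded on $Y'$); the use of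 $\delta_Y$ in the statement includes that such constants exist and are fixed. $M(f)(x)=\sup_{B\ni x}\frac1{|B|}\int_B|f(y)|\,dy$, the supremum over all balls $B$ containing $x$. A locally integrable $w:\mathbb{R}^n\to(0,\infty)$ is in $A_1(\mathbb{R}^n)$ if there is $C>0$ with $\frac1{|B|}\int_Bw\le Cw(x)$ for a.e. $x\in B$, for all balls $B$; the infimum of such $C$ is $[w]_{A_1}$. $\|f\|_{L^s_w}=(\int|f|^sw)^{1/s}$. For $k\in\mathbb{Z}$ let $B_k=\{x:|x|<2^k\}$, $C_k=B_k\setminus B_{k-1}$, $\chi_k=\chi_{C_k}$. $L^X_{\rm loc}(\mathbb{R}^n\setminus\{0\})$ is the set of measurable $f$ with $f\chi_F\in X$ for every compact $F\subseteq\mathbb{R}^n\setminus\{0\}$. The homogeneous Herz-type space is $$\dot{K}^{\alpha,p}_X(\mathbb{R}^n)=\Big\{f\in L^X_{\rm loc}(\mathbb{R}^n\setminus\{0\}):\|f\|_{\dot{K}^{\alpha,p}_X}=\Big(\sum_{k\in\mathbb{Z}}2^{kp\alpha}\|f\chi_k\|_X^p\Big)^{1/p}<\infty\Big\}.$$ *)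

theory Defs
  imports "HOL-Analysis.Analysis"
begin

text \<open>
  Functions on \<open>\<real>\<^sup>n\<close> take values in a scalar field \<open>'b\<close> of sort
  \<open>{real_normed_field, euclidean_space}\<close>; both \<open>real\<close> and \<open>complex\<close> are instances, so that
  real-valued and complex-valued measurable functions are covered simultaneously.
  A function space is given by its quasi-norm \<open>N\<close>, with values in \<open>[0, \<infinity>]\<close> and
  \<open>N f = \<infinity>\<close> for measurable \<open>f\<close> outside of the space. The values of \<open>N\<close> at functions that are not
  Lebesgue measurable are irrelevant. Functions that agree almost everywhere are not identified,
  but the lattice property below forces \<open>N\<close> to agree on them.
\<close>

type_synonym ('n, 'b) fnorm = "(real^'n \<Rightarrow> 'b) \<Rightarrow> ennreal"

definition fspace :: "('n::finite, 'b::{real_normed_field,euclidean_space}) fnorm \<Rightarrow> (real^'n \<Rightarrow> 'b) set"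
  where "fspace N = {f \<in> borel_measurable lebesgue. N f < \<infinity>}"

text \<open>Powers on \<open>[0, \<infinity>]\<close>; only used with positive exponents.\<close>

definition epowr :: "ennreal \<Rightarrow> real \<Rightarrow> ennreal"  (infixr \<open>epowr\<close> 80)
  where "t epowr a = (if t = \<infinity> then \<infinity> else ennreal (enn2real t powr a))"


subsection \<open>Ball (quasi-)Banach function spaces\<close>

definition quasi_banach_norm :: "('n::finite, 'b::{real_normed_field,euclidean_space}) fnorm \<Rightarrow> bool"
  where "quasi_banach_norm N \<longleftrightarrow>
    (\<forall>f\<in>borel_measurable lebesgue. \<forall>c. N (\<lambda>x. c * f x) = ennreal (norm c) * N f) \<and>
    (\<exists>K\<ge>1. \<forall>f\<in>fspace N. \<forall>g\<in>fspace N. N (\<lambda>x. f x + g x) \<le> ennreal K * (N f + N g)) \<and>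
    (\<forall>u. (\<forall>m::nat. u m \<in> fspace N) \<and>
         (\<forall>e>0. \<exists>m0. \<forall>m\<ge>m0. \<forall>k\<ge>m0. N (\<lambda>x. u m x - u k x) < ennreal e) \<longrightarrow>
         (\<exists>f\<in>fspace N. (\<lambda>m. N (\<lambda>x. u m x - f x)) \<longlonglongrightarrow> 0))"

definition ball_quasi_banach_function_space ::
    "('n::finite, 'b::{real_normed_field,euclidean_space}) fnorm \<Rightarrow> bool"
  where "ball_quasi_banach_function_space N \<longleftrightarrow>
    quasi_banach_norm N \<and>
    (\<forall>f\<in>borel_measurable lebesgue. N f = 0 \<longrightarrow> (AE x in lebesgue. f x = 0)) \<and>
    (\<forall>f\<in>borel_measurable lebesgue. \<forall>g\<in>borel_measurable lebesgue.
       (AE x in lebesgue. norm (g x) \<le> norm (f x)) \<longrightarrow> N g \<le> N f) \<and>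
    (\<forall>(u :: nat \<Rightarrow> real^'n \<Rightarrow> real) v.
       (\<forall>m. u m \<in> borel_measurable lebesgue) \<and> v \<in> borel_measurable lebesgue \<and>
       (AE x in lebesgue. (\<forall>m. 0 \<le> u m x) \<and> incseq (\<lambda>m. u m x) \<and> (\<lambda>m. u m x) \<longlonglongrightarrow> v x) \<longrightarrow>
       incseq (\<lambda>m. N (\<lambda>x. of_real (u m x))) \<and>
       (\<lambda>m. N (\<lambda>x. of_real (u m x))) \<longlonglongrightarrow> N (\<lambda>x. of_real (v x))) \<and>
    (\<forall>c r. 0 < r \<longrightarrow> indicator (ball c r) \<in> fspace N)"

definition ball_banach_function_space ::
    "('n::finite, 'b::{real_normed_field,euclidean_space}) fnorm \<Rightarrow> bool"
  where "ball_banach_function_space N \<longleftrightarrow>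
    ball_quasi_banach_function_space N \<and>
    (\<forall>f\<in>fspace N. \<forall>g\<in>fspace N. N (\<lambda>x. f x + g x) \<le> N f + N g) \<and>
    (\<forall>c r. 0 < r \<longrightarrow>
       (\<exists>C>0. \<forall>f\<in>fspace N. (\<integral>\<^sup>+x\<in>ball c r. ennreal (norm (f x)) \<partial>lebesgue) \<le> ennreal C * N f))"

definition convexification ::
    "('n::finite, 'b::{real_normed_field,euclidean_space}) fnorm \<Rightarrow> real \<Rightarrow> ('n, 'b) fnorm"
  where "convexification N r f = N (\<lambda>x. of_real (norm (f x) powr r)) epowr (1 / r)"

definition associate ::
    "('n::finite, 'b::{real_normed_field,euclidean_space}) fnorm \<Rightarrow> ('n, 'b) fnorm"
  where "associate N f =
    (SUP g\<in>{g \<in> borel_measurable lebesgue. N g \<le> 1}. \<integral>\<^sup>+x. ennreal (norm (f x * g x)) \<partial>lebesgue)"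

definition topological_dual ::
    "('n::finite, 'b::{real_normed_field,euclidean_space}) fnorm \<Rightarrow> ((real^'n \<Rightarrow> 'b) \<Rightarrow> 'b) set"
  where "topological_dual N = {\<phi> \<in> extensional (fspace N).
    (\<forall>f\<in>fspace N. \<forall>g\<in>fspace N. \<phi> (\<lambda>x. f x + g x) = \<phi> f + \<phi> g) \<and>
    (\<forall>f\<in>fspace N. \<forall>c. \<phi> (\<lambda>x. c * f x) = c * \<phi> f) \<and>
    (\<exists>C\<ge>0. \<forall>f\<in>fspace N. ennreal (norm (\<phi> f)) \<le> ennreal C * N f)}"

text \<open>
  The identification of the associate space with the dual. Injectivity (up to null sets) and
  isometry of the pairing map are automatic for ball Banach function spaces.
\<close>

definition associate_is_dual ::
    "('n::finite, 'b::{real_normed_field,euclidean_space}) fnorm \<Rightarrow> bool"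
  where "associate_is_dual N \<longleftrightarrow>
    (\<lambda>f. \<lambda>g\<in>fspace N. LINT x|lebesgue. f x * g x) ` fspace (associate N) = topological_dual N"

definition delta_exponent ::
    "('n::finite, 'b::{real_normed_field,euclidean_space}) fnorm \<Rightarrow> real \<Rightarrow> bool"
  where "delta_exponent N \<delta> \<longleftrightarrow> 0 < \<delta> \<and> \<delta> < 1 \<and>
    (\<exists>C>0. \<forall>c r E. 0 < r \<longrightarrow> E \<in> sets lebesgue \<longrightarrow> E \<subseteq> ball c r \<longrightarrow>
       N (indicator E) / N (indicator (ball c r))
         \<le> ennreal (C * (measure lebesgue E / measure lebesgue (ball c r)) powr \<delta>))"


subsection \<open>The maximal operator and weights\<close>

definition maximal_function :: "(real^'n::finite \<Rightarrow> 'b::real_normed_vector) \<Rightarrow> real^'n \<Rightarrow> ennreal"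
  where "maximal_function f x =
    (SUP (c, r)\<in>{(c, r). 0 < r \<and> x \<in> ball c r}.
       (\<integral>\<^sup>+y\<in>ball c r. ennreal (norm (f y)) \<partial>lebesgue) / emeasure lebesgue (ball c r))"

text \<open>
  The maximal function takes values in \<open>[0, \<infinity>]\<close>; for it to lie in the space it must be finite
  almost everywhere, and then its values on a null set do not matter.
\<close>

definition maximal_bounded_on ::
    "('n::finite, 'b::{real_normed_field,euclidean_space}) fnorm \<Rightarrow> bool"
  where "maximal_bounded_on N \<longleftrightarrow>
    (\<exists>C>0. \<forall>f\<in>fspace N. (AE x in lebesgue. maximal_function f x < \<infinity>) \<and>
       N (\<lambda>x. of_real (enn2real (maximal_function f x))) \<le> ennreal C * N f)"

definition A1_bounds :: "(real^'n::finite \<Rightarrow> real) \<Rightarrow> real set"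
  where "A1_bounds w = {C. 0 < C \<and>
    (\<forall>c r. 0 < r \<longrightarrow> (AE x in lebesgue. x \<in> ball c r \<longrightarrow>
       (LINT y:ball c r|lebesgue. w y) / measure lebesgue (ball c r) \<le> C * w x))}"

definition A1_weights :: "(real^'n::finite \<Rightarrow> real) set"
  where "A1_weights = {w. (\<forall>x. 0 < w x) \<and> (\<forall>F. compact F \<longrightarrow> set_integrable lebesgue F w) \<and>
    A1_bounds w \<noteq> {}}"

definition A1_const :: "(real^'n::finite \<Rightarrow> real) \<Rightarrow> real"
  where "A1_const w = Inf (A1_bounds w)"

definition weighted_Lp_norm ::
    "real \<Rightarrow> (real^'n::finite \<Rightarrow> real) \<Rightarrow> ('n, 'b::{real_normed_field,euclidean_space}) fnorm"
  where "weighted_Lp_norm s w f = (\<integral>\<^sup>+x. ennreal (norm (f x) powr s * w x) \<partial>lebesgue) epowr (1 / s)"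


subsection \<open>Homogeneous Herz-type spaces\<close>

definition annulus :: "int \<Rightarrow> (real^'n::finite) set"
  where "annulus k = ball 0 (2 powi k) - ball 0 (2 powi (k - 1))"

definition L_loc_punctured ::
    "('n::finite, 'b::{real_normed_field,euclidean_space}) fnorm \<Rightarrow> (real^'n \<Rightarrow> 'b) set"
  where "L_loc_punctured N = {f \<in> borel_measurable lebesgue.
    \<forall>F. compact F \<and> 0 \<notin> F \<longrightarrow> (\<lambda>x. f x * indicator F x) \<in> fspace N}"

definition herz_norm ::
    "real \<Rightarrow> real \<Rightarrow> ('n::finite, 'b::{real_normed_field,euclidean_space}) fnorm \<Rightarrow> ('n, 'b) fnorm"
  where "herz_norm \<alpha> p N f =
    (\<Sum>\<^sub>\<infinity>k\<in>(UNIV :: int set). ennreal (2 powr (of_int k * p * \<alpha>)) *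
       N (\<lambda>x. f x * indicator (annulus k) x) epowr p) epowr (1 / p)"

definition herz_space ::
    "real \<Rightarrow> real \<Rightarrow> ('n::finite, 'b::{real_normed_field,euclidean_space}) fnorm \<Rightarrow> (real^'n \<Rightarrow> 'b) set"
  where "herz_space \<alpha> p N = {f \<in> L_loc_punctured N. herz_norm \<alpha> p N f < \<infinity>}"

end

theory Submission
  imports Defs
begin

text \<open>
  Put \<open>Y = X\<^sup>1\<^sup>/\<^sup>s\<close> and \<open>q = p / s > 1\<close>. The \<open>p\<close>-th power of the Herz norm of \<open>f\<close> over \<open>X\<close> is the
  \<open>q\<close>-th power of the Herz norm of \<open>\<bar>f\<bar>\<^sup>s\<close> over \<open>Y\<close> with smoothness exponent \<open>s\<alpha>\<close>; this quantity is
  called \<open>energy\<close> below. The Herz space over \<open>Y\<close> is in the Banach range, so duality is available,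
  and the theorem follows by Rubio de Francia's extrapolation: every \<open>h\<close> in the polar of the unit
  ball of that space is dominated by a multiple of an \<open>A\<^sub>1\<close> weight \<open>w\<close> that again lies in the polar.
  The weighted inequality for \<open>w\<close> then bounds \<open>\<integral>\<bar>Tf\<bar>\<^sup>s h\<close> by a multiple of the norm of \<open>\<bar>f\<bar>\<^sup>s\<close>, and
  the supremum over \<open>h\<close> is the norm of \<open>\<bar>Tf\<bar>\<^sup>s\<close>.

  Three facts carry this argument.

  \<^item> \<open>bipolar\<close>: a solid convex set of nonnegative functions that is closed under increasing limits is
    determined by its polar. The separating function is the difference between a point
    and its nearest point of the set in \<open>L\<^sup>2\<close>. It is used for the unit ball of \<open>Y\<close>, where
    it gives \<open>\<parallel>\<chi>\<^sub>B\<parallel>\<^sub>Y \<parallel>\<chi>\<^sub>B\<parallel>\<^sub>Y\<^sub>' \<le> C\<bar>B\<bar>\<close>, and for the unit ball of the Herz space.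

  \<^item> \<open>maximal_bounded_on_polar\<close>: \<open>M\<close> maps the polar of the Herz ball into a multiple of itself.
    Cutting functions into annular pieces turns \<open>M\<close> into a matrix of blocks. The blocks near the
    diagonal are bounded because \<open>M\<close> is bounded on \<open>Y'\<close>; the other ones decay geometrically,
    with the rates \<open>n\<delta>\<^sub>Y\<close> and \<open>n\<delta>\<^sub>Y\<^sub>'\<close> on the two sides, and the bounds on \<open>s\<alpha>\<close> say
    that this decay beats the growth of the Herz weights.

  \<^item> \<open>A1_majorant\<close>: the geometric series of the iterates \<open>M\<^sup>i h\<close> is the weight \<open>w\<close>.

  The constant in the weighted inequality may depend on \<open>w\<close> in an arbitrary way, so it has to be made
  uniform in \<open>h\<close>. In \<open>extrapolation\<close> this is done by contradiction: a sequence of worse and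
  worse triples \<open>(f\<^sub>j, Tf\<^sub>j, h\<^sub>j)\<close> is tested against a single weight that dominates a multiple of
  each \<open>h\<^sub>j\<close>, namely a majorant of \<open>\<Sum> 2\<^sup>-\<^sup>j h\<^sub>j\<close>.
\<close>



section \<open>A bipolar theorem for solid convex sets\<close>

definition nonneg_measurable :: "'a measure \<Rightarrow> ('a \<Rightarrow> real) set"
  where "nonneg_measurable M = {f \<in> borel_measurable M. \<forall>x. 0 \<le> f x}"

lemma nonneg_measurableI:
  "f \<in> borel_measurable M \<Longrightarrow> (\<And>x. 0 \<le> f x) \<Longrightarrow> f \<in> nonneg_measurable M"
  by (simp add: nonneg_measurable_def)

lemma nonneg_measurableD:
  assumes "f \<in> nonneg_measurable M"
  shows "f \<in> borel_measurable M" "0 \<le> f x"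
  using assms by (simp_all add: nonneg_measurable_def)

text \<open>Turns a geometric rate in \<open>L\<^sup>2\<close> into pointwise convergence of a whole sequence: the bound
  \<open>\<bar>d\<bar> \<le> 2\<^sup>-\<^sup>n + 2\<^sup>n d\<^sup>2\<close> gives up a factor \<open>2\<^sup>n\<close> against the decay \<open>4\<^sup>-\<^sup>n\<close>.\<close>

lemma AE_summable_if_square_integral_geometric:
  fixes d :: "nat \<Rightarrow> 'a \<Rightarrow> real"
  assumes [measurable]: "\<And>n. d n \<in> borel_measurable M"
    and bound: "\<And>n. (\<integral>\<^sup>+x. ennreal ((d n x)\<^sup>2) \<partial>M) \<le> ennreal (4 * (1/4) ^ n)"
  shows "AE x in M. summable (\<lambda>n. d n x)"
proof -
  have "(\<integral>\<^sup>+x. (\<Sum>n. ennreal (2 ^ n * (d n x)\<^sup>2)) \<partial>M) = (\<Sum>n. \<integral>\<^sup>+x. ennreal (2 ^ n * (d n x)\<^sup>2) \<partial>M)"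
    by (rule nn_integral_suminf) simp
  also have "\<dots> = (\<Sum>n. ennreal (2 ^ n) * (\<integral>\<^sup>+x. ennreal ((d n x)\<^sup>2) \<partial>M))"
    by (simp add: ennreal_mult nn_integral_cmult)
  also have "\<dots> \<le> (\<Sum>n. ennreal (4 * (1/2) ^ n))"
  proof (intro suminf_le summableI)
    fix n
    have "ennreal (2 ^ n) * (\<integral>\<^sup>+x. ennreal ((d n x)\<^sup>2) \<partial>M) \<le> ennreal (2 ^ n) * ennreal (4 * (1/4) ^ n)"
      by (intro mult_left_mono bound) simp
    also have "\<dots> = ennreal (4 * (1/2) ^ n)"
    proof -
      have "(2::real) ^ n * (1/4) ^ n = (1/2) ^ n"
        by (simp only: power_mult_distrib [symmetric]) simp
      then have "(2::real) ^ n * (4 * (1/4) ^ n) = 4 * (1/2) ^ n"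
        by (simp only: mult.left_commute)
      then show ?thesis by (metis ennreal_mult'' mult_nonneg_nonneg zero_le_numeral zero_le_power zero_le_divide_1_iff)
    qed
    finally show "ennreal (2 ^ n) * (\<integral>\<^sup>+x. ennreal ((d n x)\<^sup>2) \<partial>M) \<le> ennreal (4 * (1/2) ^ n)" .
  qed
  also have "\<dots> = ennreal (\<Sum>n. 4 * (1/2) ^ n)"
    by (rule suminf_ennreal2) (auto intro!: summable_mult summable_geometric)
  also have "\<dots> < \<infinity>" by simp
  finally have "(\<integral>\<^sup>+x. (\<Sum>n. ennreal (2 ^ n * (d n x)\<^sup>2)) \<partial>M) \<noteq> \<infinity>" by simp
  then have "AE x in M. (\<Sum>n. ennreal (2 ^ n * (d n x)\<^sup>2)) \<noteq> \<infinity>"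
    by (intro nn_integral_PInf_AE) simp_all
  then show ?thesis
  proof eventually_elim
    case (elim x)
    then have "summable (\<lambda>n. 2 ^ n * (d n x)\<^sup>2)"
      by (intro summable_suminf_not_top) auto
    then have s: "summable (\<lambda>n. (1/2) ^ n + 2 ^ n * (d n x)\<^sup>2)"
      by (intro summable_add summable_geometric) auto
    show ?case
    proof (rule summable_comparison_test' [OF s, of 0])
      fix n :: nat
      \<comment> \<open>Young's inequality with the weight \<open>2 ^ n\<close>\<close>
      have "0 \<le> ((1/2) ^ n) * (1 - 2 ^ n * \<bar>d n x\<bar>)\<^sup>2" by simp
      also have "\<dots> = (1/2) ^ n + 2 ^ n * (d n x)\<^sup>2 - 2 * \<bar>d n x\<bar>"
      proof -
        have "(2::real) ^ n * (1/2) ^ n = 1"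
          by (simp only: power_mult_distrib [symmetric]) simp
        then have "b * (1 - a * \<bar>y\<bar>)\<^sup>2 = b + a * y\<^sup>2 - 2 * \<bar>y\<bar>" if "a = 2 ^ n" "b = (1/2) ^ n" for a b y :: real
          proof -
          have "b * (1 - a * z)\<^sup>2 = b + a * z\<^sup>2 - 2 * z" if "a * b = 1" for a b z :: real
            using that by algebra
          from this[of a b "\<bar>y\<bar>"] show ?thesis
            using that \<open>2 ^ n * (1/2) ^ n = 1\<close> by (simp add: power2_abs)
        qed
        then show ?thesis by blast
      qed
      finally show "norm (d n x) \<le> (1/2) ^ n + 2 ^ n * (d n x)\<^sup>2" by auto
    qed
  qed
qed

lemma real_nonpos_if_le_multiple:
  fixes a b :: real
  assumes "\<And>t. 0 < t \<Longrightarrow> t \<le> 1 \<Longrightarrow> a \<le> t * b"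
  shows "a \<le> 0"
proof (rule ccontr)
  assume "\<not> a \<le> 0"
  then have a: "a > 0" by simp
  define t where "t = min 1 (a / (2 * (\<bar>b\<bar> + 1)))"
  have t: "0 < t" "t \<le> 1" using a by (auto simp: t_def)
  have "t * b \<le> t * (\<bar>b\<bar> + 1)" using t by (intro mult_left_mono) auto
  also have "\<dots> \<le> (a / (2 * (\<bar>b\<bar> + 1))) * (\<bar>b\<bar> + 1)"
    by (intro mult_right_mono) (auto simp: t_def)
  also have "\<dots> = a / 2" by (simp add: field_simps)
  finally show False using assms[OF t] a by simp
qed

text \<open>Members of the polar take values in \<open>[0, \<infinity>]\<close>, because maximal functions do.\<close>

definition polar :: "'a measure \<Rightarrow> ('a \<Rightarrow> real) set \<Rightarrow> ('a \<Rightarrow> ennreal) set"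
  where "polar M U = {h \<in> borel_measurable M. \<forall>f\<in>U. (\<integral>\<^sup>+x. ennreal (f x) * h x \<partial>M) \<le> 1}"

lemma polarI:
  assumes "h \<in> borel_measurable M" "\<And>f. f \<in> U \<Longrightarrow> (\<integral>\<^sup>+x. ennreal (f x) * h x \<partial>M) \<le> 1"
  shows "h \<in> polar M U"
  using assms by (simp add: polar_def)

lemma polarD:
  assumes "h \<in> polar M U"
  shows "h \<in> borel_measurable M" "f \<in> U \<Longrightarrow> (\<integral>\<^sup>+x. ennreal (f x) * h x \<partial>M) \<le> 1"
  using assms by (simp_all add: polar_def)

text \<open>The properties of the unit ball of a lattice norm with the Fatou property, stated for the
  nonnegative functions in it.\<close>

locale solid_convex_set =
  fixes M :: "'a measure" and U :: "('a \<Rightarrow> real) set"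
  assumes nonneg: "U \<subseteq> nonneg_measurable M"
    and zero: "(\<lambda>x. 0) \<in> U"
    and convex: "\<And>f g t. f \<in> U \<Longrightarrow> g \<in> U \<Longrightarrow> 0 \<le> t \<Longrightarrow> t \<le> 1 \<Longrightarrow>
      (\<lambda>x. (1 - t) * f x + t * g x) \<in> U"
    and solid: "\<And>f g. f \<in> U \<Longrightarrow> g \<in> nonneg_measurable M \<Longrightarrow> AE x in M. g x \<le> f x \<Longrightarrow> g \<in> U"
    and Fatou: "\<And>u v. (\<And>m. u m \<in> U) \<Longrightarrow> v \<in> nonneg_measurable M \<Longrightarrow>
      AE x in M. incseq (\<lambda>m. u m x) \<and> (\<lambda>m. u m x) \<longlonglongrightarrow> v x \<Longrightarrow> v \<in> U"
begin

lemma measurable_U: "f \<in> U \<Longrightarrow> f \<in> borel_measurable M"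
  using nonneg by (auto simp: nonneg_measurable_def)

lemma nonneg_U: "f \<in> U \<Longrightarrow> 0 \<le> f x"
  using nonneg by (auto simp: nonneg_measurable_def)

text \<open>The infima of the tails of \<open>u\<close> increase to the limit, and they belong to \<open>U\<close> by solidity.\<close>

lemma closed_AE_limit:
  assumes u: "\<And>m. u m \<in> U" and v: "v \<in> nonneg_measurable M"
    and lim: "AE x in M. (\<lambda>m. u m x) \<longlonglongrightarrow> v x"
  shows "v \<in> U"
proof -
  define l where "l m x = (INF k\<in>{m..}. u k x)" for m x
  have bdd: "bdd_below ((\<lambda>k. u k x) ` A)" for x A
    using nonneg_U[OF u] by (intro bdd_belowI2[of _ 0]) auto
  have l_le: "l m x \<le> u k x" if "m \<le> k" for m k x
    unfolding l_def using that by (intro cINF_lower bdd) auto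
  have l_ge: "c \<le> l m x" if "\<And>k. m \<le> k \<Longrightarrow> c \<le> u k x" for c m x
    unfolding l_def using that by (intro cINF_greatest) auto
  have lU: "l m \<in> U" for m
  proof (rule solid[OF u[of m]])
    have "l m \<in> borel_measurable M"
      unfolding l_def by (intro borel_measurable_cINF_real measurable_U u) auto
    then show "l m \<in> nonneg_measurable M"
      by (intro nonneg_measurableI l_ge nonneg_U u)
  qed (use l_le in auto)
  have "AE x in M. incseq (\<lambda>m. l m x) \<and> (\<lambda>m. l m x) \<longlonglongrightarrow> v x"
    using lim
  proof eventually_elim
    case (elim x)
    have "incseq (\<lambda>m. l m x)"
      by (intro incseq_SucI l_ge l_le) auto
    moreover have "(\<lambda>m. l m x) \<longlonglongrightarrow> v x"
    proof (rule LIMSEQ_I)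
      fix e :: real assume e: "e > 0"
      obtain n0 where n0: "\<And>n. n \<ge> n0 \<Longrightarrow> norm (u n x - v x) < e / 2"
        using LIMSEQ_D[OF elim, of "e/2"] e by auto
      show "\<exists>n0. \<forall>n\<ge>n0. norm (l n x - v x) < e"
      proof (intro exI allI impI)
        fix n assume n: "n \<ge> n0"
        have "l n x \<le> u n x" by (rule l_le) simp
        moreover have "v x - e / 2 \<le> l n x"
        proof (rule l_ge)
          fix k assume "n \<le> k"
          then show "v x - e / 2 \<le> u k x"
            using n0[of k] n unfolding real_norm_def by linarith
        qed
        ultimately show "norm (l n x - v x) < e"
          using n0[OF n] e unfolding real_norm_def by linarith
      qed
    qed
    ultimately show ?case ..
  qed
  from Fatou[of l v, OF lU v this] show ?thesis .
qed

text \<open>By the parallelogram identity a minimising sequence is Cauchy in \<open>L\<^sup>2\<close>; its pointwise limit stays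
  in \<open>U\<close>. Competitors are restricted to functions below \<open>g\<close>, so that \<open>g\<^sup>2\<close> dominates all
  integrands.\<close>

lemma nearest_point:
  assumes g: "g \<in> nonneg_measurable M" and g2: "integrable M (\<lambda>x. (g x)\<^sup>2)"
  obtains f0 where "f0 \<in> U" "\<And>x. f0 x \<le> g x"
    "\<And>f. f \<in> U \<Longrightarrow> (\<And>x. f x \<le> g x) \<Longrightarrow> (LINT x|M. (g x - f0 x)\<^sup>2) \<le> (LINT x|M. (g x - f x)\<^sup>2)"
proof -
  note [measurable] = nonneg_measurableD(1)[OF g]
  define D where "D = {f \<in> U. \<forall>x. f x \<le> g x}"
  define J where "J f = (LINT x|M. (g x - f x)\<^sup>2)" for f
  have D_meas [measurable]: "f \<in> borel_measurable M" if "f \<in> D" for f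
    using that measurable_U by (auto simp: D_def)
  have D_bd: "0 \<le> f x" "f x \<le> g x" if "f \<in> D" for f x
    using that nonneg_U by (auto simp: D_def)
  have dist_sq_le: "(g x - f x)\<^sup>2 \<le> (g x)\<^sup>2" if "f \<in> D" for f x
    using D_bd[OF that, of x] by (intro power_mono) auto
  have int: "integrable M (\<lambda>x. (g x - f x)\<^sup>2)" if "f \<in> D" for f
    using that dist_sq_le[OF that]
    by (intro Bochner_Integration.integrable_bound[OF g2]) auto
  have mid: "(\<lambda>x. (f x + h x) / 2) \<in> D" if "f \<in> D" "h \<in> D" for f h
  proof -
    have "(\<lambda>x. (1 - 1/2) * f x + (1/2) * h x) \<in> U"
      using that by (intro convex) (auto simp: D_def)
    moreover have "(\<lambda>x. (1 - 1/2) * f x + (1/2) * h x) = (\<lambda>x. (f x + h x) / 2)"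
      by (auto simp: field_simps)
    ultimately have "(\<lambda>x. (f x + h x) / 2) \<in> U" by simp
    moreover have "(f x + h x) / 2 \<le> g x" for x
      using D_bd(2)[OF that(1), of x] D_bd(2)[OF that(2), of x] by simp
    ultimately show ?thesis by (simp add: D_def)
  qed
  have zD: "(\<lambda>x. 0) \<in> D" using zero nonneg_measurableD[OF g] by (auto simp: D_def)
  define d where "d = Inf (J ` D)"
  have bdd: "bdd_below (J ` D)" unfolding J_def by (intro bdd_belowI2[of _ 0]) simp
  have d_le: "d \<le> J f" if "f \<in> D" for f
    unfolding d_def using that bdd by (intro cInf_lower) auto
  have "\<exists>f\<in>D. J f < d + (1/4) ^ n" for n :: nat
  proof -
    have "Inf (J ` D) < d + (1/4) ^ n" unfolding d_def by simp
    then show ?thesis using cInf_lessD[of "J ` D"] zD by auto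
  qed
  then obtain f where fD: "\<And>n. f n \<in> D" and Jf: "\<And>n. J (f n) < d + (1/4) ^ n"
    by metis
  note fD [measurable]
  have step: "(\<integral>\<^sup>+x. ennreal ((f (Suc n) x - f n x)\<^sup>2) \<partial>M) \<le> ennreal (4 * (1/4) ^ n)" for n
  proof -
    \<comment> \<open>the parallelogram identity for \<open>g - f n\<close> and \<open>g - f (Suc n)\<close>\<close>
    have eq: "(f (Suc n) x - f n x)\<^sup>2 = 2 * (g x - f n x)\<^sup>2 + 2 * (g x - f (Suc n) x)\<^sup>2
        - 4 * (g x - (f n x + f (Suc n) x) / 2)\<^sup>2" for x
      by (simp add: power2_eq_square field_simps)
    note i = int[OF fD[of n]] int[OF fD[of "Suc n"]] int[OF mid[OF fD[of n] fD[of "Suc n"]]]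
    have "integrable M (\<lambda>x. (f (Suc n) x - f n x)\<^sup>2)"
      unfolding eq using i by (intro Bochner_Integration.integrable_diff Bochner_Integration.integrable_add
          integrable_mult_right) auto
    then have "(\<integral>\<^sup>+x. ennreal ((f (Suc n) x - f n x)\<^sup>2) \<partial>M) = ennreal (LINT x|M. (f (Suc n) x - f n x)\<^sup>2)"
      by (intro nn_integral_eq_integral) auto
    also have "(LINT x|M. (f (Suc n) x - f n x)\<^sup>2)
        = 2 * J (f n) + 2 * J (f (Suc n)) - 4 * J (\<lambda>x. (f n x + f (Suc n) x) / 2)"
      unfolding eq J_def using i by simp
    also have "\<dots> \<le> 4 * (1/4) ^ n"
    proof -
      have "J (f (Suc n)) \<le> d + (1/4) ^ n"
        using Jf[of "Suc n"] zero_le_power[of "1/4::real" n] by (simp add: field_simps)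
      then show ?thesis using Jf[of n] d_le[OF mid[OF fD[of n] fD[of "Suc n"]]] by linarith
    qed
    finally show ?thesis by (simp add: ennreal_leI)
  qed
  have conv: "AE x in M. convergent (\<lambda>n. f n x)"
  proof -
    have "AE x in M. summable (\<lambda>n. f (Suc n) x - f n x)"
      by (rule AE_summable_if_square_integral_geometric) (use step in auto)
    then show ?thesis
    proof eventually_elim
      case (elim x)
      then have "convergent (\<lambda>n. f 0 x + (\<Sum>i<n. f (Suc i) x - f i x))"
        by (simp add: summable_iff_convergent convergent_add_const_iff)
      moreover have "f 0 x + (\<Sum>i<n. f (Suc i) x - f i x) = f n x" for n
        by (induction n) auto
      ultimately show ?case by simp
    qed
  qed
  define f0 where "f0 x = max 0 (min (g x) (lim (\<lambda>n. f n x)))" for x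
  have lim: "AE x in M. (\<lambda>n. f n x) \<longlonglongrightarrow> f0 x"
    using conv
  proof eventually_elim
    case (elim x)
    then have l: "(\<lambda>n. f n x) \<longlonglongrightarrow> lim (\<lambda>n. f n x)"
      by (simp add: convergent_LIMSEQ_iff)
    have "0 \<le> lim (\<lambda>n. f n x)" "lim (\<lambda>n. f n x) \<le> g x"
      using D_bd[OF fD] by (auto intro: LIMSEQ_le_const[OF l] LIMSEQ_le_const2[OF l])
    then show ?case using l by (simp add: f0_def)
  qed
  have f0_meas [measurable]: "f0 \<in> borel_measurable M"
    unfolding f0_def by measurable
  have f0_le: "f0 x \<le> g x" for x using nonneg_measurableD(2)[OF g] by (simp add: f0_def)
  have f0U: "f0 \<in> U"
  proof (rule closed_AE_limit[OF _ _ lim])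
    show "f0 \<in> nonneg_measurable M" by (rule nonneg_measurableI) (auto simp: f0_def)
  qed (use fD in \<open>auto simp: D_def\<close>)
  have "(\<lambda>n. J (f n)) \<longlonglongrightarrow> J f0"
    unfolding J_def
  proof (rule integral_dominated_convergence[OF _ _ g2])
    show "AE x in M. (\<lambda>i. (g x - f i x)\<^sup>2) \<longlonglongrightarrow> (g x - f0 x)\<^sup>2"
      using lim by eventually_elim (auto intro!: tendsto_intros)
  qed (use dist_sq_le[OF fD] in auto)
  moreover have "(\<lambda>n. d + (1/4) ^ n) \<longlonglongrightarrow> d + 0"
    by (intro tendsto_intros LIMSEQ_power_zero) auto
  ultimately have "J f0 \<le> d"
    using Jf by (intro LIMSEQ_le[of "\<lambda>n. J (f n)" _ "\<lambda>n. d + (1/4) ^ n"]) (auto intro: less_imp_le)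
  show ?thesis
  proof (rule that[OF f0U f0_le])
    fix f assume "f \<in> U" "\<And>x. f x \<le> g x"
    then have "d \<le> J f" by (intro d_le) (simp add: D_def)
    with \<open>J f0 \<le> d\<close> show "(LINT x|M. (g x - f0 x)\<^sup>2) \<le> (LINT x|M. (g x - f x)\<^sup>2)"
      by (simp add: J_def)
  qed
qed

text \<open>The separating function is \<open>h = g - f0\<close> with \<open>f0\<close> the point of \<open>U\<close> nearest to \<open>g\<close>: moving from
  \<open>f0\<close> towards \<open>f \<in> U\<close> does not decrease the distance to \<open>g\<close>, and the first-order condition reads
  \<open>\<integral>h(f - f0) \<le> 0\<close>. It suffices to consider \<open>f\<close> below a multiple of \<open>g\<close>, since
  \<open>h\<close> vanishes wherever \<open>g\<close> does.\<close>

lemma separation_square_integrable: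
  assumes g: "g \<in> nonneg_measurable M" and g2: "integrable M (\<lambda>x. (g x)\<^sup>2)" and gU: "g \<notin> U"
  obtains h where "h \<in> nonneg_measurable M"
    "\<And>f. f \<in> U \<Longrightarrow> (\<integral>\<^sup>+x. ennreal (f x * h x) \<partial>M) \<le> 1"
    "1 < (\<integral>\<^sup>+x. ennreal (g x * h x) \<partial>M)"
proof -
  note g_meas [measurable] = nonneg_measurableD(1)[OF g] and g_nn = nonneg_measurableD(2)[OF g]
  obtain f0 where f0: "f0 \<in> U" "\<And>x. f0 x \<le> g x"
    and nearest: "\<And>f. f \<in> U \<Longrightarrow> (\<And>x. f x \<le> g x) \<Longrightarrow>
      (LINT x|M. (g x - f0 x)\<^sup>2) \<le> (LINT x|M. (g x - f x)\<^sup>2)"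
    using nearest_point[OF g g2] by blast
  note f0_meas [measurable] = measurable_U[OF f0(1)] and f0_nn = nonneg_U[OF f0(1)]
  define h where "h x = g x - f0 x" for x
  have h_meas [measurable]: "h \<in> borel_measurable M" unfolding h_def by measurable
  have h_nn: "0 \<le> h x" and h_le: "h x \<le> g x" for x
    using f0(2)[of x] f0_nn[of x] by (auto simp: h_def)
  have int: "integrable M (\<lambda>x. a x * b x)"
    if [measurable]: "a \<in> borel_measurable M" "b \<in> borel_measurable M"
      and a: "\<And>x. \<bar>a x\<bar> \<le> c * g x" and b: "\<And>x. \<bar>b x\<bar> \<le> c' * g x" for a b c c'
  proof (rule Bochner_Integration.integrable_bound)
    show "integrable M (\<lambda>x. c * c' * (g x)\<^sup>2)" using g2 by simp
    show "AE x in M. norm (a x * b x) \<le> norm (c * c' * (g x)\<^sup>2)"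
    proof (rule AE_I2)
      fix x
      have "\<bar>a x\<bar> * \<bar>b x\<bar> \<le> (c * g x) * (c' * g x)"
        by (rule mult_mono) (use a[of x] b[of x] in \<open>auto intro: order_trans[OF abs_ge_zero]\<close>)
      also have "\<dots> \<le> \<bar>c * c' * (g x)\<^sup>2\<bar>" by (simp add: power2_eq_square ac_simps)
      finally show "norm (a x * b x) \<le> norm (c * c' * (g x)\<^sup>2)"
        by (simp add: abs_mult)
    qed
  qed measurable
  define \<beta> where "\<beta> = (LINT x|M. f0 x * h x)"
  define \<gamma> where "\<gamma> = (LINT x|M. h x * h x)"
  have i0: "integrable M (\<lambda>x. f0 x * h x)" and ihh: "integrable M (\<lambda>x. h x * h x)"
    and igh: "integrable M (\<lambda>x. g x * h x)"
    by (rule int[of _ _ 1 1]; use f0_nn f0(2) h_nn h_le g_nn in simp)+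
  have \<beta>: "0 \<le> \<beta>" unfolding \<beta>_def using f0_nn h_nn by (intro integral_nonneg_AE) auto
  have \<gamma>: "0 < \<gamma>"
  proof (rule ccontr)
    assume "\<not> 0 < \<gamma>"
    moreover have "0 \<le> \<gamma>" unfolding \<gamma>_def by (intro integral_nonneg_AE) auto
    ultimately have "\<gamma> = 0" by simp
    then have "AE x in M. h x * h x = 0"
      using integral_nonneg_eq_0_iff_AE[OF ihh] by (simp add: \<gamma>_def)
    then have "AE x in M. g x \<le> f0 x" by eventually_elim (simp add: h_def)
    with solid[OF f0(1) g] gU show False by blast
  qed
  have variation: "(LINT x|M. f x * h x) \<le> \<beta>" if f: "f \<in> U" and fg: "\<And>x. f x \<le> c * g x" for f c
  proof -
    note [measurable] = measurable_U[OF f]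
    have fnn: "0 \<le> f x" for x by (rule nonneg_U[OF f])
    have diff_le: "\<bar>f x - f0 x\<bar> \<le> (\<bar>c\<bar> + 1) * g x" for x
    proof -
      have "c * g x \<le> \<bar>c\<bar> * g x" using g_nn[of x] by (intro mult_right_mono) auto
      then show ?thesis
        using fg[of x] fnn[of x] f0_nn[of x] f0(2)[of x] by (auto simp: abs_le_iff distrib_right)
    qed
    have ifh: "integrable M (\<lambda>x. f x * h x)"
      by (rule int[of _ _ c 1]) (use fnn fg h_nn h_le in auto)
    have idd: "integrable M (\<lambda>x. (f x - f0 x) * (f x - f0 x))"
      by (rule int[of _ _ "\<bar>c\<bar> + 1" "\<bar>c\<bar> + 1"]) (use diff_le in auto)
    have ihd: "integrable M (\<lambda>x. h x * (f x - f0 x))"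
      by (rule int[of _ _ 1 "\<bar>c\<bar> + 1"]) (use diff_le h_nn h_le in auto)
    define V where "V = (LINT x|M. (f x - f0 x) * (f x - f0 x))"
    define W where "W = (LINT x|M. h x * (f x - f0 x))"
    have "2 * W \<le> t * V" if t: "0 < t" "t \<le> 1" for t
    proof -
      define e where "e x = (1 - t) * f0 x + t * f x" for x
      have eU: "e \<in> U" unfolding e_def using t by (intro convex f0 f) auto
      note [measurable] = measurable_U[OF eU]
      have enn: "0 \<le> e x" for x by (rule nonneg_U[OF eU])
      \<comment> \<open>cutting off at \<open>g\<close> makes the perturbed point an admissible competitor and brings it closer to \<open>g\<close>\<close>
      have mU: "(\<lambda>x. min (e x) (g x)) \<in> U"
        using enn g_nn by (intro solid[OF eU] nonneg_measurableI) auto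
      have e_h: "g x - e x = h x - t * (f x - f0 x)" for x
        by (simp add: e_def h_def algebra_simps)
      have expand: "(g x - e x)\<^sup>2 = h x * h x - 2 * t * (h x * (f x - f0 x))
          + t\<^sup>2 * ((f x - f0 x) * (f x - f0 x))" for x
        unfolding e_h by (simp add: power2_eq_square algebra_simps)
      have ie: "integrable M (\<lambda>x. (g x - e x)\<^sup>2)"
        unfolding expand using ihh idd ihd
        by (intro Bochner_Integration.integrable_add Bochner_Integration.integrable_diff integrable_mult_right)
      have "\<gamma> \<le> (LINT x|M. (g x - min (e x) (g x))\<^sup>2)"
        using nearest[OF mU] by (simp add: \<gamma>_def h_def power2_eq_square)
      also have "\<dots> \<le> (LINT x|M. (g x - e x)\<^sup>2)"
      proof (rule integral_mono'[OF ie])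
        fix x show "(g x - min (e x) (g x))\<^sup>2 \<le> (g x - e x)\<^sup>2"
          by (auto simp: min_def)
      qed auto
      also have "\<dots> = \<gamma> - 2 * t * W + t\<^sup>2 * V"
        unfolding expand \<gamma>_def V_def W_def using ihh idd ihd by simp
      finally have "t * (2 * W) \<le> t * (t * V)" by (simp add: power2_eq_square)
      then show ?thesis using t by simp
    qed
    then have "2 * W \<le> 0" by (rule real_nonpos_if_le_multiple)
    moreover have "W = (LINT x|M. f x * h x - f0 x * h x)"
      unfolding W_def by (intro Bochner_Integration.integral_cong) (auto simp: algebra_simps)
    then have "W = (LINT x|M. f x * h x) - \<beta>"
      using ifh i0 by (simp add: \<beta>_def)
    ultimately show ?thesis by simp
  qed
  have all: "(\<integral>\<^sup>+x. ennreal (f x * h x) \<partial>M) \<le> ennreal \<beta>" if f: "f \<in> U" for f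
  proof -
    note [measurable] = measurable_U[OF f]
    have fnn: "0 \<le> f x" for x by (rule nonneg_U[OF f])
    define F where "F n x = min (f x) (real n * g x)" for n :: nat and x
    have [measurable]: "F n \<in> borel_measurable M" for n unfolding F_def by measurable
    have FU: "F n \<in> U" for n
      unfolding F_def using fnn g_nn by (intro solid[OF f] nonneg_measurableI) auto
    have Fh: "F n x * h x \<le> F (Suc n) x * h x" for n x
      using g_nn[of x] h_nn[of x] by (intro mult_right_mono) (auto simp: F_def min_def mult_right_mono distrib_right)
    have le: "(\<integral>\<^sup>+x. ennreal (F n x * h x) \<partial>M) \<le> ennreal \<beta>" for n
    proof -
      have "integrable M (\<lambda>x. F n x * h x)"
        by (rule int[of _ _ "real n" 1]) (use h_nn h_le nonneg_U[OF FU] in \<open>auto simp: F_def\<close>)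
      then have "(\<integral>\<^sup>+x. ennreal (F n x * h x) \<partial>M) = ennreal (LINT x|M. F n x * h x)"
        using nonneg_U[OF FU] h_nn by (intro nn_integral_eq_integral) auto
      also have "\<dots> \<le> ennreal \<beta>"
        by (intro ennreal_leI variation[OF FU, of _ "real n"]) (simp add: F_def)
      finally show ?thesis .
    qed
    have "(\<integral>\<^sup>+x. ennreal (f x * h x) \<partial>M) = (\<integral>\<^sup>+x. (SUP n. ennreal (F n x * h x)) \<partial>M)"
    proof (intro nn_integral_cong)
      fix x
      obtain n :: nat where n: "f x * h x \<le> F n x * h x"
      proof (cases "g x = 0")
        case True
        then have "h x = 0" using h_nn[of x] h_le[of x] by simp
        then show ?thesis by (intro that[of 0]) simp
      next
        case False
        then have "g x > 0" using g_nn[of x] by simp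
        then obtain n :: nat where "f x < real n * g x"
          using ex_less_of_nat_mult by blast
        then show ?thesis by (intro that[of n]) (simp add: F_def)
      qed
      show "ennreal (f x * h x) = (SUP n. ennreal (F n x * h x))"
      proof (rule antisym)
        show "ennreal (f x * h x) \<le> (SUP n. ennreal (F n x * h x))"
          using n by (intro SUP_upper2[of n] ennreal_leI) auto
        show "(SUP n. ennreal (F n x * h x)) \<le> ennreal (f x * h x)"
          using h_nn[of x] by (intro SUP_least ennreal_leI mult_right_mono) (auto simp: F_def)
      qed
    qed
    also have "\<dots> = (SUP n. \<integral>\<^sup>+x. ennreal (F n x * h x) \<partial>M)"
      by (rule nn_integral_monotone_convergence_SUP) (auto intro!: incseq_SucI le_funI ennreal_leI Fh)
    also have "\<dots> \<le> ennreal \<beta>" by (intro SUP_least le)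
    finally show ?thesis .
  qed
  have "(LINT x|M. g x * h x) = (LINT x|M. f0 x * h x + h x * h x)"
    by (intro Bochner_Integration.integral_cong) (auto simp: h_def algebra_simps)
  then have gh: "(LINT x|M. g x * h x) = \<beta> + \<gamma>"
    using i0 ihh by (simp add: \<beta>_def \<gamma>_def)
  \<comment> \<open>\<open>h\<close> separates \<open>g\<close> from \<open>U\<close> at a level between \<open>\<beta>\<close> and \<open>\<beta> + \<gamma>\<close>; rescaling moves that level to \<open>1\<close>.\<close>
  define c where "c = 1 / (\<beta> + \<gamma> / 2)"
  have c: "0 < c" "c * \<beta> \<le> 1" "1 < c * (\<beta> + \<gamma>)"
    using \<beta> \<gamma> by (auto simp: c_def field_simps)
  have scale: "(\<integral>\<^sup>+x. ennreal (f x * (c * h x)) \<partial>M) = ennreal c * (\<integral>\<^sup>+x. ennreal (f x * h x) \<partial>M)"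
    if [measurable]: "f \<in> borel_measurable M" for f
    using c by (subst nn_integral_cmult [symmetric]) (auto simp: ennreal_mult' [symmetric] ac_simps)
  show ?thesis
  proof (rule that[of "\<lambda>x. c * h x"])
    show "(\<lambda>x. c * h x) \<in> nonneg_measurable M"
      using c h_nn by (intro nonneg_measurableI) auto
    show "(\<integral>\<^sup>+x. ennreal (f x * (c * h x)) \<partial>M) \<le> 1" if f: "f \<in> U" for f
    proof -
      have "ennreal c * (\<integral>\<^sup>+x. ennreal (f x * h x) \<partial>M) \<le> ennreal c * ennreal \<beta>"
        by (intro mult_left_mono all f) simp
      also have "\<dots> = ennreal (c * \<beta>)" using c \<beta> by (simp add: ennreal_mult)
      also have "\<dots> \<le> 1" using c by (simp add: ennreal_le_1)
      finally show ?thesis using scale[OF measurable_U[OF f]] by simp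
    qed
    have "(\<integral>\<^sup>+x. ennreal (g x * h x) \<partial>M) = ennreal (\<beta> + \<gamma>)"
      unfolding gh [symmetric] using g_nn h_nn by (intro nn_integral_eq_integral igh) auto
    then have "(\<integral>\<^sup>+x. ennreal (g x * (c * h x)) \<partial>M) = ennreal (c * (\<beta> + \<gamma>))"
      using scale[OF g_meas] c \<beta> \<gamma> by (simp add: ennreal_mult)
    then show "1 < (\<integral>\<^sup>+x. ennreal (g x * (c * h x)) \<partial>M)"
      using c by (simp flip: ennreal_1 add: ennreal_less_iff)
  qed
qed

text \<open>Reduction to \<open>L\<^sup>2\<close>: \<open>g\<close> is the increasing limit of its truncations to bounded functions on sets of
  finite measure, so one of these is already outside of \<open>U\<close>, and what separates it separates \<open>g\<close>.\<close>

theorem bipolar: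
  assumes "sigma_finite_measure M"
    and g: "g \<in> nonneg_measurable M" and gU: "g \<notin> U"
  obtains h where "h \<in> polar M U" "1 < (\<integral>\<^sup>+x. ennreal (g x) * h x \<partial>M)"
proof -
  interpret sigma_finite_measure M by fact
  note g_meas [measurable] = nonneg_measurableD(1)[OF g] and g_nn = nonneg_measurableD(2)[OF g]
  obtain A :: "nat \<Rightarrow> 'a set" where A: "range A \<subseteq> sets M" "(\<Union>i. A i) = space M"
    "\<And>i. emeasure M (A i) \<noteq> \<infinity>" "incseq A"
    using sigma_finite_incseq by metis
  have [measurable]: "A i \<in> sets M" for i using A(1) by auto
  define G where "G i x = min (g x) (real i) * indicator (A i) x" for i x
  have G_meas [measurable]: "G i \<in> borel_measurable M" for i unfolding G_def by measurable
  have G_nn: "G i \<in> nonneg_measurable M" for i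
    using g_nn by (intro nonneg_measurableI) (auto simp: G_def)
  have G_le: "G i x \<le> g x" for i x using g_nn[of x] by (auto simp: G_def indicator_def)
  have "\<exists>i. G i \<notin> U"
  proof (rule ccontr)
    assume "\<not> ?thesis"
    then have "G i \<in> U" for i by auto
    moreover have "AE x in M. incseq (\<lambda>i. G i x) \<and> (\<lambda>i. G i x) \<longlonglongrightarrow> g x"
    proof (rule AE_I2)
      fix x assume x: "x \<in> space M"
      have "G i x \<le> G (Suc i) x" for i
        using incseq_SucD[OF A(4), of i] g_nn[of x] by (auto simp: G_def indicator_def)
      then have "incseq (\<lambda>i. G i x)" by (rule incseq_SucI)
      moreover obtain i0 where "x \<in> A i0" using x A(2) by auto
      then have in_A: "x \<in> A i" if "i \<ge> i0" for i using incseqD[OF A(4) that] by auto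
      obtain i1 :: nat where i1: "g x \<le> real i1" using real_arch_simple by blast
      have "\<forall>\<^sub>F i in sequentially. G i x = g x"
        using eventually_ge_at_top[of "max i0 i1"]
      proof eventually_elim
        case (elim i)
        then have "g x \<le> real i" using i1 by (auto intro: order_trans)
        then show ?case using elim in_A[of i] by (simp add: G_def)
      qed
      then have "(\<lambda>i. G i x) \<longlonglongrightarrow> g x" by (rule tendsto_eventually)
      ultimately show "incseq (\<lambda>i. G i x) \<and> (\<lambda>i. G i x) \<longlonglongrightarrow> g x" by simp
    qed
    ultimately have "g \<in> U" by (rule Fatou[OF _ g])
    with gU show False ..
  qed
  then obtain i where i: "G i \<notin> U" ..
  have "integrable M (\<lambda>x. (G i x)\<^sup>2)"
  proof (rule Bochner_Integration.integrable_bound)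
    have "integrable M (indicator (A i) :: 'a \<Rightarrow> real)"
      using A(3)[of i] by (simp add: less_top)
    then show "integrable M (\<lambda>x. (real i)\<^sup>2 * indicator (A i) x)" by simp
    have "norm ((G i x)\<^sup>2) \<le> norm ((real i)\<^sup>2 * indicator (A i) x)" for x
      using g_nn[of x] by (auto simp: G_def indicator_def intro!: power_mono)
    then show "AE x in M. norm ((G i x)\<^sup>2) \<le> norm ((real i)\<^sup>2 * indicator (A i) x)" by simp
  qed measurable
  then obtain h where h: "h \<in> nonneg_measurable M"
    "\<And>f. f \<in> U \<Longrightarrow> (\<integral>\<^sup>+x. ennreal (f x * h x) \<partial>M) \<le> 1"
    "1 < (\<integral>\<^sup>+x. ennreal (G i x * h x) \<partial>M)"
    using separation_square_integrable[OF G_nn _ i] by blast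
  have "(\<integral>\<^sup>+x. ennreal (G i x * h x) \<partial>M) \<le> (\<integral>\<^sup>+x. ennreal (g x * h x) \<partial>M)"
    using nonneg_measurableD(2)[OF h(1)]
    by (intro nn_integral_mono ennreal_leI mult_right_mono G_le) auto
  with h(3) have "1 < (\<integral>\<^sup>+x. ennreal (g x * h x) \<partial>M)" by (rule less_le_trans)
  then have "1 < (\<integral>\<^sup>+x. ennreal (g x) * ennreal (h x) \<partial>M)"
    using g_nn nonneg_measurableD(2)[OF h(1)] by (simp add: ennreal_mult)
  moreover have "(\<lambda>x. ennreal (h x)) \<in> polar M U"
  proof (rule polarI)
    show "(\<lambda>x. ennreal (h x)) \<in> borel_measurable M"
      using nonneg_measurableD(1)[OF h(1)] by simp
    show "(\<integral>\<^sup>+x. ennreal (f x) * ennreal (h x) \<partial>M) \<le> 1" if "f \<in> U" for f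
      using h(2)[OF that] nonneg_U[OF that] nonneg_measurableD(2)[OF h(1)] by (simp add: ennreal_mult)
  qed
  ultimately show ?thesis by (rule that[rotated])
qed

end


section \<open>The maximal function of a nonnegative function\<close>

text \<open>In this form the maximal operator can be iterated and applied to infinite series without
  any finiteness condition.\<close>

definition maximal :: "(real^'n::finite \<Rightarrow> ennreal) \<Rightarrow> real^'n \<Rightarrow> ennreal"
  where "maximal h x = (SUP (c, r)\<in>{(c, r). 0 < r \<and> x \<in> ball c r}.
    (\<integral>\<^sup>+y\<in>ball c r. h y \<partial>lebesgue) / emeasure lebesgue (ball c r))"

lemma maximal_function_eq: "maximal_function f x = maximal (\<lambda>y. ennreal (norm (f y))) x"
  unfolding maximal_function_def maximal_def ..

lemma emeasure_lebesgue_ball: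
  fixes c :: "real^'n::finite"
  assumes "0 \<le> r"
  shows "emeasure lebesgue (ball c r) = ennreal (unit_ball_vol (real CARD('n)) * r ^ CARD('n))"
  using emeasure_ball[OF assms, of c] by (simp add: emeasure_completion)

lemma emeasure_ball_neq_0:
  fixes c :: "real^'n::finite"
  shows "0 < r \<Longrightarrow> emeasure lebesgue (ball c r) \<noteq> 0"
  using less_imp_neq[OF unit_ball_vol_pos[of "real CARD('n)"]] by (subst emeasure_lebesgue_ball) auto

lemma emeasure_ball_neq_top:
  fixes c :: "real^'n::finite"
  shows "emeasure lebesgue (ball c r) \<noteq> top"
proof (cases "0 \<le> r")
  case True
  then show ?thesis by (subst emeasure_lebesgue_ball) simp_all
next
  case False
  then have "ball c r = {}" by (simp add: ball_eq_empty)
  then show ?thesis by (simp only: emeasure_empty) simp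
qed

lemma measurable_annulus [measurable]: "annulus k \<in> sets lebesgue"
  unfolding annulus_def by simp

lemma indicator_ball_measurable [measurable]:
  "indicator (ball c r) \<in> borel_measurable lebesgue"
  by (intro borel_measurable_indicator) simp

lemma average_le_maximal:
  assumes "x \<in> ball c r"
  shows "(\<integral>\<^sup>+y\<in>ball c r. h y \<partial>lebesgue) / emeasure lebesgue (ball c r) \<le> maximal h x"
proof -
  have "0 < r" using assms by (metis ball_eq_empty empty_iff not_le)
  then show ?thesis unfolding maximal_def using assms by (intro SUP_upper2[of "(c, r)"]) auto
qed

lemma ball_integral_le_maximal:
  assumes "x \<in> ball c r"
  shows "(\<integral>\<^sup>+y\<in>ball c r. h y \<partial>lebesgue) \<le> emeasure lebesgue (ball c r) * maximal h x"
proof -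
  have "0 < r" using assms by (metis ball_eq_empty empty_iff not_le)
  then have "(\<integral>\<^sup>+y\<in>ball c r. h y \<partial>lebesgue)
      = (\<integral>\<^sup>+y\<in>ball c r. h y \<partial>lebesgue) / emeasure lebesgue (ball c r) * emeasure lebesgue (ball c r)"
    using emeasure_ball_neq_0[of r c] emeasure_ball_neq_top[of c r]
    by (simp add: ennreal_divide_times ennreal_divide_self less_top del: emeasure_completion)
  also have "\<dots> \<le> maximal h x * emeasure lebesgue (ball c r)"
    by (intro mult_right_mono average_le_maximal assms) simp
  finally show ?thesis by (simp add: mult.commute)
qed

lemma maximal_least:
  assumes "\<And>c r. 0 < r \<Longrightarrow> x \<in> ball c r \<Longrightarrow>
    (\<integral>\<^sup>+y\<in>ball c r. h y \<partial>lebesgue) / emeasure lebesgue (ball c r) \<le> t"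
  shows "maximal h x \<le> t"
  unfolding maximal_def using assms by (intro SUP_least) auto

text \<open>Lower semicontinuity: a ball that witnesses a large value at \<open>x\<close> does so at all its points.\<close>

lemma borel_measurable_maximal [measurable]: "maximal h \<in> borel_measurable lebesgue"
proof -
  have "{x. t < maximal h x} = (\<Union>(c, r)\<in>{(c, r). 0 < r \<and>
      t < (\<integral>\<^sup>+y\<in>ball c r. h y \<partial>lebesgue) / emeasure lebesgue (ball c r)}. ball c r)" for t
    by (auto simp: maximal_def less_SUP_iff simp del: emeasure_completion; blast)
  then have "open {x. t < maximal h x}" for t by auto
  then have "maximal h \<in> borel_measurable lborel"
    by (intro borel_measurableI_greater) simp
  then show ?thesis by (rule measurable_completion)
qed

lemma maximal_mono_AE:
  assumes "AE y in lebesgue. h y \<le> h' y"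
  shows "maximal h x \<le> maximal h' x"
proof (rule maximal_least)
  fix c r assume "0 < r" and x: "x \<in> ball c r"
  have "(\<integral>\<^sup>+y\<in>ball c r. h y \<partial>lebesgue) \<le> (\<integral>\<^sup>+y\<in>ball c r. h' y \<partial>lebesgue)"
    using assms by (intro nn_integral_mono_AE) (auto elim!: eventually_mono simp: indicator_def)
  then show "(\<integral>\<^sup>+y\<in>ball c r. h y \<partial>lebesgue) / emeasure lebesgue (ball c r) \<le> maximal h' x"
    by (intro order_trans[OF divide_right_mono_ennreal average_le_maximal] x)
qed

lemma maximal_cong_AE:
  assumes "AE y in lebesgue. h y = h' y"
  shows "maximal h x = maximal h' x"
  using assms by (intro antisym maximal_mono_AE) (auto elim: eventually_mono)

lemma maximal_cmult_le:
  assumes [measurable]: "h \<in> borel_measurable lebesgue"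
  shows "maximal (\<lambda>y. c * h y) x \<le> c * maximal h x"
proof (rule maximal_least)
  fix a r assume x: "x \<in> ball a r"
  have "(\<integral>\<^sup>+y\<in>ball a r. c * h y \<partial>lebesgue) = c * (\<integral>\<^sup>+y\<in>ball a r. h y \<partial>lebesgue)"
    by (subst nn_integral_cmult [symmetric]) (auto simp: ac_simps)
  then show "(\<integral>\<^sup>+y\<in>ball a r. c * h y \<partial>lebesgue) / emeasure lebesgue (ball a r) \<le> c * maximal h x"
    using average_le_maximal[OF x, of h] by (simp add: ennreal_times_divide [symmetric] mult_left_mono)
qed

lemma maximal_countable_sum_le:
  assumes I: "countable I" and [measurable]: "\<And>i. i \<in> I \<Longrightarrow> h i \<in> borel_measurable lebesgue"
  shows "maximal (\<lambda>y. \<integral>\<^sup>+i. h i y \<partial>count_space I) x \<le> (\<integral>\<^sup>+i. maximal (h i) x \<partial>count_space I)"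
proof (rule maximal_least)
  fix a r assume x: "x \<in> ball a r"
  have "(\<integral>\<^sup>+y\<in>ball a r. (\<integral>\<^sup>+i. h i y \<partial>count_space I) \<partial>lebesgue)
      = (\<integral>\<^sup>+y. (\<integral>\<^sup>+i. h i y * indicator (ball a r) y \<partial>count_space I) \<partial>lebesgue)"
    by (intro nn_integral_cong nn_integral_multc [symmetric]) simp
  also have "\<dots> = (\<integral>\<^sup>+i. (\<integral>\<^sup>+y\<in>ball a r. h i y \<partial>lebesgue) \<partial>count_space I)"
    by (rule nn_integral_count_space_nn_integral[OF I]) measurable
  finally have "(\<integral>\<^sup>+y\<in>ball a r. (\<integral>\<^sup>+i. h i y \<partial>count_space I) \<partial>lebesgue) / emeasure lebesgue (ball a r)
      = (\<integral>\<^sup>+i. (\<integral>\<^sup>+y\<in>ball a r. h i y \<partial>lebesgue) / emeasure lebesgue (ball a r) \<partial>count_space I)"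
    by (simp add: divide_ennreal_def nn_integral_multc)
  also have "\<dots> \<le> (\<integral>\<^sup>+i. maximal (h i) x \<partial>count_space I)"
    by (intro nn_integral_mono average_le_maximal x)
  finally show "(\<integral>\<^sup>+y\<in>ball a r. (\<integral>\<^sup>+i. h i y \<partial>count_space I) \<partial>lebesgue) / emeasure lebesgue (ball a r)
      \<le> (\<integral>\<^sup>+i. maximal (h i) x \<partial>count_space I)" .
qed

text \<open>If \<open>M h\<close> vanishes at \<open>x\<close>, then \<open>h\<close> vanishes almost everywhere on each ball centred at \<open>x\<close>.\<close>

lemma maximal_pos:
  assumes [measurable]: "h \<in> borel_measurable lebesgue" and h: "\<not> (AE y in lebesgue. h y = 0)"
  shows "0 < maximal h x"
proof (rule ccontr)
  assume "\<not> 0 < maximal h x"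
  then have zero: "maximal h x = 0" by (simp add: not_less)
  have "AE y in lebesgue. h y * indicator (ball x (real (Suc n))) y = 0" for n
  proof -
    have "(\<integral>\<^sup>+y\<in>ball x (real (Suc n)). h y \<partial>lebesgue) = 0"
      using ball_integral_le_maximal[of x x "real (Suc n)" h] zero by simp
    then show ?thesis by (subst (asm) nn_integral_0_iff_AE) auto
  qed
  then have "AE y in lebesgue. \<forall>n. h y * indicator (ball x (real (Suc n))) y = 0"
    unfolding AE_all_countable by blast
  then have "AE y in lebesgue. h y = 0"
  proof eventually_elim
    case (elim y)
    obtain n where "dist x y < real n" using reals_Archimedean2 by blast
    then have "y \<in> ball x (real (Suc n))" by simp
    then show ?case using elim[rule_format, of n] by simp
  qed
  with h show False ..
qed

lemma ennreal_inverse_antimono: "(a::ennreal) \<le> b \<Longrightarrow> inverse b \<le> inverse a"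
  including ennreal.lifting by transfer (rule ereal_inverse_antimono)

text \<open>Far from the support of \<open>h\<close> only large balls see \<open>h\<close>.\<close>

lemma maximal_le_if_dist:
  fixes h :: "real^'n::finite \<Rightarrow> ennreal"
  assumes d: "0 < d" and far: "\<And>y. h y \<noteq> 0 \<Longrightarrow> d \<le> dist x y"
  shows "maximal h x \<le> (\<integral>\<^sup>+y. h y \<partial>lebesgue) / emeasure lebesgue (ball (0::real^'n) (d / 2))"
proof (rule maximal_least)
  fix c r assume r: "0 < r" and x: "x \<in> ball c r"
  let ?V = "emeasure lebesgue (ball (0::real^'n) (d / 2))"
  show "(\<integral>\<^sup>+y\<in>ball c r. h y \<partial>lebesgue) / emeasure lebesgue (ball c r) \<le> (\<integral>\<^sup>+y. h y \<partial>lebesgue) / ?V"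
  proof (cases "\<exists>y\<in>ball c r. h y \<noteq> 0")
    case True
    then obtain y where y: "y \<in> ball c r" "h y \<noteq> 0" by blast
    have "d < 2 * r"
      using far[OF y(2)] x y(1) dist_triangle2[of x y c] by (simp add: dist_commute)
    then have "unit_ball_vol (real CARD('n)) * (d / 2) ^ CARD('n) \<le> unit_ball_vol (real CARD('n)) * r ^ CARD('n)"
      using d unit_ball_vol_pos[of "real CARD('n)"] by (intro mult_left_mono power_mono) auto
    then have V: "?V \<le> emeasure lebesgue (ball c r)"
      using d r by (subst (1 2) emeasure_lebesgue_ball) (auto intro: ennreal_leI)
    have "(\<integral>\<^sup>+y\<in>ball c r. h y \<partial>lebesgue) \<le> (\<integral>\<^sup>+y. h y \<partial>lebesgue)"
      by (intro nn_integral_mono) (simp add: indicator_def)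
    then have "(\<integral>\<^sup>+y\<in>ball c r. h y \<partial>lebesgue) / emeasure lebesgue (ball c r)
        \<le> (\<integral>\<^sup>+y. h y \<partial>lebesgue) / emeasure lebesgue (ball c r)"
      by (rule divide_right_mono_ennreal)
    also have "\<dots> \<le> (\<integral>\<^sup>+y. h y \<partial>lebesgue) / ?V"
      unfolding divide_ennreal_def using V by (intro mult_left_mono ennreal_inverse_antimono) simp_all
    finally show ?thesis .
  next
    case False
    then have "(\<integral>\<^sup>+y\<in>ball c r. h y \<partial>lebesgue) = (\<integral>\<^sup>+y. 0 \<partial>(lebesgue :: (real^'n) measure))"
      by (intro nn_integral_cong) (auto simp: indicator_def)
    then show ?thesis by simp
  qed
qed

section \<open>Dyadic annuli\<close>

lemma annulus_iff: "x \<in> annulus k \<longleftrightarrow> 2 powi (k - 1) \<le> norm x \<and> norm x < 2 powi k"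
  by (auto simp: annulus_def)

lemma annulus_unique:
  assumes "x \<in> annulus j" "x \<in> annulus k" shows "j = k"
proof (rule ccontr)
  have *: False if "x \<in> annulus a" "x \<in> annulus b" "a < b" for a b
  proof -
    have "(2::real) powi a \<le> 2 powi (b - 1)" using that by (intro power_int_increasing) auto
    then show False using that by (auto simp: annulus_iff)
  qed
  assume "j \<noteq> k"
  then show False using *[OF assms] *[OF assms(2,1)] by linarith
qed

lemma annulus_exists:
  assumes "x \<noteq> 0" obtains k where "x \<in> annulus k"
proof -
  define k where "k = \<lfloor>log 2 (norm x)\<rfloor> + 1"
  have pos: "0 < norm x" using assms by simp
  have "2 powr real_of_int (k - 1) \<le> norm x" "norm x < 2 powr real_of_int k"
    using pos by (simp_all add: k_def flip: le_log_iff log_less_iff)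
  then have "x \<in> annulus k" unfolding annulus_iff by (simp add: powr_real_of_int' del: of_int_diff)
  then show ?thesis by (rule that)
qed

lemma annulus_subset_ball: "annulus k \<subseteq> ball 0 (2 powi k)"
  by (auto simp: annulus_def)

abbreviation dyadic_ball :: "int \<Rightarrow> (real^'n::finite) set"
  where "dyadic_ball k \<equiv> ball 0 (2 powi k)"

lemma dist_annuli:
  assumes x: "x \<in> annulus k" and y: "y \<in> annulus j" and kj: "k + 2 \<le> j \<or> j + 2 \<le> k"
  shows "2 powi (max j k - 2) \<le> dist x y"
proof -
  have *: "2 powi (b - 2) \<le> dist u v"
    if u: "u \<in> annulus a" and v: "v \<in> annulus b" and ab: "a + 2 \<le> b" for u v :: "real^'n" and a b
  proof -
    have "(2::real) powi a \<le> 2 powi (b - 2)" using ab by (intro power_int_increasing) auto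
    moreover have "(2::real) powi (b - 1) = 2 * 2 powi (b - 2)"
      using power_int_add[of "2::real" "b - 2" 1] by simp
    moreover have "norm v \<le> norm u + dist u v"
      using norm_triangle_ineq2[of v u] by (simp add: dist_norm norm_minus_commute)
    ultimately show ?thesis using u v by (simp add: annulus_iff)
  qed
  from kj show ?thesis
  proof
    assume "k + 2 \<le> j" with *[OF x y] show ?thesis by (simp add: max_def)
  next
    assume "j + 2 \<le> k" with *[OF y x] show ?thesis by (simp add: max_def dist_commute)
  qed
qed

lemma AE_not_zero: "AE x in lebesgue. x \<noteq> (0::real^'n::finite)"
proof -
  have "{0::real^'n} \<in> null_sets lebesgue"
    by (simp add: null_sets_completionI)
  then show ?thesis by (rule AE_I'[where N="{0}"]) auto
qed

lemma sum_annuli: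
  fixes f :: "real^'n::finite \<Rightarrow> ennreal"
  assumes "x \<noteq> 0"
  shows "(\<integral>\<^sup>+k. f x * indicator (annulus k) x \<partial>count_space UNIV) = f x"
proof -
  obtain k where k: "x \<in> annulus k" using annulus_exists[OF assms] by blast
  then have "x \<in> annulus j \<longleftrightarrow> j = k" for j using annulus_unique by blast
  then have "(\<integral>\<^sup>+j. f x * indicator (annulus j) x \<partial>count_space UNIV)
      = (\<integral>\<^sup>+j. f x * indicator {k} j \<partial>count_space UNIV)"
    by (simp add: indicator_def)
  also have "\<dots> = f x" by (simp add: nn_integral_cmult_indicator)
  finally show ?thesis .
qed

text \<open>With \<open>m = max j k\<close>, the distance of the annuli is at least \<open>2 powi (m - 2)\<close>, and the factor
  \<open>8 ^ n\<close> compares the ball of radius \<open>2 powi m\<close> with the ball of half that distance.\<close>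

lemma maximal_annulus_le:
  fixes h :: "real^'n::finite \<Rightarrow> ennreal"
  assumes x: "x \<in> annulus k" and kj: "k + 2 \<le> j \<or> j + 2 \<le> k"
  shows "maximal (\<lambda>y. h y * indicator (annulus j) y) x
    \<le> ennreal (8 ^ CARD('n) / (unit_ball_vol (real CARD('n)) * (2 powi max j k) ^ CARD('n)))
      * (\<integral>\<^sup>+y\<in>annulus j. h y \<partial>lebesgue)"
proof -
  define v where "v = unit_ball_vol (real CARD('n))"
  have v: "0 < v" unfolding v_def by simp
  define m where "m = max j k"
  have "maximal (\<lambda>y. h y * indicator (annulus j) y) x
    \<le> (\<integral>\<^sup>+y\<in>annulus j. h y \<partial>lebesgue) / emeasure lebesgue (ball (0::real^'n) (2 powi (m - 2) / 2))"
  proof (rule maximal_le_if_dist)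
    fix y assume "h y * indicator (annulus j) y \<noteq> 0"
    then have "y \<in> annulus j" by (auto simp: indicator_def split: if_splits)
    then show "2 powi (m - 2) \<le> dist x y" unfolding m_def by (rule dist_annuli[OF x _ kj])
  qed simp
  also have "emeasure lebesgue (ball (0::real^'n) (2 powi (m - 2) / 2)) = ennreal (v * (2 powi m) ^ CARD('n) / 8 ^ CARD('n))"
  proof -
    have "(2::real) powi (m - 2) / 2 = 2 powi m / 8"
      by (simp add: power_int_diff)
    then show ?thesis
      by (simp only:) (subst emeasure_lebesgue_ball, auto simp: v_def power_divide)
  qed
  also have "(\<integral>\<^sup>+y\<in>annulus j. h y \<partial>lebesgue) / ennreal (v * (2 powi m) ^ CARD('n) / 8 ^ CARD('n))
      = ennreal (8 ^ CARD('n) / (v * (2 powi m) ^ CARD('n))) * (\<integral>\<^sup>+y\<in>annulus j. h y \<partial>lebesgue)"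
    using v by (simp add: divide_ennreal_def inverse_ennreal mult.commute)
  finally show ?thesis by (simp add: v_def m_def)
qed


section \<open>Function norms and their duals\<close>

lemma sigma_finite_lebesgue: "sigma_finite_measure (lebesgue :: (real^'n::finite) measure)"
proof
  show "\<exists>A::(real^'n) set set. countable A \<and> A \<subseteq> sets lebesgue \<and> \<Union> A = space lebesgue
      \<and> (\<forall>a\<in>A. emeasure lebesgue a \<noteq> \<infinity>)"
  proof (intro exI conjI)
    show "\<Union> (range (\<lambda>i::nat. ball (0::real^'n) (real i))) = space lebesgue"
      using reals_Archimedean2 by auto
    show "\<forall>a\<in>range (\<lambda>i::nat. ball (0::real^'n) (real i)). emeasure lebesgue a \<noteq> \<infinity>"
      using emeasure_ball_neq_top by (auto simp: infinity_ennreal_def simp del: emeasure_completion)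
  qed auto
qed

lemma nonneg_measurable_mult:
  assumes "f \<in> nonneg_measurable M" "g \<in> nonneg_measurable M"
  shows "(\<lambda>x. f x * g x) \<in> nonneg_measurable M"
  using assms by (auto simp: nonneg_measurable_def)

lemma nonneg_measurable_add:
  assumes "f \<in> nonneg_measurable M" "g \<in> nonneg_measurable M"
  shows "(\<lambda>x. f x + g x) \<in> nonneg_measurable M"
  using assms by (auto simp: nonneg_measurable_def)

lemma nonneg_measurable_cmult:
  assumes "f \<in> nonneg_measurable M" "0 \<le> c"
  shows "(\<lambda>x. c * f x) \<in> nonneg_measurable M"
  using assms by (auto simp: nonneg_measurable_def)

lemma nonneg_measurable_indicator:
  assumes "A \<in> sets M"
  shows "indicator A \<in> nonneg_measurable M"
  using assms by (auto simp: nonneg_measurable_def)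

lemma nonneg_measurable_sum:
  assumes "\<And>i. i \<in> I \<Longrightarrow> f i \<in> nonneg_measurable M"
  shows "(\<lambda>x. \<Sum>i\<in>I. f i x) \<in> nonneg_measurable M"
  unfolding nonneg_measurable_def
  using nonneg_measurableD[OF assms] by (auto intro!: sum_nonneg borel_measurable_sum)

abbreviation pairing :: "(real^'n::finite \<Rightarrow> real) \<Rightarrow> (real^'n \<Rightarrow> ennreal) \<Rightarrow> ennreal"
  where "pairing f h \<equiv> \<integral>\<^sup>+x. ennreal (f x) * h x \<partial>lebesgue"

text \<open>What a ball Banach function norm does to nonnegative functions. Scalar-valued functions
  enter through their absolute values only, so the duality theory can be developed here.\<close>

locale ball_function_norm =
  fixes \<rho> :: "(real^'n::finite \<Rightarrow> real) \<Rightarrow> ennreal"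
  assumes scale: "\<And>f c. f \<in> nonneg_measurable lebesgue \<Longrightarrow> 0 \<le> c \<Longrightarrow> \<rho> (\<lambda>x. c * f x) = ennreal c * \<rho> f"
    and add_le: "\<And>f g. f \<in> nonneg_measurable lebesgue \<Longrightarrow> g \<in> nonneg_measurable lebesgue \<Longrightarrow>
      \<rho> (\<lambda>x. f x + g x) \<le> \<rho> f + \<rho> g"
    and mono: "\<And>f g. f \<in> nonneg_measurable lebesgue \<Longrightarrow> g \<in> nonneg_measurable lebesgue \<Longrightarrow>
      AE x in lebesgue. g x \<le> f x \<Longrightarrow> \<rho> g \<le> \<rho> f"
    and Fatou: "\<And>u v. (\<And>m. u m \<in> nonneg_measurable lebesgue) \<Longrightarrow> v \<in> nonneg_measurable lebesgue \<Longrightarrow>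
      AE x in lebesgue. incseq (\<lambda>m. u m x) \<and> (\<lambda>m. u m x) \<longlonglongrightarrow> v x \<Longrightarrow> (\<lambda>m. \<rho> (u m)) \<longlonglongrightarrow> \<rho> v"
    and ball_finite: "\<And>c r. 0 < r \<Longrightarrow> \<rho> (indicator (ball c r)) < \<infinity>"
    and ball_integral: "\<And>c r. 0 < r \<Longrightarrow> \<exists>C>0. \<forall>f\<in>nonneg_measurable lebesgue. \<rho> f < \<infinity> \<longrightarrow>
      (\<integral>\<^sup>+x\<in>ball c r. ennreal (f x) \<partial>lebesgue) \<le> ennreal C * \<rho> f"
begin

definition dual_norm :: "(real^'n \<Rightarrow> ennreal) \<Rightarrow> ennreal"
  where "dual_norm h = (SUP g\<in>{g \<in> nonneg_measurable lebesgue. \<rho> g \<le> 1}.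
    pairing g h)"

lemma rho_zero: "\<rho> (\<lambda>x. 0) = 0"
  using scale[of "\<lambda>x. 0" 0] by (simp add: nonneg_measurable_def)

lemma rho_sum_le:
  assumes "finite I" "\<And>i. i \<in> I \<Longrightarrow> f i \<in> nonneg_measurable lebesgue"
  shows "\<rho> (\<lambda>x. \<Sum>i\<in>I. f i x) \<le> (\<Sum>i\<in>I. \<rho> (f i))"
  using assms
proof (induction I rule: finite_induct)
  case (insert i I)
  have "\<rho> (\<lambda>x. f i x + (\<Sum>i\<in>I. f i x)) \<le> \<rho> (f i) + \<rho> (\<lambda>x. \<Sum>i\<in>I. f i x)"
    using insert by (intro add_le nonneg_measurable_sum) auto
  also have "\<dots> \<le> \<rho> (f i) + (\<Sum>i\<in>I. \<rho> (f i))"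
    using insert by (intro add_left_mono) auto
  finally show ?case using insert by simp
qed (simp add: rho_zero)

lemma dual_normI:
  assumes "\<And>g. g \<in> nonneg_measurable lebesgue \<Longrightarrow> \<rho> g \<le> 1 \<Longrightarrow>
    (pairing g h) \<le> t"
  shows "dual_norm h \<le> t"
  unfolding dual_norm_def using assms by (intro SUP_least) auto

lemma dual_normD:
  assumes "g \<in> nonneg_measurable lebesgue" "\<rho> g \<le> 1"
  shows "pairing g h \<le> dual_norm h"
  unfolding dual_norm_def using assms by (intro SUP_upper) auto

lemma dual_norm_mono_AE:
  assumes "AE x in lebesgue. h x \<le> h' x"
  shows "dual_norm h \<le> dual_norm h'"
proof (rule dual_normI)
  fix g assume g: "g \<in> nonneg_measurable lebesgue" "\<rho> g \<le> 1"
  have "pairing g h \<le> (pairing g h')"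
    using assms by (intro nn_integral_mono_AE) (auto elim!: eventually_mono intro: mult_left_mono)
  also have "\<dots> \<le> dual_norm h'" by (rule dual_normD[OF g])
  finally show "pairing g h \<le> dual_norm h'" .
qed

text \<open>\<open>f\<close> is divided by a number \<open>t\<close> slightly larger than \<open>\<rho> f\<close>, which also covers the case
  \<open>\<rho> f = 0\<close>.\<close>

lemma Hoelder:
  assumes f: "f \<in> nonneg_measurable lebesgue" and [measurable]: "h \<in> borel_measurable lebesgue"
    and fin: "\<rho> f < \<infinity>" "dual_norm h < \<infinity>"
  shows "pairing f h \<le> \<rho> f * dual_norm h"
proof (rule ennreal_le_epsilon)
  note [measurable] = nonneg_measurableD(1)[OF f]
  fix e :: real assume e: "0 < e"
  define a where "a = enn2real (\<rho> f)"
  define D where "D = enn2real (dual_norm h)"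
  have aD: "\<rho> f = ennreal a" "dual_norm h = ennreal D" "0 \<le> a" "0 \<le> D"
    using fin by (auto simp: a_def D_def)
  define t where "t = a + e / (D + 1)"
  have t: "0 < t" "a \<le> t" using aD e by (auto simp: t_def intro!: add_nonneg_pos)
  define g where "g x = (1 / t) * f x" for x
  have g: "g \<in> nonneg_measurable lebesgue"
    unfolding g_def using t by (intro nonneg_measurable_cmult f) auto
  have "\<rho> g = ennreal (1 / t) * ennreal a"
    unfolding g_def using t scale[OF f, of "1/t"] aD by simp
  also have "\<dots> \<le> 1"
    using t aD by (simp add: ennreal_mult [symmetric] ennreal_le_1)
  finally have le: "pairing g h \<le> ennreal D"
    using dual_normD[OF g, of h] aD(2) by simp
  have "pairing f h = (\<integral>\<^sup>+x. ennreal t * (ennreal (g x) * h x) \<partial>lebesgue)"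
    using t nonneg_measurableD(2)[OF f]
    by (intro nn_integral_cong) (simp add: g_def mult.assoc [symmetric] ennreal_mult [symmetric])
  also have "\<dots> = ennreal t * (pairing g h)"
  proof -
    note [measurable] = nonneg_measurableD(1)[OF g]
    show ?thesis by (rule nn_integral_cmult) measurable
  qed
  also have "\<dots> \<le> ennreal t * ennreal D" by (intro mult_left_mono le) simp
  also have "\<dots> = ennreal (t * D)" using t aD by (simp add: ennreal_mult)
  also have "t * D \<le> a * D + e"
    using aD e by (simp add: t_def field_simps)
  then have "ennreal (t * D) \<le> ennreal (a * D) + ennreal e"
    using aD e by (simp add: ennreal_plus [symmetric] ennreal_leI del: ennreal_plus)
  finally show "pairing f h \<le> \<rho> f * dual_norm h + ennreal e"
    using aD by (simp add: ennreal_mult)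
qed

lemma unit_ball_solid_convex: "solid_convex_set lebesgue {f \<in> nonneg_measurable lebesgue. \<rho> f \<le> 1}"
proof
  show "(\<lambda>x. 0) \<in> {f \<in> nonneg_measurable lebesgue. \<rho> f \<le> 1}"
    by (simp add: rho_zero nonneg_measurable_def)
next
  fix f g and t :: real
  assume f: "f \<in> {f \<in> nonneg_measurable lebesgue. \<rho> f \<le> 1}"
    and g: "g \<in> {f \<in> nonneg_measurable lebesgue. \<rho> f \<le> 1}" and t: "0 \<le> t" "t \<le> 1"
  have "\<rho> (\<lambda>x. (1 - t) * f x + t * g x) \<le> ennreal (1 - t) * \<rho> f + ennreal t * \<rho> g"
    using add_le[of "\<lambda>x. (1 - t) * f x" "\<lambda>x. t * g x"] f g t
    by (simp add: scale nonneg_measurable_cmult)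
  also have "\<dots> \<le> ennreal (1 - t) * 1 + ennreal t * 1"
    using f g by (intro add_mono mult_left_mono) auto
  also have "\<dots> = 1" using t by (simp add: ennreal_plus [symmetric] del: ennreal_plus)
  finally show "(\<lambda>x. (1 - t) * f x + t * g x) \<in> {f \<in> nonneg_measurable lebesgue. \<rho> f \<le> 1}"
    using f g t by (auto intro!: nonneg_measurable_add nonneg_measurable_cmult)
next
  fix f g
  assume "f \<in> {f \<in> nonneg_measurable lebesgue. \<rho> f \<le> 1}" "g \<in> nonneg_measurable lebesgue"
    "AE x in lebesgue. g x \<le> f x"
  then show "g \<in> {f \<in> nonneg_measurable lebesgue. \<rho> f \<le> 1}"
    using mono[of f g] by auto
next
  fix u :: "nat \<Rightarrow> real^'n \<Rightarrow> real" and v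
  assume u: "\<And>m. u m \<in> {f \<in> nonneg_measurable lebesgue. \<rho> f \<le> 1}" and v: "v \<in> nonneg_measurable lebesgue"
    and lim: "AE x in lebesgue. incseq (\<lambda>m. u m x) \<and> (\<lambda>m. u m x) \<longlonglongrightarrow> v x"
  have "\<rho> v \<le> 1"
    using u by (intro LIMSEQ_le_const2[OF Fatou[OF _ v lim]]) auto
  with v show "v \<in> {f \<in> nonneg_measurable lebesgue. \<rho> f \<le> 1}" by simp
qed auto

lemma dual_norm_ball_finite:
  assumes "0 < r"
  shows "dual_norm (indicator (ball c r)) < \<infinity>"
proof -
  obtain C where C: "C > 0" "\<And>f. f \<in> nonneg_measurable lebesgue \<Longrightarrow> \<rho> f < \<infinity> \<Longrightarrow>
      (\<integral>\<^sup>+x\<in>ball c r. ennreal (f x) \<partial>lebesgue) \<le> ennreal C * \<rho> f"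
    using ball_integral[OF assms] by blast
  have "dual_norm (indicator (ball c r)) \<le> ennreal C"
  proof (rule dual_normI)
    fix g assume g: "g \<in> nonneg_measurable lebesgue" "\<rho> g \<le> 1"
    have "(\<integral>\<^sup>+x\<in>ball c r. ennreal (g x) \<partial>lebesgue) \<le> ennreal C * \<rho> g"
      using g by (intro C) (auto intro: le_less_trans)
    also have "\<dots> \<le> ennreal C * 1" by (intro mult_left_mono g) simp
    finally show "(\<integral>\<^sup>+x\<in>ball c r. ennreal (g x) \<partial>lebesgue) \<le> ennreal C" by simp
  qed
  then show ?thesis by (rule le_less_trans) simp
qed

text \<open>On the ball \<open>B\<close> the average of \<open>h\<close> over \<open>B\<close> is below \<open>M h\<close>. If \<open>h\<close> is in the dual unit ball, boundedness
  of \<open>M\<close> on the dual therefore gives \<open>\<integral>\<^sub>B h \<le> l\<close> with \<open>l = A \<bar>B\<bar> / \<parallel>\<chi>\<^sub>B\<parallel>'\<close>, where \<open>\<parallel> \<parallel>'\<close> is the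
  dual norm. By the bipolar theorem this means \<open>\<rho>(\<chi>\<^sub>B) \<le> l\<close>.\<close>

lemma rho_ball_times_dual_norm_ball_le:
  assumes M: "0 < A" "\<And>h. h \<in> borel_measurable lebesgue \<Longrightarrow> dual_norm h < \<infinity> \<Longrightarrow>
      dual_norm (maximal h) \<le> ennreal A * dual_norm h"
    and r: "0 < r"
  shows "\<rho> (indicator (ball c r)) * dual_norm (indicator (ball c r)) \<le> ennreal A * emeasure lebesgue (ball c r)"
proof -
  let ?B = "ball c r"
  let ?V = "emeasure lebesgue ?B"
  note V = emeasure_ball_neq_0[OF r, of c] emeasure_ball_neq_top[of c r]
  define v where "v = enn2real (dual_norm (indicator ?B))"
  have v: "dual_norm (indicator ?B) = ennreal v" "0 \<le> v"
    using dual_norm_ball_finite[OF r, of c] by (auto simp: v_def)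
  show ?thesis
  proof (cases "v = 0")
    case True
    then show ?thesis using v by simp
  next
    case False
    then have vpos: "0 < v" using v by simp
    define l where "l = A * measure lebesgue ?B / v"
    have Vl: "?V = ennreal (measure lebesgue ?B)"
      using V by (intro emeasure_eq_ennreal_measure) simp
    have mpos: "0 < measure lebesgue ?B"
      using V Vl by (metis ennreal_0 measure_nonneg order_le_less)
    have l: "0 < l" using M(1) vpos mpos by (simp add: l_def)
    interpret B: solid_convex_set lebesgue "{f \<in> nonneg_measurable lebesgue. \<rho> f \<le> 1}"
      by (rule unit_ball_solid_convex)
    have iB: "indicator ?B \<in> nonneg_measurable lebesgue" by (intro nonneg_measurable_indicator) simp
    have gB: "(\<lambda>x. (1 / l) * indicator ?B x) \<in> nonneg_measurable lebesgue"
      using l by (intro nonneg_measurable_cmult iB) auto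
    have "(\<lambda>x. (1 / l) * indicator ?B x) \<in> {f \<in> nonneg_measurable lebesgue. \<rho> f \<le> 1}"
    proof (rule ccontr)
      assume "\<not> ?thesis"
      then obtain h where h: "h \<in> polar lebesgue {f \<in> nonneg_measurable lebesgue. \<rho> f \<le> 1}"
        and big: "1 < (\<integral>\<^sup>+x. ennreal ((1 / l) * indicator ?B x) * h x \<partial>lebesgue)"
        using B.bipolar[OF sigma_finite_lebesgue gB] by blast
      note [measurable] = polarD(1)[OF h]
      have dh: "dual_norm h \<le> 1"
        using polarD(2)[OF h] by (intro dual_normI) simp
      have "dual_norm (maximal h) \<le> ennreal A * dual_norm h"
        using dh by (intro M) (auto intro: le_less_trans)
      also have "\<dots> \<le> ennreal A * 1" by (intro mult_left_mono dh) simp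
      finally have dM: "dual_norm (maximal h) \<le> ennreal A" by simp
      define I where "I = (\<integral>\<^sup>+x\<in>?B. h x \<partial>lebesgue)"
      have "I / ?V * ennreal v \<le> ennreal A"
        unfolding v(1) [symmetric] dual_norm_def SUP_mult_left_ennreal
      proof (rule SUP_least)
        fix g assume g: "g \<in> {g \<in> nonneg_measurable lebesgue. \<rho> g \<le> 1}"
        then have [measurable]: "g \<in> borel_measurable lebesgue" by (auto dest: nonneg_measurableD)
        have "I / ?V * (\<integral>\<^sup>+x. ennreal (g x) * indicator ?B x \<partial>lebesgue)
            = (\<integral>\<^sup>+x. I / ?V * (ennreal (g x) * indicator ?B x) \<partial>lebesgue)"
          by (intro nn_integral_cmult [symmetric]) measurable
        also have "\<dots> \<le> pairing g (maximal h)"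
        proof (intro nn_integral_mono)
          fix x show "I / ?V * (ennreal (g x) * indicator ?B x) \<le> ennreal (g x) * maximal h x"
            using average_le_maximal[of x c r h]
            by (auto simp: I_def indicator_def mult.commute intro: mult_left_mono)
        qed
        also have "\<dots> \<le> dual_norm (maximal h)" using g by (intro dual_normD) auto
        finally show "I / ?V * (\<integral>\<^sup>+x. ennreal (g x) * indicator ?B x \<partial>lebesgue) \<le> ennreal A"
          using dM by (rule order_trans)
      qed
      then have I1: "I * ennreal (v / measure lebesgue ?B) \<le> ennreal A"
      proof -
        have "ennreal (v / measure lebesgue ?B) = inverse ?V * ennreal v"
          unfolding Vl using vpos mpos
          by (simp add: inverse_ennreal ennreal_mult [symmetric] divide_inverse mult.commute)
        then show ?thesis using \<open>I / ?V * ennreal v \<le> ennreal A\<close>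
          by (simp only: divide_ennreal_def mult.assoc)
      qed
      have "(\<integral>\<^sup>+x. ennreal ((1 / l) * indicator ?B x) * h x \<partial>lebesgue)
          = (\<integral>\<^sup>+x. ennreal (1 / l) * (h x * indicator ?B x) \<partial>lebesgue)"
        using l by (intro nn_integral_cong) (auto simp: indicator_def ennreal_mult' [symmetric])
      also have "\<dots> = ennreal (1 / l) * I"
        unfolding I_def by (intro nn_integral_cmult) measurable
      also have "ennreal (1 / l) * I = (I * ennreal (v / measure lebesgue ?B)) * ennreal (1 / A)"
      proof -
        have l_eq: "1 / l = v / measure lebesgue ?B * (1 / A)" by (simp add: l_def)
        show ?thesis unfolding l_eq
          using vpos mpos M(1) by (subst ennreal_mult) (auto simp: ac_simps)
      qed
      also have "\<dots> \<le> ennreal A * ennreal (1 / A)" by (intro mult_right_mono I1) simp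
      also have "\<dots> = 1" using M(1) by (simp add: ennreal_mult [symmetric])
      finally show False using big leD by blast
    qed
    then have "ennreal (1 / l) * \<rho> (indicator ?B) \<le> 1" using l scale[OF iB, of "1 / l"] by simp
    then have "ennreal l * (ennreal (1 / l) * \<rho> (indicator ?B)) \<le> ennreal l * 1"
      by (rule mult_left_mono) simp
    then have "\<rho> (indicator ?B) \<le> ennreal l"
      using l by (simp add: mult.assoc [symmetric] ennreal_mult [symmetric])
    then have "\<rho> (indicator ?B) * ennreal v \<le> ennreal l * ennreal v" by (rule mult_right_mono) simp
    also have "\<dots> = ennreal A * ?V"
      unfolding Vl using l vpos M(1) mpos by (simp add: ennreal_mult [symmetric] l_def)
    finally show ?thesis using v by simp
  qed
qed

end


section \<open>Powers on the extended half-line and sums over the integers\<close>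

lemma ennreal_epowr: "0 \<le> x \<Longrightarrow> ennreal x epowr a = ennreal (x powr a)"
  by (simp add: epowr_def)

lemma top_epowr: "top epowr a = top"
  by (simp add: epowr_def)

lemma zero_epowr: "0 epowr a = 0"
  by (simp add: epowr_def)

lemma epowr_mono:
  assumes "x \<le> y" "0 \<le> a" shows "x epowr a \<le> y epowr a"
proof (cases y)
  case (real r)
  with assms(1) obtain s where s: "x = ennreal s" "0 \<le> s" "s \<le> r"
    by (cases x) (auto simp: top_unique)
  then show ?thesis using real assms(2) by (simp add: ennreal_epowr ennreal_leI powr_mono2)
qed (simp add: top_epowr)

lemma epowr_less_top: "x < \<infinity> \<Longrightarrow> x epowr a < \<infinity>"
  by (simp add: epowr_def)

lemma epowr_mult:
  assumes "0 \<le> c" "0 < a" shows "(ennreal c * x) epowr a = ennreal (c powr a) * x epowr a"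
proof (cases x)
  case (real r)
  then show ?thesis using assms by (simp add: ennreal_mult [symmetric] ennreal_epowr powr_mult)
next
  case top
  show ?thesis
  proof (cases "c = 0")
    case False
    then show ?thesis using top assms by (simp add: top_epowr ennreal_mult_top)
  qed (simp add: zero_epowr)
qed

lemma epowr_epowr: "0 < a \<Longrightarrow> 0 < b \<Longrightarrow> (x epowr a) epowr b = x epowr (a * b)"
  by (cases x) (simp_all add: top_epowr ennreal_epowr powr_powr)

lemma epowr_one: "x epowr 1 = x"
  by (cases x) (simp_all add: top_epowr ennreal_epowr)

lemma tendsto_epowr:
  assumes lim: "(u \<longlongrightarrow> l) F" and fin: "\<And>m. u m < \<infinity>" "l < \<infinity>" and a: "0 < a"
  shows "((\<lambda>m. u m epowr a) \<longlongrightarrow> l epowr a) F"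
proof -
  have "((\<lambda>m. enn2real (u m) powr a) \<longlongrightarrow> enn2real l powr a) F"
  proof (rule tendsto_powr2)
    show "((\<lambda>m. enn2real (u m)) \<longlongrightarrow> enn2real l) F"
      using lim fin(2) by (intro tendsto_enn2real) auto
  qed (use a in auto)
  then have "((\<lambda>m. ennreal (enn2real (u m) powr a)) \<longlongrightarrow> ennreal (enn2real l powr a)) F"
    by (rule tendsto_ennrealI)
  moreover have "x epowr a = ennreal (enn2real x powr a)" if "x < \<infinity>" for x
    using that by (simp add: epowr_def)
  ultimately show ?thesis using fin by simp
qed

text \<open>Where one of the endpoints is \<open>0\<close>, convexity is the inequality \<open>s\<^sup>q \<le> s\<close> for \<open>s \<le> 1\<close>.\<close>

lemma powr_convex_combination:
  fixes a b t q :: real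
  assumes "0 \<le> a" "0 \<le> b" "0 \<le> t" "t \<le> 1" "1 \<le> q"
  shows "((1 - t) * a + t * b) powr q \<le> (1 - t) * a powr q + t * b powr q"
proof -
  have shrink: "(s * x) powr q \<le> s * x powr q" if "0 \<le> s" "s \<le> 1" "0 \<le> x" for s x :: real
  proof -
    have "s powr q \<le> s"
    proof (cases "s = 0")
      case False
      then have "s powr q \<le> s powr 1" using that assms(5) by (intro powr_mono') auto
      then show ?thesis using that by simp
    qed simp
    then show ?thesis using that by (simp add: powr_mult mult_right_mono)
  qed
  consider "a = 0" | "b = 0" | "0 < a" "0 < b" using assms by linarith
  then show ?thesis
  proof cases
    case 1 then show ?thesis using shrink[of t b] assms by simp
  next
    case 2 then show ?thesis using shrink[of "1 - t" a] assms by simp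
  next
    case 3
    then show ?thesis using convex_onD[OF powr_convex[OF assms(5)], of t a b] assms by simp
  qed
qed

lemma epowr_convex_combination:
  assumes t: "0 \<le> t" "t \<le> 1" and q: "1 \<le> q"
  shows "(ennreal (1 - t) * a + ennreal t * b) epowr q \<le> ennreal (1 - t) * a epowr q + ennreal t * b epowr q"
proof -
  consider "t = 0" | "t = 1" | "0 < t" "t < 1" using t by linarith
  then show ?thesis
  proof cases
    case 3
    show ?thesis
    proof (cases "a = top \<or> b = top")
      case True
      then show ?thesis using 3 by (auto simp: top_epowr ennreal_mult_top)
    next
      case False
      then obtain x y where xy: "a = ennreal x" "b = ennreal y" "0 \<le> x" "0 \<le> y"
        by (metis ennreal_cases)
      have l: "ennreal (1 - t) * a + ennreal t * b = ennreal ((1 - t) * x + t * y)"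
        using xy t by (simp add: ennreal_mult)
      have r: "ennreal (1 - t) * a epowr q + ennreal t * b epowr q = ennreal ((1 - t) * x powr q + t * y powr q)"
        using xy t by (simp add: ennreal_mult ennreal_epowr)
      show ?thesis unfolding l r using xy t q
        by (simp add: ennreal_epowr ennreal_leI powr_convex_combination del: ennreal_plus)
    qed
  qed simp_all
qed

lemma nn_integral_count_int_eq_SUP:
  fixes f :: "int \<Rightarrow> ennreal"
  shows "(\<integral>\<^sup>+k. f k \<partial>count_space UNIV) = (SUP n::nat. \<Sum>k\<in>{- int n..int n}. f k)"
proof -
  have "(\<integral>\<^sup>+k. f k \<partial>count_space UNIV) = (\<integral>\<^sup>+k. (SUP n::nat. f k * indicator {- int n..int n} k) \<partial>count_space UNIV)"
  proof (intro nn_integral_cong antisym)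
    fix k
    show "f k \<le> (SUP n::nat. f k * indicator {- int n..int n} k)"
      by (rule SUP_upper2[of "nat \<bar>k\<bar>"]) (auto simp: indicator_def)
    show "(SUP n::nat. f k * indicator {- int n..int n} k) \<le> f k"
      by (intro SUP_least) (simp add: indicator_def)
  qed
  also have "\<dots> = (SUP n::nat. (\<integral>\<^sup>+k. f k * indicator {- int n..int n} k \<partial>count_space UNIV))"
    by (intro nn_integral_monotone_convergence_SUP incseq_SucI le_funI) (auto simp: indicator_def)
  also have "\<dots> = (SUP n::nat. \<Sum>k\<in>{- int n..int n}. f k)"
  proof (intro SUP_cong refl)
    fix n
    show "(\<integral>\<^sup>+k. f k * indicator {- int n..int n} k \<partial>count_space UNIV) = (\<Sum>k\<in>{- int n..int n}. f k)"
      by (subst nn_integral_count_space'[of "{- int n..int n}"]) auto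
  qed
  finally show ?thesis .
qed

lemma nn_integral_count_int_le:
  assumes "\<And>F. finite F \<Longrightarrow> (\<Sum>k\<in>F. f k) \<le> c"
  shows "(\<integral>\<^sup>+k. f k \<partial>count_space (UNIV :: int set)) \<le> c"
  unfolding nn_integral_count_int_eq_SUP by (intro SUP_least assms) simp

lemma infsum_int_eq_nn_integral:
  fixes f :: "int \<Rightarrow> ennreal"
  shows "(\<Sum>\<^sub>\<infinity>k\<in>UNIV. f k) = (\<integral>\<^sup>+k. f k \<partial>count_space UNIV)"
proof -
  have "(\<Sum>\<^sub>\<infinity>k\<in>UNIV. f k) = (SUP F\<in>{F. finite F \<and> F \<subseteq> UNIV}. \<Sum>k\<in>F. f k)"
    by (rule nonneg_infsum_complete) simp
  also have "\<dots> = (\<integral>\<^sup>+k. f k \<partial>count_space UNIV)"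
  proof (rule antisym)
    show "(SUP F\<in>{F. finite F \<and> F \<subseteq> UNIV}. \<Sum>k\<in>F. f k) \<le> (\<integral>\<^sup>+k. f k \<partial>count_space UNIV)"
    proof (rule SUP_least)
      fix F :: "int set" assume "F \<in> {F. finite F \<and> F \<subseteq> UNIV}"
      then have "(\<Sum>k\<in>F. f k) = (\<integral>\<^sup>+k. f k * indicator F k \<partial>count_space UNIV)"
        by (subst nn_integral_count_space'[where A=F]) auto
      also have "\<dots> \<le> (\<integral>\<^sup>+k. f k \<partial>count_space UNIV)"
        by (intro nn_integral_mono) (simp add: indicator_def)
      finally show "(\<Sum>k\<in>F. f k) \<le> (\<integral>\<^sup>+k. f k \<partial>count_space UNIV)" .
    qed
    show "(\<integral>\<^sup>+k. f k \<partial>count_space UNIV) \<le> (SUP F\<in>{F. finite F \<and> F \<subseteq> UNIV}. \<Sum>k\<in>F. f k)"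
      by (intro nn_integral_count_int_le SUP_upper) simp
  qed
  finally show ?thesis .
qed

text \<open>Suprema over independently chosen arguments may be taken after the summation. The additional
  term \<open>x\<close> is there for the induction.\<close>

lemma sum_SUP_le:
  fixes f :: "'i \<Rightarrow> 'a \<Rightarrow> ennreal"
  assumes "finite F" "S \<noteq> {}" "\<And>g. (\<And>k. g k \<in> S) \<Longrightarrow> x + (\<Sum>k\<in>F. f k (g k)) \<le> c"
  shows "x + (\<Sum>k\<in>F. SUP y\<in>S. f k y) \<le> c"
  using assms(1,3)
proof (induction F arbitrary: x rule: finite_induct)
  case empty
  obtain s where "s \<in> S" using assms(2) by blast
  then show ?case using empty[of "\<lambda>_. s"] by simp
next
  case (insert i F)
  have "x + f i y + (\<Sum>k\<in>F. SUP y\<in>S. f k y) \<le> c" if y: "y \<in> S" for y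
  proof (rule insert.IH)
    fix g :: "'i \<Rightarrow> 'a" assume g: "\<And>k. g k \<in> S"
    have "(\<Sum>k\<in>F. f k ((g(i := y)) k)) = (\<Sum>k\<in>F. f k (g k))"
      using insert.hyps by (intro sum.cong) auto
    then show "x + f i y + (\<Sum>k\<in>F. f k (g k)) \<le> c"
      using insert.prems[of "g(i := y)"] insert.hyps g y by (simp add: add.assoc)
  qed
  then have "(SUP y\<in>S. x + (f i y + (\<Sum>k\<in>F. SUP y\<in>S. f k y))) \<le> c"
    by (intro SUP_least) (simp add: add.assoc)
  also have "(SUP y\<in>S. x + (f i y + (\<Sum>k\<in>F. SUP y\<in>S. f k y)))
      = x + ((SUP y\<in>S. f i y) + (\<Sum>k\<in>F. SUP y\<in>S. f k y))"
    using assms(2) by (simp add: ennreal_SUP_add_right [symmetric] ennreal_SUP_add_left)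
  finally show ?case using insert.hyps by simp
qed

section \<open>The unit ball of a Herz space and its polar\<close>

text \<open>The Herz space over \<open>\<rho>\<close> has smoothness \<open>\<beta>\<close> and summability exponent \<open>q\<close>; \<open>\<eta>\<close> and \<open>\<eta>'\<close> are
  the rates at which the norms of the dyadic balls decrease in the space and in its dual.\<close>

locale herz_frame = ball_function_norm \<rho> for \<rho> :: "(real^'n::finite \<Rightarrow> real) \<Rightarrow> ennreal" +
  fixes \<beta> q \<eta> \<eta>' :: real
  assumes q: "1 \<le> q"
    and eta: "0 < \<eta>" "0 < \<eta>'" "- \<eta> < \<beta>" "\<beta> < \<eta>'"
    and dual_maximal: "\<exists>A>0. \<forall>h\<in>borel_measurable lebesgue. dual_norm h < \<infinity> \<longrightarrow>
      dual_norm (maximal h) \<le> ennreal A * dual_norm h"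
    and rho_decay: "\<exists>C>0. \<forall>j k. j \<le> k \<longrightarrow> \<rho> (indicator (dyadic_ball j))
      \<le> ennreal (C * 2 powr (\<eta> * of_int (j - k))) * \<rho> (indicator (dyadic_ball k))"
    and dual_decay: "\<exists>C>0. \<forall>j k. j \<le> k \<longrightarrow> dual_norm (indicator (dyadic_ball j))
      \<le> ennreal (C * 2 powr (\<eta>' * of_int (j - k))) * dual_norm (indicator (dyadic_ball k))"
begin

definition weight :: "int \<Rightarrow> real"
  where "weight k = 2 powr (\<beta> * of_int k)"

lemma weight_pos: "0 < weight k"
  by (simp add: weight_def)

lemma weight_diff: "weight (j - k) = weight j / weight k"
  by (simp add: weight_def powr_diff right_diff_distrib)

definition piece :: "int \<Rightarrow> (real^'n \<Rightarrow> real) \<Rightarrow> real^'n \<Rightarrow> real"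
  where "piece k f = (\<lambda>x. f x * indicator (annulus k) x)"

definition dual_piece :: "int \<Rightarrow> (real^'n \<Rightarrow> ennreal) \<Rightarrow> real^'n \<Rightarrow> ennreal"
  where "dual_piece k h = (\<lambda>x. h x * indicator (annulus k) x)"

text \<open>The \<open>q\<close>-th power of the Herz norm.\<close>

definition energy :: "(real^'n \<Rightarrow> real) \<Rightarrow> ennreal"
  where "energy f = (\<integral>\<^sup>+k. ennreal (weight k powr q) * \<rho> (piece k f) epowr q \<partial>count_space UNIV)"

definition herz_ball :: "(real^'n \<Rightarrow> real) set"
  where "herz_ball = {f \<in> nonneg_measurable lebesgue. energy f \<le> 1}"

definition herz_polar :: "(real^'n \<Rightarrow> ennreal) set"
  where "herz_polar = polar lebesgue herz_ball"

lemma piece_nonneg_measurable: "f \<in> nonneg_measurable lebesgue \<Longrightarrow> piece k f \<in> nonneg_measurable lebesgue"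
  unfolding piece_def by (intro nonneg_measurable_mult nonneg_measurable_indicator) auto

lemma dual_piece_measurable [measurable]:
  "h \<in> borel_measurable lebesgue \<Longrightarrow> dual_piece k h \<in> borel_measurable lebesgue"
  unfolding dual_piece_def by (intro borel_measurable_times_ennreal borel_measurable_indicator measurable_annulus)

lemma energy_scale:
  assumes f: "f \<in> nonneg_measurable lebesgue" and c: "0 \<le> c"
  shows "energy (\<lambda>x. c * f x) = ennreal (c powr q) * energy f"
proof -
  have "ennreal (weight k powr q) * \<rho> (piece k (\<lambda>x. c * f x)) epowr q
      = ennreal (c powr q) * (ennreal (weight k powr q) * \<rho> (piece k f) epowr q)" for k
  proof -
    have "piece k (\<lambda>x. c * f x) = (\<lambda>x. c * piece k f x)"
      by (simp add: piece_def mult.assoc)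
    then have "\<rho> (piece k (\<lambda>x. c * f x)) = ennreal c * \<rho> (piece k f)"
      using scale[OF piece_nonneg_measurable[OF f] c] by simp
    then show ?thesis using c q by (simp add: epowr_mult ac_simps)
  qed
  then show ?thesis unfolding energy_def by (simp add: nn_integral_cmult)
qed

lemma rho_piece_le:
  assumes "energy f \<le> 1"
  shows "\<rho> (piece k f) \<le> ennreal (1 / weight k)"
proof -
  have "ennreal (weight k powr q) * \<rho> (piece k f) epowr q \<le> energy f"
    unfolding energy_def by (rule nn_integral_ge_point) simp
  also note assms
  finally have "(ennreal (weight k) * \<rho> (piece k f)) epowr q \<le> 1"
    using q weight_pos[of k] by (simp add: epowr_mult)
  then have "((ennreal (weight k) * \<rho> (piece k f)) epowr q) epowr (1 / q) \<le> 1 epowr (1 / q)"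
    using q by (intro epowr_mono) auto
  then have "ennreal (weight k) * \<rho> (piece k f) \<le> 1"
    using q ennreal_epowr[of 1 "1/q"] by (simp add: epowr_epowr epowr_one)
  then have "ennreal (1 / weight k) * (ennreal (weight k) * \<rho> (piece k f)) \<le> ennreal (1 / weight k) * 1"
    by (rule mult_left_mono) simp
  then show ?thesis
    using weight_pos[of k] by (simp add: mult.assoc [symmetric] ennreal_mult [symmetric])
qed

lemma rho_piece_finite: "energy f \<le> 1 \<Longrightarrow> \<rho> (piece k f) < \<infinity>"
  by (rule le_less_trans[OF rho_piece_le]) simp_all

text \<open>Convexity follows annulus by annulus from the convexity of \<open>t\<^sup>q\<close>, without the triangle inequality
  in \<open>\<ell>\<^sup>q\<close>. Closedness is Fatou's lemma for the counting measure.\<close>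

lemma herz_ball_solid_convex: "solid_convex_set lebesgue herz_ball"
proof
  show "herz_ball \<subseteq> nonneg_measurable lebesgue" by (auto simp: herz_ball_def)
  show "(\<lambda>x. 0) \<in> herz_ball"
    by (simp add: herz_ball_def energy_def piece_def rho_zero zero_epowr nonneg_measurable_def)
next
  fix f g and t :: real
  assume f: "f \<in> herz_ball" and g: "g \<in> herz_ball" and t: "0 \<le> t" "t \<le> 1"
  have m: "f \<in> nonneg_measurable lebesgue" "g \<in> nonneg_measurable lebesgue"
    using f g by (auto simp: herz_ball_def)
  let ?F = "\<lambda>f k. ennreal (weight k powr q) * \<rho> (piece k f) epowr q"
  have "?F (\<lambda>x. (1 - t) * f x + t * g x) k \<le> ennreal (1 - t) * ?F f k + ennreal t * ?F g k" for k
  proof -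
    have "\<rho> (piece k (\<lambda>x. (1 - t) * f x + t * g x))
        = \<rho> (\<lambda>x. (1 - t) * piece k f x + t * piece k g x)"
      by (simp add: piece_def distrib_right mult.assoc)
    also have "\<dots> \<le> ennreal (1 - t) * \<rho> (piece k f) + ennreal t * \<rho> (piece k g)"
      using add_le[of "\<lambda>x. (1 - t) * piece k f x" "\<lambda>x. t * piece k g x"] m t
      by (simp add: scale nonneg_measurable_cmult piece_nonneg_measurable)
    finally have "\<rho> (piece k (\<lambda>x. (1 - t) * f x + t * g x)) epowr q
        \<le> ennreal (1 - t) * \<rho> (piece k f) epowr q + ennreal t * \<rho> (piece k g) epowr q"
      using q t by (intro order_trans[OF epowr_mono epowr_convex_combination]) auto
    then have "?F (\<lambda>x. (1 - t) * f x + t * g x) k \<le> ennreal (weight k powr q) *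
        (ennreal (1 - t) * \<rho> (piece k f) epowr q + ennreal t * \<rho> (piece k g) epowr q)"
      by (rule mult_left_mono) simp
    then show ?thesis by (simp add: distrib_left ac_simps)
  qed
  then have "energy (\<lambda>x. (1 - t) * f x + t * g x)
      \<le> (\<integral>\<^sup>+k. ennreal (1 - t) * ?F f k + ennreal t * ?F g k \<partial>count_space UNIV)"
    unfolding energy_def by (intro nn_integral_mono)
  also have "\<dots> = ennreal (1 - t) * energy f + ennreal t * energy g"
    unfolding energy_def by (simp add: nn_integral_add nn_integral_cmult)
  also have "\<dots> \<le> ennreal (1 - t) * 1 + ennreal t * 1"
    using f g by (intro add_mono mult_left_mono) (auto simp: herz_ball_def)
  also have "\<dots> = 1" using t by (simp add: ennreal_plus [symmetric] del: ennreal_plus)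
  finally show "(\<lambda>x. (1 - t) * f x + t * g x) \<in> herz_ball"
    using m t by (auto simp: herz_ball_def intro!: nonneg_measurable_add nonneg_measurable_cmult)
next
  fix f g
  assume f: "f \<in> herz_ball" and g: "g \<in> nonneg_measurable lebesgue" and le: "AE x in lebesgue. g x \<le> f x"
  have "\<rho> (piece k g) \<le> \<rho> (piece k f)" for k
  proof (rule mono)
    show "AE x in lebesgue. piece k g x \<le> piece k f x"
      using le by eventually_elim (simp add: piece_def mult_right_mono)
  qed (use f g in \<open>auto simp: herz_ball_def intro: piece_nonneg_measurable\<close>)
  then have "energy g \<le> energy f"
    unfolding energy_def using q by (intro nn_integral_mono mult_left_mono epowr_mono) auto
  then show "g \<in> herz_ball" using f g by (auto simp: herz_ball_def)
next
  fix u :: "nat \<Rightarrow> real^'n \<Rightarrow> real" and v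
  assume u: "\<And>m. u m \<in> herz_ball" and v: "v \<in> nonneg_measurable lebesgue"
    and lim: "AE x in lebesgue. incseq (\<lambda>m. u m x) \<and> (\<lambda>m. u m x) \<longlonglongrightarrow> v x"
  let ?F = "\<lambda>f k. ennreal (weight k powr q) * \<rho> (piece k f) epowr q"
  have tend: "(\<lambda>m. ?F (u m) k) \<longlonglongrightarrow> ?F v k" for k
  proof -
    have L: "(\<lambda>m. \<rho> (piece k (u m))) \<longlonglongrightarrow> \<rho> (piece k v)"
    proof (rule Fatou)
      show "AE x in lebesgue. incseq (\<lambda>m. piece k (u m) x) \<and> (\<lambda>m. piece k (u m) x) \<longlonglongrightarrow> piece k v x"
        using lim by eventually_elim
          (auto simp: piece_def incseq_def intro!: mult_right_mono tendsto_intros)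
    qed (use u v in \<open>auto simp: herz_ball_def intro: piece_nonneg_measurable\<close>)
    have bound: "\<rho> (piece k (u m)) \<le> ennreal (1 / weight k)" for m
      using u by (intro rho_piece_le) (auto simp: herz_ball_def)
    then have "\<rho> (piece k v) \<le> ennreal (1 / weight k)"
      by (intro LIMSEQ_le_const2[OF L]) auto
    then have "(\<lambda>m. \<rho> (piece k (u m)) epowr q) \<longlonglongrightarrow> \<rho> (piece k v) epowr q"
      using q bound by (intro tendsto_epowr L) (auto intro: le_less_trans[OF _ ennreal_less_top])
    then show ?thesis by (intro ennreal_tendsto_cmult) auto
  qed
  have "energy v = (\<integral>\<^sup>+k. liminf (\<lambda>m. ?F (u m) k) \<partial>count_space UNIV)"
    unfolding energy_def using lim_imp_Liminf[OF _ tend] by simp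
  also have "\<dots> \<le> liminf (\<lambda>m. energy (u m))"
    unfolding energy_def by (rule nn_integral_liminf) simp
  also have "\<dots> \<le> 1"
    using u by (intro Liminf_le) (auto simp: herz_ball_def)
  finally show "v \<in> herz_ball" using v by (simp add: herz_ball_def)
qed

lemma rho_piece_of_test_function:
  assumes f: "f \<in> nonneg_measurable lebesgue" "\<rho> f \<le> 1"
  shows "\<rho> (piece k f) \<le> 1"
proof -
  have "\<rho> (piece k f) \<le> \<rho> f"
    using nonneg_measurableD(2)[OF f(1)]
    by (intro mono f piece_nonneg_measurable) (auto simp: piece_def indicator_def)
  then show ?thesis using f(2) by (rule order_trans)
qed

lemma glued_in_herz_ball:
  assumes F: "finite F" and g: "\<And>k. g k \<in> nonneg_measurable lebesgue" "\<And>k. \<rho> (g k) \<le> 1"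
    and a: "\<And>k. 0 \<le> a k" "(\<Sum>k\<in>F. ennreal (weight k powr q) * ennreal (a k) epowr q) \<le> 1"
  shows "(\<lambda>x. \<Sum>k\<in>F. a k * piece k (g k) x) \<in> herz_ball"
proof -
  let ?G = "\<lambda>x. \<Sum>k\<in>F. a k * piece k (g k) x"
  have G: "?G \<in> nonneg_measurable lebesgue"
    by (intro nonneg_measurable_sum nonneg_measurable_cmult piece_nonneg_measurable g a)
  have piece_G: "piece j ?G = (if j \<in> F then (\<lambda>x. a j * piece j (g j) x) else (\<lambda>x. 0))" for j
  proof -
    have "a k * piece k (g k) x * indicator (annulus j) x = (if k = j then a j * piece j (g j) x else 0)" for k x
      using annulus_unique[of x k j] by (auto simp: piece_def indicator_def)
    then have "piece j ?G = (\<lambda>x. \<Sum>k\<in>F. if k = j then a j * piece j (g j) x else 0)"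
      unfolding piece_def[of j ?G] sum_distrib_right by presburger
    then show ?thesis using F by (auto simp: sum.delta)
  qed
  have "\<rho> (piece j ?G) \<le> (if j \<in> F then ennreal (a j) else 0)" for j
  proof (cases "j \<in> F")
    case True
    then have "\<rho> (piece j ?G) = ennreal (a j) * \<rho> (piece j (g j))"
      unfolding piece_G using scale[OF piece_nonneg_measurable[OF g(1)] a(1)] by simp
    also have "\<dots> \<le> ennreal (a j) * 1"
      by (intro mult_left_mono rho_piece_of_test_function g) simp
    finally show ?thesis using True by simp
  next
    case False
    then show ?thesis unfolding piece_G by (simp add: rho_zero)
  qed
  then have "energy ?G \<le> (\<integral>\<^sup>+j. ennreal (weight j powr q) * (if j \<in> F then ennreal (a j) else 0) epowr q \<partial>count_space UNIV)"
    unfolding energy_def using q by (intro nn_integral_mono mult_left_mono epowr_mono) auto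
  also have "\<dots> = (\<Sum>k\<in>F. ennreal (weight k powr q) * ennreal (a k) epowr q)"
    using F by (subst nn_integral_count_space'[of F]) (auto simp: zero_epowr)
  also note a(2)
  finally show ?thesis using G by (simp add: herz_ball_def)
qed

text \<open>Nearly extremal test functions for the pieces of \<open>h\<close> live on disjoint annuli, so they can be glued
  with the coefficients \<open>a k\<close> to one element of the Herz ball, to which the definition of the polar
  applies. This takes the place of the duality between \<open>\<ell>\<^sup>q\<close> and its dual.\<close>

lemma polar_sequence_duality:
  assumes h: "h \<in> herz_polar"
    and a: "\<And>k. 0 \<le> a k" "(\<integral>\<^sup>+k. ennreal (weight k powr q) * ennreal (a k) epowr q \<partial>count_space UNIV) \<le> 1"
  shows "(\<integral>\<^sup>+k. ennreal (a k) * dual_norm (dual_piece k h) \<partial>count_space UNIV) \<le> 1"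
proof (rule nn_integral_count_int_le)
  fix F :: "int set" assume F: "finite F"
  have h_meas [measurable]: "h \<in> borel_measurable lebesgue"
    using h by (auto simp: herz_polar_def dest: polarD)
  let ?S = "{g \<in> nonneg_measurable lebesgue. \<rho> g \<le> 1}"
  have aF: "(\<Sum>k\<in>F. ennreal (weight k powr q) * ennreal (a k) epowr q) \<le> 1"
  proof -
    have "(\<Sum>k\<in>F. ennreal (weight k powr q) * ennreal (a k) epowr q)
        = (\<integral>\<^sup>+k. ennreal (weight k powr q) * ennreal (a k) epowr q * indicator F k \<partial>count_space UNIV)"
      using F by (subst nn_integral_count_space'[of F]) auto
    also have "\<dots> \<le> (\<integral>\<^sup>+k. ennreal (weight k powr q) * ennreal (a k) epowr q \<partial>count_space UNIV)"
      by (intro nn_integral_mono) (simp add: indicator_def)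
    finally show ?thesis using a(2) by (rule order_trans)
  qed
  have "0 + (\<Sum>k\<in>F. SUP g\<in>?S. ennreal (a k) * (pairing g (dual_piece k h))) \<le> 1"
  proof (rule sum_SUP_le[OF F])
    show "?S \<noteq> {}" using rho_zero by (auto simp: nonneg_measurable_def intro!: exI[of _ "\<lambda>x. 0"])
    fix g :: "int \<Rightarrow> real^'n \<Rightarrow> real" assume "\<And>k. g k \<in> ?S"
    then have g: "g k \<in> nonneg_measurable lebesgue" "\<rho> (g k) \<le> 1" for k by auto
    note [measurable] = nonneg_measurableD(1)[OF g(1)]
    let ?G = "\<lambda>x. \<Sum>k\<in>F. a k * piece k (g k) x"
    have "(\<Sum>k\<in>F. ennreal (a k) * (pairing (g k) (dual_piece k h)))
        = (\<integral>\<^sup>+x. (\<Sum>k\<in>F. ennreal (a k) * (ennreal (g k x) * dual_piece k h x)) \<partial>lebesgue)"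
      by (simp add: nn_integral_sum nn_integral_cmult)
    also have "\<dots> = (\<integral>\<^sup>+x. ennreal (?G x) * h x \<partial>lebesgue)"
    proof (intro nn_integral_cong)
      fix x
      have "ennreal (a k) * (ennreal (g k x) * dual_piece k h x) = ennreal (a k * piece k (g k) x) * h x" for k
        using a(1)[of k] nonneg_measurableD(2)[OF g(1), of k x]
        by (auto simp: dual_piece_def piece_def indicator_def ennreal_mult mult.assoc)
      moreover have "ennreal (?G x) = (\<Sum>k\<in>F. ennreal (a k * piece k (g k) x))"
        using a(1) nonneg_measurableD(2)[OF g(1)]
        by (intro sum_ennreal [symmetric]) (auto simp: piece_def)
      ultimately show "(\<Sum>k\<in>F. ennreal (a k) * (ennreal (g k x) * dual_piece k h x)) = ennreal (?G x) * h x"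
        by (simp add: sum_distrib_right)
    qed
    also have "\<dots> \<le> 1"
      using h unfolding herz_polar_def by (rule polarD(2)) (rule glued_in_herz_ball[OF F g a(1) aF])
    finally show "0 + (\<Sum>k\<in>F. ennreal (a k) * (pairing (g k) (dual_piece k h))) \<le> 1"
      by simp
  qed
  then show "(\<Sum>k\<in>F. ennreal (a k) * dual_norm (dual_piece k h)) \<le> 1"
    by (simp add: dual_norm_def SUP_mult_left_ennreal)
qed

lemma dual_norm_dual_piece_le:
  assumes h: "h \<in> herz_polar"
  shows "dual_norm (dual_piece k h) \<le> ennreal (weight k)"
proof -
  define a where "a j = (if j = k then 1 / weight k else 0)" for j
  have a0: "0 \<le> a j" for j using weight_pos[of k] by (simp add: a_def)
  have "(\<integral>\<^sup>+j. ennreal (weight j powr q) * ennreal (a j) epowr q \<partial>count_space UNIV)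
      = ennreal (weight k powr q) * ennreal (1 / weight k) epowr q"
    by (subst nn_integral_count_space'[of "{k}"]) (auto simp: a_def zero_epowr)
  also have "\<dots> = 1"
    using weight_pos[of k] by (simp add: ennreal_epowr ennreal_mult [symmetric] powr_mult [symmetric])
  finally have "(\<integral>\<^sup>+j. ennreal (a j) * dual_norm (dual_piece j h) \<partial>count_space UNIV) \<le> 1"
    by (intro polar_sequence_duality[OF h a0]) simp
  then have "ennreal (1 / weight k) * dual_norm (dual_piece k h) \<le> 1"
    by (subst (asm) nn_integral_count_space'[of "{k}"]) (auto simp: a_def)
  then have "ennreal (weight k) * (ennreal (1 / weight k) * dual_norm (dual_piece k h)) \<le> ennreal (weight k) * 1"
    by (rule mult_left_mono) simp
  then show ?thesis
    using weight_pos[of k] by (simp add: mult.assoc [symmetric] ennreal_mult [symmetric])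
qed

end


section \<open>The maximal operator on the polar\<close>

context herz_frame
begin

text \<open>The norm, up to a constant, of the block of \<open>M\<close> that leads from the annulus of index \<open>k + m\<close> to the
  annulus of index \<open>k\<close>.\<close>

definition decay :: "int \<Rightarrow> real"
  where "decay m = (if m < 0 then 2 powr (\<eta> * of_int m) else 2 powr (- \<eta>' * of_int m))"

lemma decay_pos: "0 < decay m"
  by (simp add: decay_def)

lemma piece_integral_le:
  assumes f: "f \<in> nonneg_measurable lebesgue" and fin: "\<rho> (piece k f) < \<infinity>"
  shows "(\<integral>\<^sup>+x. ennreal (piece k f x) \<partial>lebesgue) \<le> \<rho> (piece k f) * dual_norm (indicator (dyadic_ball k))"
proof -
  have "(\<integral>\<^sup>+x. ennreal (piece k f x) \<partial>lebesgue)
      = (\<integral>\<^sup>+x. ennreal (piece k f x) * indicator (dyadic_ball k) x \<partial>lebesgue)"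
    using annulus_subset_ball[of k] by (intro nn_integral_cong) (auto simp: piece_def indicator_def)
  also have "\<dots> \<le> \<rho> (piece k f) * dual_norm (indicator (dyadic_ball k))"
    by (intro Hoelder piece_nonneg_measurable f fin dual_norm_ball_finite indicator_ball_measurable) simp
  finally show ?thesis .
qed

lemma dual_piece_integral_le:
  assumes h: "h \<in> borel_measurable lebesgue" and fin: "dual_norm (dual_piece j h) < \<infinity>"
  shows "(\<integral>\<^sup>+x. dual_piece j h x \<partial>lebesgue) \<le> \<rho> (indicator (dyadic_ball j)) * dual_norm (dual_piece j h)"
proof -
  have "(\<integral>\<^sup>+x. dual_piece j h x \<partial>lebesgue)
      = (\<integral>\<^sup>+x. ennreal (indicator (dyadic_ball j) x) * dual_piece j h x \<partial>lebesgue)"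
    using annulus_subset_ball[of j] by (intro nn_integral_cong) (auto simp: dual_piece_def indicator_def)
  also have "\<dots> \<le> \<rho> (indicator (dyadic_ball j)) * dual_norm (dual_piece j h)"
    by (intro Hoelder nonneg_measurable_indicator ball_finite fin dual_piece_measurable h) simp_all
  finally show ?thesis .
qed

text \<open>On the annulus \<open>k\<close> the maximal function of the piece \<open>j\<close> is at most the integral of this piece over the
  volume of the larger of the two dyadic balls, up to a constant. Both integrals that arise are estimated
  with \<open>Hoelder\<close> against characteristic functions of dyadic balls.\<close>

lemma far_pairing_le:
  assumes f: "f \<in> nonneg_measurable lebesgue" and h: "h \<in> borel_measurable lebesgue"
    and a: "\<rho> (piece k f) < \<infinity>" and b: "dual_norm (dual_piece j h) < \<infinity>"
    and jk: "k + 2 \<le> j \<or> j + 2 \<le> k"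
    and balls: "\<rho> (indicator (dyadic_ball j)) * dual_norm (indicator (dyadic_ball k))
      \<le> ennreal c * emeasure lebesgue (ball (0::real^'n) (2 powi max j k))" and c: "0 \<le> c"
  shows "(pairing (piece k f) (maximal (dual_piece j h)))
    \<le> ennreal (8 ^ CARD('n) * c) * (\<rho> (piece k f) * dual_norm (dual_piece j h))"
proof -
  note [measurable] = nonneg_measurableD(1)[OF piece_nonneg_measurable[OF f]]
  let ?V = "unit_ball_vol (real CARD('n)) * (2 powi max j k) ^ CARD('n)"
  let ?K = "8 ^ CARD('n) / ?V"
  let ?I = "\<integral>\<^sup>+x. dual_piece j h x \<partial>lebesgue"
  let ?r = "\<rho> (indicator (dyadic_ball j))" and ?d = "dual_norm (indicator (dyadic_ball k))"
  let ?a = "\<rho> (piece k f)" and ?b = "dual_norm (dual_piece j h)"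
  have V: "0 < ?V" by simp
  have "(pairing (piece k f) (maximal (dual_piece j h)))
      \<le> (\<integral>\<^sup>+x. (ennreal ?K * ?I) * ennreal (piece k f x) \<partial>lebesgue)"
  proof (intro nn_integral_mono)
    fix x :: "real^'n"
    show "ennreal (piece k f x) * maximal (dual_piece j h) x \<le> (ennreal ?K * ?I) * ennreal (piece k f x)"
    proof (cases "x \<in> annulus k")
      case True
      then show ?thesis
        using maximal_annulus_le[OF True jk, of h]
        by (simp add: dual_piece_def mult.commute mult_left_mono)
    qed (simp add: piece_def)
  qed
  also have "\<dots> = (ennreal ?K * ?I) * (\<integral>\<^sup>+x. ennreal (piece k f x) \<partial>lebesgue)"
    by (rule nn_integral_cmult) measurable
  also have "\<dots> \<le> (ennreal ?K * (?r * ?b)) * (?a * ?d)"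
    by (intro mult_mono mult_left_mono dual_piece_integral_le piece_integral_le f h a b) auto
  also have "\<dots> = (ennreal ?K * (?r * ?d)) * (?a * ?b)" by (simp add: ac_simps)
  also have "\<dots> \<le> (ennreal ?K * (ennreal c * ennreal ?V)) * (?a * ?b)"
    using balls by (intro mult_right_mono mult_left_mono) (simp_all add: emeasure_lebesgue_ball del: emeasure_completion)
  also have "ennreal ?K * (ennreal c * ennreal ?V) = ennreal (8 ^ CARD('n) * c)"
  proof -
    have "?K * (c * ?V) = 8 ^ CARD('n) * c"
      using less_imp_neq[OF V] by simp
    then show ?thesis using V c by (metis ennreal_mult' ennreal_mult less_imp_le mult_nonneg_nonneg divide_nonneg_pos zero_le_power zero_le_numeral)
  qed
  finally show ?thesis .
qed

lemma near_pairing_le: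
  assumes M: "0 < A" "\<And>h. h \<in> borel_measurable lebesgue \<Longrightarrow> dual_norm h < \<infinity> \<Longrightarrow>
      dual_norm (maximal h) \<le> ennreal A * dual_norm h"
    and f: "f \<in> nonneg_measurable lebesgue" and h: "h \<in> borel_measurable lebesgue"
    and a: "\<rho> (piece k f) < \<infinity>" and b: "dual_norm (dual_piece j h) < \<infinity>"
  shows "(pairing (piece k f) (maximal (dual_piece j h)))
    \<le> ennreal A * (\<rho> (piece k f) * dual_norm (dual_piece j h))"
proof -
  have le: "dual_norm (maximal (dual_piece j h)) \<le> ennreal A * dual_norm (dual_piece j h)"
    by (intro M dual_piece_measurable h b)
  also have "\<dots> < \<infinity>" using b by (simp add: ennreal_mult_less_top)
  finally have "(pairing (piece k f) (maximal (dual_piece j h)))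
      \<le> \<rho> (piece k f) * dual_norm (maximal (dual_piece j h))"
    by (intro Hoelder piece_nonneg_measurable f borel_measurable_maximal a)
  also have "\<dots> \<le> \<rho> (piece k f) * (ennreal A * dual_norm (dual_piece j h))"
    by (rule mult_left_mono[OF le]) simp
  finally show ?thesis by (simp add: ac_simps)
qed

text \<open>The product \<open>\<rho>(\<chi>\<^sub>j) \<parallel>\<chi>\<^sub>k\<parallel>'\<close> of the norm and the dual norm of two different dyadic balls is reduced to
  the larger ball, where \<open>rho_ball_times_dual_norm_ball_le\<close> applies. The factor lost by the
  smaller ball is the decay, with rate \<open>\<eta>\<close> if it is measured in the space (\<open>j < k\<close>) and with rate
  \<open>\<eta>'\<close> if it is measured in the dual (\<open>j > k\<close>).\<close>

lemma pairing_decay: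
  obtains D where "0 < D"
    "\<And>f h j k. f \<in> nonneg_measurable lebesgue \<Longrightarrow> h \<in> borel_measurable lebesgue \<Longrightarrow>
      \<rho> (piece k f) < \<infinity> \<Longrightarrow> dual_norm (dual_piece j h) < \<infinity> \<Longrightarrow>
      (pairing (piece k f) (maximal (dual_piece j h)))
      \<le> ennreal (D * decay (j - k)) * (\<rho> (piece k f) * dual_norm (dual_piece j h))"
proof -
  obtain A where A: "0 < A" "\<And>h. h \<in> borel_measurable lebesgue \<Longrightarrow> dual_norm h < \<infinity> \<Longrightarrow>
      dual_norm (maximal h) \<le> ennreal A * dual_norm h"
    using dual_maximal by blast
  obtain C where C: "0 < C" "\<And>j k. j \<le> k \<Longrightarrow> \<rho> (indicator (dyadic_ball j))
      \<le> ennreal (C * 2 powr (\<eta> * of_int (j - k))) * \<rho> (indicator (dyadic_ball k))"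
    using rho_decay by blast
  obtain C' where C': "0 < C'" "\<And>j k. j \<le> k \<Longrightarrow> dual_norm (indicator (dyadic_ball j))
      \<le> ennreal (C' * 2 powr (\<eta>' * of_int (j - k))) * dual_norm (indicator (dyadic_ball k))"
    using dual_decay by blast
  let ?r = "\<lambda>j. \<rho> (indicator (dyadic_ball j))"
  let ?d = "\<lambda>j. dual_norm (indicator (dyadic_ball j))"
  let ?V = "\<lambda>j. emeasure lebesgue (ball (0::real^'n) (2 powi j))"
  have rd: "?r k * ?d k \<le> ennreal A * ?V k" for k
    by (rule rho_ball_times_dual_norm_ball_le[OF A]) simp_all
  \<comment> \<open>the first term is for \<open>\<bar>j - k\<bar> \<le> 1\<close>, where \<open>decay (j - k)\<close> is at least \<open>2 powr - (\<eta> + \<eta>')\<close>\<close>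
  define D where "D = max (A * 2 powr (\<eta> + \<eta>')) (8 ^ CARD('n) * (A * (C + C')))"
  have D_near: "A * 2 powr (\<eta> + \<eta>') \<le> D" and D_far: "8 ^ CARD('n) * (A * (C + C')) \<le> D"
    by (simp_all add: D_def)
  have "0 < A * 2 powr (\<eta> + \<eta>')" using A by simp
  then have D: "0 < D" using D_near by linarith
  show ?thesis
  proof (rule that[OF D])
    fix f :: "real^'n \<Rightarrow> real" and h :: "real^'n \<Rightarrow> ennreal" and j k
    assume *: "f \<in> nonneg_measurable lebesgue" "h \<in> borel_measurable lebesgue"
      "\<rho> (piece k f) < \<infinity>" "dual_norm (dual_piece j h) < \<infinity>"
    let ?ab = "\<rho> (piece k f) * dual_norm (dual_piece j h)"
    have far: "(pairing (piece k f) (maximal (dual_piece j h)))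
        \<le> ennreal (D * decay (j - k)) * ?ab"
      if jk: "k + 2 \<le> j \<or> j + 2 \<le> k" and c: "0 \<le> c" "c \<le> A * ((C + C') * decay (j - k))"
        and rdjk: "?r j * ?d k \<le> ennreal c * ?V (max j k)" for c
    proof -
      have "8 ^ CARD('n) * c \<le> 8 ^ CARD('n) * (A * ((C + C') * decay (j - k)))"
        by (intro mult_left_mono c) simp
      also have "\<dots> = (8 ^ CARD('n) * (A * (C + C'))) * decay (j - k)" by (simp add: ac_simps)
      also have "\<dots> \<le> D * decay (j - k)"
        by (intro mult_right_mono D_far less_imp_le decay_pos)
      finally have "ennreal (8 ^ CARD('n) * c) * ?ab \<le> ennreal (D * decay (j - k)) * ?ab"
        by (intro mult_right_mono ennreal_leI) simp_all
      with far_pairing_le[OF * jk rdjk c(1)] show ?thesis by (rule order_trans)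
    qed
    consider "j + 2 \<le> k" | "k + 2 \<le> j" | "\<bar>j - k\<bar> \<le> 1" by linarith
    then show "(pairing (piece k f) (maximal (dual_piece j h)))
        \<le> ennreal (D * decay (j - k)) * ?ab"
    proof cases
      case 1
      define t where "t = C * 2 powr (\<eta> * of_int (j - k))"
      have t: "0 \<le> t" "decay (j - k) = 2 powr (\<eta> * of_int (j - k))"
        using C(1) 1 by (simp_all add: t_def decay_def)
      have "?r j * ?d k \<le> (ennreal t * ?r k) * ?d k"
        unfolding t_def using 1 by (intro mult_right_mono C(2)) simp_all
      also have "\<dots> \<le> ennreal t * (ennreal A * ?V k)"
        unfolding mult.assoc by (intro mult_left_mono rd) simp
      also have "\<dots> = ennreal (A * t) * ?V (max j k)"
        using A(1) t 1 by (simp add: ennreal_mult ac_simps max_def)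
      finally show ?thesis
        using 1 t A(1) C(1) C'(1) by (intro far[of "A * t"]) (auto simp: t_def)
    next
      case 2
      define t where "t = C' * 2 powr (\<eta>' * of_int (k - j))"
      have t: "0 \<le> t" "decay (j - k) = 2 powr (\<eta>' * of_int (k - j))"
        using C'(1) 2 by (simp_all add: t_def decay_def algebra_simps)
      have "?r j * ?d k \<le> ?r j * (ennreal t * ?d j)"
        unfolding t_def using 2 by (intro mult_left_mono C'(2)) simp_all
      also have "\<dots> = ennreal t * (?r j * ?d j)" by (simp add: ac_simps)
      also have "\<dots> \<le> ennreal t * (ennreal A * ?V j)"
        by (intro mult_left_mono rd) simp
      also have "\<dots> = ennreal (A * t) * ?V (max j k)"
        using A(1) t 2 by (simp add: ennreal_mult ac_simps max_def)
      finally show ?thesis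
        using 2 t A(1) C(1) C'(1) by (intro far[of "A * t"]) (auto simp: t_def)
    next
      case 3
      have "2 powr (- (\<eta> + \<eta>')) \<le> decay (j - k)"
      proof -
        have "\<eta> * (- 1) \<le> \<eta> * of_int (j - k)"
          using 3 eta by (intro mult_left_mono) auto
        moreover have "\<eta>' * of_int (j - k) \<le> \<eta>' * 1"
          using 3 eta by (intro mult_left_mono) auto
        ultimately have "- (\<eta> + \<eta>') \<le> \<eta> * of_int (j - k)" "- (\<eta> + \<eta>') \<le> - \<eta>' * of_int (j - k)"
          using eta by linarith+
        then show ?thesis
          unfolding decay_def by (cases "j - k < 0") (simp_all only: if_True if_False powr_mono one_le_numeral)
      qed
      then have "(A * 2 powr (\<eta> + \<eta>')) * 2 powr (- (\<eta> + \<eta>')) \<le> D * decay (j - k)"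
        using D by (intro mult_mono D_near) auto
      then have "A \<le> D * decay (j - k)"
        by (simp add: mult.assoc powr_add [symmetric])
      then have "ennreal A * ?ab \<le> ennreal (D * decay (j - k)) * ?ab"
        by (intro mult_right_mono ennreal_leI) simp_all
      with near_pairing_le[OF A *] show ?thesis by (rule order_trans)
    qed
  qed
qed

text \<open>The ratios of the two geometric series are \<open>2 powr (\<beta> - \<eta>')\<close> and \<open>2 powr - (\<eta> + \<beta>)\<close>; this is
  where the admissible range of \<open>\<beta>\<close> comes from.\<close>

lemma decay_weight_summable:
  "(\<integral>\<^sup>+m. ennreal (decay m) * ennreal (weight m) \<partial>count_space UNIV) < \<infinity>"
proof -
  let ?f = "\<lambda>m. ennreal (decay m) * ennreal (weight m)"
  define s where "s = 2 powr (\<beta> - \<eta>')"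
  define t where "t = 2 powr (- (\<eta> + \<beta>))"
  have s: "0 < s" "s < 1" using eta by (simp_all add: s_def powr_less_one)
  have t: "0 < t" "t < 1" using eta by (simp_all add: t_def powr_less_one)
  have f_pos: "?f (int i) = ennreal (s ^ i)" for i
    by (simp add: decay_def weight_def s_def ennreal_mult [symmetric] powr_add [symmetric]
        powr_realpow [symmetric] powr_powr algebra_simps)
  have f_neg: "?f (- int i) = ennreal (t ^ i)" for i
    by (cases "i = 0") (simp_all add: decay_def weight_def t_def ennreal_mult [symmetric] powr_add [symmetric]
        powr_realpow [symmetric] powr_powr algebra_simps)
  have "(\<integral>\<^sup>+m. ?f m \<partial>count_space UNIV) \<le> (\<Sum>i. ennreal (s ^ i)) + (\<Sum>i. ennreal (t ^ i))"
    unfolding nn_integral_count_int_eq_SUP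
  proof (rule SUP_least)
    fix n :: nat
    have "{- int n..int n} \<subseteq> int ` {..n} \<union> (\<lambda>i. - int i) ` {..n}"
    proof
      fix m assume m: "m \<in> {- int n..int n}"
      show "m \<in> int ` {..n} \<union> (\<lambda>i. - int i) ` {..n}"
      proof (cases "0 \<le> m")
        case True
        then have "m = int (nat m)" "nat m \<in> {..n}" using m by auto
        then show ?thesis by blast
      next
        case False
        then have "m = - int (nat (- m))" "nat (- m) \<in> {..n}" using m by auto
        then show ?thesis by blast
      qed
    qed
    then have "(\<Sum>m\<in>{- int n..int n}. ?f m) \<le> (\<Sum>m\<in>int ` {..n} \<union> (\<lambda>i. - int i) ` {..n}. ?f m)"
      by (intro sum_mono2) auto
    also have "\<dots> \<le> (\<Sum>m\<in>int ` {..n}. ?f m) + (\<Sum>m\<in>(\<lambda>i. - int i) ` {..n}. ?f m)"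
      by (subst sum.union_inter [of "int ` {..n}" "(\<lambda>i. - int i) ` {..n}" ?f, symmetric]) simp_all
    also have "\<dots> = (\<Sum>i\<le>n. ennreal (s ^ i)) + (\<Sum>i\<le>n. ennreal (t ^ i))"
      by (simp add: sum.reindex inj_on_def f_pos f_neg)
    also have "\<dots> \<le> (\<Sum>i. ennreal (s ^ i)) + (\<Sum>i. ennreal (t ^ i))"
      by (intro add_mono sum_le_suminf) auto
    finally show "(\<Sum>m\<in>{- int n..int n}. ?f m) \<le> (\<Sum>i. ennreal (s ^ i)) + (\<Sum>i. ennreal (t ^ i))" .
  qed
  also have "\<dots> = ennreal (\<Sum>i. s ^ i) + ennreal (\<Sum>i. t ^ i)"
    using s t by (intro arg_cong2[where f="(+)"] suminf_ennreal2) (auto intro!: summable_geometric)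
  also have "\<dots> < \<infinity>" by simp
  finally show ?thesis .
qed

lemma maximal_le_sum_annuli:
  assumes [measurable]: "h \<in> borel_measurable lebesgue"
  shows "maximal h x \<le> (\<integral>\<^sup>+j. maximal (dual_piece j h) x \<partial>count_space UNIV)"
proof -
  have "maximal h x = maximal (\<lambda>y. \<integral>\<^sup>+j. dual_piece j h y \<partial>count_space UNIV) x"
    using AE_not_zero unfolding dual_piece_def
    by (intro maximal_cong_AE) (auto elim!: eventually_mono simp: sum_annuli)
  also have "\<dots> \<le> (\<integral>\<^sup>+j. maximal (dual_piece j h) x \<partial>count_space UNIV)"
    by (rule maximal_countable_sum_le) simp_all
  finally show ?thesis .
qed

text \<open>Shifting the sequence of annular norms of \<open>f\<close> by \<open>m\<close> multiplies its norm in the weighted \<open>\<ell>\<^sup>q\<close> by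
  \<open>weight m\<close>.\<close>

lemma shifted_pairing_le:
  assumes f: "f \<in> herz_ball" and h: "h \<in> herz_polar"
  shows "(\<integral>\<^sup>+k. \<rho> (piece k f) * dual_norm (dual_piece (k + m) h) \<partial>count_space UNIV) \<le> ennreal (weight m)"
proof -
  have fE: "energy f \<le> 1" using f by (simp add: herz_ball_def)
  define a where "a k = enn2real (\<rho> (piece (k - m) f)) / weight m" for k
  have a0: "0 \<le> a k" for k using weight_pos[of m] by (simp add: a_def)
  have rho_eq: "\<rho> (piece (k - m) f) = ennreal (weight m) * ennreal (a k)" for k
    using rho_piece_finite[OF fE, of "k - m"] weight_pos[of m]
    by (simp add: a_def ennreal_mult [symmetric])
  have term_eq: "ennreal (weight k powr q) * ennreal (a k) epowr q
      = ennreal (weight (k - m) powr q) * \<rho> (piece (k - m) f) epowr q" for k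
  proof -
    have "weight k = weight (k - m) * weight m" using weight_pos[of m] by (simp add: weight_diff)
    then have "ennreal (weight k powr q) * ennreal (a k) epowr q
        = ennreal (weight (k - m) powr q) * (ennreal (weight m powr q) * ennreal (a k) epowr q)"
      using weight_pos[of m] weight_pos[of "k - m"]
      by (simp add: powr_mult ennreal_mult mult.assoc)
    also have "ennreal (weight m powr q) * ennreal (a k) epowr q = \<rho> (piece (k - m) f) epowr q"
      unfolding rho_eq using weight_pos[of m] q by (simp add: epowr_mult)
    finally show ?thesis .
  qed
  have shift: "bij_betw (\<lambda>k. k - m) UNIV UNIV" for m :: int
    by (rule bij_betwI[where g = "\<lambda>k. k + m"]) auto
  have "(\<integral>\<^sup>+k. ennreal (weight k powr q) * ennreal (a k) epowr q \<partial>count_space UNIV) = energy f"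
    unfolding term_eq energy_def by (rule nn_integral_bij_count_space[OF shift])
  then have "(\<integral>\<^sup>+k. ennreal (a k) * dual_norm (dual_piece k h) \<partial>count_space UNIV) \<le> 1"
    using fE by (intro polar_sequence_duality[OF h a0]) simp
  then have "ennreal (weight m) * (\<integral>\<^sup>+k. ennreal (a k) * dual_norm (dual_piece k h) \<partial>count_space UNIV) \<le> ennreal (weight m) * 1"
    by (rule mult_left_mono) simp
  also have "ennreal (weight m) * (\<integral>\<^sup>+k. ennreal (a k) * dual_norm (dual_piece k h) \<partial>count_space UNIV)
      = (\<integral>\<^sup>+k. \<rho> (piece (k - m) f) * dual_norm (dual_piece (k - m + m) h) \<partial>count_space UNIV)"
    unfolding rho_eq by (subst nn_integral_cmult [symmetric]) (simp_all add: mult.assoc)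
  also have "\<dots> = (\<integral>\<^sup>+k. \<rho> (piece k f) * dual_norm (dual_piece (k + m) h) \<partial>count_space UNIV)"
    by (rule nn_integral_bij_count_space[OF shift])
  finally show ?thesis by simp
qed

text \<open>The double sum over pairs of annuli is arranged by the diagonals \<open>j = k + m\<close>. By
  \<open>shifted_pairing_le\<close> the diagonal \<open>m\<close> contributes at most \<open>D * decay m * weight m\<close>.\<close>

theorem maximal_bounded_on_polar:
  obtains L where "0 < L"
    "\<And>h. h \<in> herz_polar \<Longrightarrow> (\<lambda>x. ennreal (1 / L) * maximal h x) \<in> herz_polar"
proof -
  obtain D where D: "0 < D"
    "\<And>f h j k. f \<in> nonneg_measurable lebesgue \<Longrightarrow> h \<in> borel_measurable lebesgue \<Longrightarrow>
      \<rho> (piece k f) < \<infinity> \<Longrightarrow> dual_norm (dual_piece j h) < \<infinity> \<Longrightarrow>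
      (pairing (piece k f) (maximal (dual_piece j h)))
      \<le> ennreal (D * decay (j - k)) * (\<rho> (piece k f) * dual_norm (dual_piece j h))"
    using pairing_decay by blast
  define S where "S = (\<integral>\<^sup>+m. ennreal (decay m) * ennreal (weight m) \<partial>count_space UNIV)"
  have S: "S < \<infinity>" unfolding S_def by (rule decay_weight_summable)
  define L where "L = D * enn2real S + 1"
  have L: "0 < L" "ennreal D * S \<le> ennreal L"
  proof -
    show "0 < L" using D(1) by (auto simp: L_def intro!: add_nonneg_pos)
    have "ennreal D * S = ennreal (D * enn2real S)" using S D(1) by (simp add: ennreal_mult)
    also have "\<dots> \<le> ennreal L" by (intro ennreal_leI) (simp add: L_def)
    finally show "ennreal D * S \<le> ennreal L" .
  qed
  have main: "pairing f (maximal h) \<le> ennreal L"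
    if f: "f \<in> herz_ball" and h: "h \<in> herz_polar" for f h
  proof -
    have fE: "energy f \<le> 1" and f_nn: "f \<in> nonneg_measurable lebesgue"
      using f by (auto simp: herz_ball_def)
    have h_meas [measurable]: "h \<in> borel_measurable lebesgue"
      using h by (auto simp: herz_polar_def dest: polarD)
    note [measurable] = nonneg_measurableD(1)[OF piece_nonneg_measurable[OF f_nn]]
    note a = rho_piece_finite[OF fE]
    have b: "dual_norm (dual_piece j h) < \<infinity>" for j
      by (rule le_less_trans[OF dual_norm_dual_piece_le[OF h]]) simp
    let ?a = "\<lambda>k. \<rho> (piece k f)" and ?b = "\<lambda>j. dual_norm (dual_piece j h)"
    have "(pairing f (maximal h))
        \<le> (\<integral>\<^sup>+x. (\<integral>\<^sup>+k. ennreal (piece k f x) * maximal h x \<partial>count_space UNIV) \<partial>lebesgue)"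
    proof (intro nn_integral_mono_AE)
      show "AE x in lebesgue. ennreal (f x) * maximal h x
          \<le> (\<integral>\<^sup>+k. ennreal (piece k f x) * maximal h x \<partial>count_space UNIV)"
        using AE_not_zero
      proof eventually_elim
        case (elim x)
        have "ennreal (f x) * maximal h x
            = (\<integral>\<^sup>+k. ennreal (f x) * maximal h x * indicator (annulus k) x \<partial>count_space UNIV)"
          by (rule sum_annuli[OF elim, symmetric])
        also have "\<dots> = (\<integral>\<^sup>+k. ennreal (piece k f x) * maximal h x \<partial>count_space UNIV)"
          by (intro nn_integral_cong) (simp add: piece_def indicator_def)
        finally show ?case by simp
      qed
    qed
    also have "\<dots> = (\<integral>\<^sup>+k. (pairing (piece k f) (maximal h)) \<partial>count_space UNIV)"
      by (rule nn_integral_count_space_nn_integral) simp_all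
    also have "\<dots> \<le> (\<integral>\<^sup>+k. (\<integral>\<^sup>+j. ennreal (D * decay (j - k)) * (?a k * ?b j) \<partial>count_space UNIV) \<partial>count_space UNIV)"
    proof (intro nn_integral_mono)
      fix k :: int
      have "(pairing (piece k f) (maximal h))
          \<le> (\<integral>\<^sup>+x. (\<integral>\<^sup>+j. ennreal (piece k f x) * maximal (dual_piece j h) x \<partial>count_space UNIV) \<partial>lebesgue)"
        by (intro nn_integral_mono) (simp add: nn_integral_cmult mult_left_mono maximal_le_sum_annuli)
      also have "\<dots> = (\<integral>\<^sup>+j. (pairing (piece k f) (maximal (dual_piece j h))) \<partial>count_space UNIV)"
        by (rule nn_integral_count_space_nn_integral) simp_all
      also have "\<dots> \<le> (\<integral>\<^sup>+j. ennreal (D * decay (j - k)) * (?a k * ?b j) \<partial>count_space UNIV)"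
        by (intro nn_integral_mono D(2) f_nn h_meas a b)
      finally show "(pairing (piece k f) (maximal h))
          \<le> (\<integral>\<^sup>+j. ennreal (D * decay (j - k)) * (?a k * ?b j) \<partial>count_space UNIV)" .
    qed
    also have "\<dots> = (\<integral>\<^sup>+k. (\<integral>\<^sup>+m. ennreal (D * decay m) * (?a k * ?b (k + m)) \<partial>count_space UNIV) \<partial>count_space UNIV)"
    proof (rule nn_integral_cong)
      fix k :: int
      have "bij_betw (\<lambda>m. k + m) UNIV UNIV"
        by (rule bij_betwI[where g = "\<lambda>j. j - k"]) auto
      from nn_integral_bij_count_space[OF this, of "\<lambda>j. ennreal (D * decay (j - k)) * (?a k * ?b j)"]
      show "(\<integral>\<^sup>+j. ennreal (D * decay (j - k)) * (?a k * ?b j) \<partial>count_space UNIV)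
          = (\<integral>\<^sup>+m. ennreal (D * decay m) * (?a k * ?b (k + m)) \<partial>count_space UNIV)"
        by simp
    qed
    also have "\<dots> = (\<integral>\<^sup>+m. (\<integral>\<^sup>+k. ennreal (D * decay m) * (?a k * ?b (k + m)) \<partial>count_space UNIV) \<partial>count_space UNIV)"
      by (rule nn_integral_count_space_nn_integral) simp_all
    also have "\<dots> \<le> (\<integral>\<^sup>+m. ennreal (D * decay m) * ennreal (weight m) \<partial>count_space UNIV)"
      by (intro nn_integral_mono) (simp add: nn_integral_cmult mult_left_mono shifted_pairing_le[OF f h])
    also have "\<dots> = ennreal D * S"
      unfolding S_def using D(1) decay_pos
      by (subst nn_integral_cmult [symmetric]) (simp_all add: ennreal_mult less_imp_le mult.assoc)
    also have "\<dots> \<le> ennreal L" by (rule L)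
    finally show ?thesis .
  qed
  show ?thesis
  proof (rule that[OF L(1)])
    fix h assume h: "h \<in> herz_polar"
    show "(\<lambda>x. ennreal (1 / L) * maximal h x) \<in> herz_polar"
      unfolding herz_polar_def
    proof (rule polarI)
      fix f assume f: "f \<in> herz_ball"
      then have [measurable]: "f \<in> borel_measurable lebesgue" by (auto simp: herz_ball_def dest: nonneg_measurableD)
      have "(\<integral>\<^sup>+x. ennreal (f x) * (ennreal (1 / L) * maximal h x) \<partial>lebesgue)
          = (\<integral>\<^sup>+x. ennreal (1 / L) * (ennreal (f x) * maximal h x) \<partial>lebesgue)"
        by (simp add: ac_simps)
      also have "\<dots> = ennreal (1 / L) * (pairing f (maximal h))"
        by (rule nn_integral_cmult) measurable
      also have "\<dots> \<le> ennreal (1 / L) * ennreal L" by (intro mult_left_mono main f h) simp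
      also have "\<dots> = 1" using L(1) by (simp add: ennreal_mult [symmetric])
      finally show "(\<integral>\<^sup>+x. ennreal (f x) * (ennreal (1 / L) * maximal h x) \<partial>lebesgue) \<le> 1" .
    qed simp
  qed
qed

end


section \<open>Extrapolation from weighted inequalities\<close>

text \<open>Local integrability comes with the \<open>A\<^sub>1\<close> condition: every ball contains a point at which the maximal
  function is finite.\<close>

lemma A1_weightI:
  fixes w :: "real^'n::finite \<Rightarrow> real"
  assumes [measurable]: "w \<in> borel_measurable lebesgue" and w: "\<And>x. 0 < w x" and C: "0 < C"
    and M: "AE x in lebesgue. maximal (\<lambda>x. ennreal (w x)) x \<le> ennreal (C * w x)"
  shows "w \<in> A1_weights"
proof -
  have ball_le: "(\<integral>\<^sup>+y\<in>ball c r. ennreal (w y) \<partial>lebesgue) \<le> emeasure lebesgue (ball c r) * ennreal (C * w x)"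
    if "x \<in> ball c r" "maximal (\<lambda>x. ennreal (w x)) x \<le> ennreal (C * w x)" for x c r
    using ball_integral_le_maximal[OF that(1)] that(2) by (rule order_trans[OF _ mult_left_mono]) simp
  have measure_eq: "emeasure lebesgue (ball c r) = ennreal (measure lebesgue (ball c r))" for c :: "real^'n" and r
    using emeasure_ball_neq_top by (intro emeasure_eq_ennreal_measure) simp
  have "C \<in> A1_bounds w"
    unfolding A1_bounds_def
  proof (intro CollectI conjI allI impI C)
    fix c :: "real^'n" and r :: real assume r: "0 < r"
    show "AE x in lebesgue. x \<in> ball c r \<longrightarrow>
        (LINT y:ball c r|lebesgue. w y) / measure lebesgue (ball c r) \<le> C * w x"
      using M
    proof eventually_elim
      case (elim x)
      show ?case
      proof
        assume x: "x \<in> ball c r"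
        have pos: "0 < measure lebesgue (ball c r)"
          using emeasure_ball_neq_0[OF r, of c] measure_eq[of c r]
          by (metis ennreal_0 measure_nonneg order_le_less)
        have "(LINT y:ball c r|lebesgue. w y) = enn2real (\<integral>\<^sup>+y\<in>ball c r. ennreal (w y) \<partial>lebesgue)"
        proof -
          have "(\<lambda>y. indicator (ball c r) y *\<^sub>R w y) \<in> borel_measurable lebesgue" by measurable
          then have "(LINT y:ball c r|lebesgue. w y) = enn2real (\<integral>\<^sup>+y. ennreal (indicator (ball c r) y *\<^sub>R w y) \<partial>lebesgue)"
            unfolding set_lebesgue_integral_def using w
            by (intro integral_eq_nn_integral) (auto simp: less_imp_le)
          also have "(\<integral>\<^sup>+y. ennreal (indicator (ball c r) y *\<^sub>R w y) \<partial>lebesgue) = (\<integral>\<^sup>+y\<in>ball c r. ennreal (w y) \<partial>lebesgue)"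
            by (intro nn_integral_cong) (simp add: indicator_def)
          finally show ?thesis .
        qed
        also have "\<dots> \<le> measure lebesgue (ball c r) * (C * w x)"
          using ball_le[OF x elim] pos C w[of x]
          unfolding measure_eq by (intro enn2real_leI) (simp_all add: ennreal_mult less_imp_le)
        finally show "(LINT y:ball c r|lebesgue. w y) / measure lebesgue (ball c r) \<le> C * w x"
          using pos by (simp add: field_simps)
      qed
    qed
  qed
  moreover have "set_integrable lebesgue F w" if F: "compact F" for F
  proof -
    obtain r where r: "0 < r" "F \<subseteq> ball 0 r"
      using bounded_subset_ballD[OF compact_imp_bounded[OF F]] by blast
    have "\<exists>x\<in>ball 0 r. maximal (\<lambda>x. ennreal (w x)) x \<le> ennreal (C * w x)"
    proof (rule ccontr)
      assume none: "\<not> ?thesis"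
      have "AE x in lebesgue. x \<notin> ball (0::real^'n) r"
        using M by eventually_elim (use none in auto)
      then have "emeasure lebesgue (ball (0::real^'n) r) = 0"
        by (subst (asm) AE_iff_measurable[of "ball 0 r"]) auto
      with emeasure_ball_neq_0[OF r(1)] show False by blast
    qed
    then obtain x where "x \<in> ball 0 r" "maximal (\<lambda>x. ennreal (w x)) x \<le> ennreal (C * w x)" by blast
    from ball_le[OF this]
    have ball_fin: "(\<integral>\<^sup>+y\<in>ball 0 r. ennreal (w y) \<partial>lebesgue) < \<infinity>"
      unfolding measure_eq by (rule le_less_trans) (simp add: ennreal_mult_less_top)
    have F_meas [measurable]: "F \<in> sets lebesgue"
      using F by (simp add: compact_imp_closed)
    have "(\<integral>\<^sup>+x. ennreal (norm (indicator F x *\<^sub>R w x)) \<partial>lebesgue) \<le> (\<integral>\<^sup>+y\<in>ball 0 r. ennreal (w y) \<partial>lebesgue)"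
      using r(2) w by (intro nn_integral_mono) (auto simp: indicator_def less_imp_le)
    also note ball_fin
    finally show ?thesis
      unfolding set_integrable_def by (intro integrableI_bounded) auto
  qed
  ultimately show ?thesis using w by (auto simp: A1_weights_def)
qed

context herz_frame
begin

lemma scaled_in_herz_ball_iff:
  assumes f: "f \<in> nonneg_measurable lebesgue" and t: "0 < t"
  shows "(\<lambda>x. (1 / t) * f x) \<in> herz_ball \<longleftrightarrow> energy f \<le> ennreal (t powr q)"
proof -
  have tq: "0 < t powr q" using t by simp
  have "energy (\<lambda>x. (1 / t) * f x) = ennreal (1 / t powr q) * energy f"
    using energy_scale[OF f, of "1 / t"] t by (simp add: powr_divide)
  moreover have "ennreal (1 / t powr q) * energy f \<le> 1 \<longleftrightarrow> energy f \<le> ennreal (t powr q)"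
  proof
    assume "ennreal (1 / t powr q) * energy f \<le> 1"
    then have "ennreal (t powr q) * (ennreal (1 / t powr q) * energy f) \<le> ennreal (t powr q) * 1"
      by (rule mult_left_mono) simp
    then show "energy f \<le> ennreal (t powr q)"
      using tq by (simp add: mult.assoc [symmetric] ennreal_mult [symmetric])
  next
    assume "energy f \<le> ennreal (t powr q)"
    then have "ennreal (1 / t powr q) * energy f \<le> ennreal (1 / t powr q) * ennreal (t powr q)"
      by (rule mult_left_mono) simp
    then show "ennreal (1 / t powr q) * energy f \<le> 1"
      using tq by (simp add: ennreal_mult [symmetric])
  qed
  ultimately show ?thesis
    using t nonneg_measurable_cmult[OF f, of "1 / t"] by (simp add: herz_ball_def)
qed

lemma polar_pairing_le:
  assumes f: "f \<in> nonneg_measurable lebesgue" and t: "0 < t" and e: "energy f \<le> ennreal (t powr q)"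
    and h: "h \<in> herz_polar"
  shows "pairing f h \<le> ennreal t"
proof -
  have [measurable]: "f \<in> borel_measurable lebesgue" "h \<in> borel_measurable lebesgue"
    using f h by (auto simp: herz_polar_def dest: polarD nonneg_measurableD)
  have ball: "(\<lambda>x. (1 / t) * f x) \<in> herz_ball" using scaled_in_herz_ball_iff[OF f t] e by blast
  have "pairing f h = (\<integral>\<^sup>+x. ennreal t * (ennreal ((1 / t) * f x) * h x) \<partial>lebesgue)"
    using t nonneg_measurableD(2)[OF f]
    by (intro nn_integral_cong) (simp add: mult.assoc [symmetric] ennreal_mult [symmetric])
  also have "\<dots> = ennreal t * (\<integral>\<^sup>+x. ennreal ((1 / t) * f x) * h x \<partial>lebesgue)"
    by (rule nn_integral_cmult) measurable
  also have "\<dots> \<le> ennreal t * 1"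
    using h ball unfolding herz_polar_def by (intro mult_left_mono polarD) auto
  finally show ?thesis by simp
qed

lemma polar_geometric_sum:
  assumes h: "\<And>i::nat. h i \<in> herz_polar"
  shows "(\<lambda>x. \<Sum>i. ennreal ((1/2) ^ Suc i) * h i x) \<in> herz_polar"
  unfolding herz_polar_def
proof (rule polarI)
  have [measurable]: "h i \<in> borel_measurable lebesgue" for i
    using h[of i] by (auto simp: herz_polar_def dest: polarD)
  show "(\<lambda>x. \<Sum>i. ennreal ((1/2) ^ Suc i) * h i x) \<in> borel_measurable lebesgue" by measurable
  fix f assume f: "f \<in> herz_ball"
  then have [measurable]: "f \<in> borel_measurable lebesgue"
    by (auto simp: herz_ball_def dest: nonneg_measurableD)
  have "(\<integral>\<^sup>+x. ennreal (f x) * (\<Sum>i. ennreal ((1/2) ^ Suc i) * h i x) \<partial>lebesgue)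
      = (\<integral>\<^sup>+x. (\<Sum>i. ennreal ((1/2) ^ Suc i) * (ennreal (f x) * h i x)) \<partial>lebesgue)"
    by (intro nn_integral_cong, subst ennreal_suminf_cmult [symmetric])
      (simp only: mult.left_commute)
  also have "\<dots> = (\<Sum>i. ennreal ((1/2) ^ Suc i) * (\<integral>\<^sup>+x. ennreal (f x) * h i x \<partial>lebesgue))"
    by (subst nn_integral_suminf) (simp_all add: nn_integral_cmult del: power_Suc)
  also have "\<dots> \<le> (\<Sum>i. ennreal ((1/2) ^ Suc i) * 1)"
    using h f unfolding herz_polar_def by (intro suminf_le summableI mult_left_mono polarD(2)) auto
  also have "\<dots> = 1"
  proof -
    have "(\<Sum>i. ennreal ((1/2) ^ Suc i)) = ennreal 1"
      by (rule suminf_ennreal_eq[OF _ power_half_series]) simp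
    then show ?thesis by (simp only: mult_1_right ennreal_1)
  qed
  finally show "(\<integral>\<^sup>+x. ennreal (f x) * (\<Sum>i. ennreal ((1/2) ^ Suc i) * h i x) \<partial>lebesgue) \<le> 1" .
qed

lemma geometric_sum_ge: "ennreal ((1/2) ^ Suc i) * h i x \<le> (\<Sum>i. ennreal ((1/2) ^ Suc i) * h i x)"
  using sum_le_suminf[of "\<lambda>i. ennreal ((1/2) ^ Suc i) * h i x" "{i}"] by (simp del: power_Suc)

lemma polar_finite_AE:
  assumes h: "h \<in> herz_polar"
  shows "AE x in lebesgue. h x < \<infinity>"
proof -
  have h_meas [measurable]: "h \<in> borel_measurable lebesgue"
    using h by (auto simp: herz_polar_def dest: polarD)
  have "AE x in lebesgue. dual_piece j h x \<noteq> \<infinity>" for j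
  proof -
    have b: "dual_norm (dual_piece j h) < \<infinity>"
      by (rule le_less_trans[OF dual_norm_dual_piece_le[OF h]]) simp
    have "(\<integral>\<^sup>+x. dual_piece j h x \<partial>lebesgue) \<le> \<rho> (indicator (dyadic_ball j)) * dual_norm (dual_piece j h)"
      by (rule dual_piece_integral_le[OF h_meas b])
    also have "\<dots> < \<infinity>" using b ball_finite[of "2 powi j" 0] by (simp add: ennreal_mult_less_top)
    finally show ?thesis by (intro nn_integral_PInf_AE) auto
  qed
  then have "AE x in lebesgue. \<forall>j. dual_piece j h x \<noteq> \<infinity>"
    unfolding AE_all_countable by blast
  then show ?thesis using AE_not_zero
  proof eventually_elim
    case (elim x)
    obtain j where "x \<in> annulus j" using annulus_exists elim(2) by blast
    then show ?case using elim(1)[rule_format, of j] by (simp add: dual_piece_def less_top)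
  qed
qed

text \<open>The maximal function of such an \<open>h\<close> is positive everywhere, as a weight has to be.\<close>

lemma nonzero_in_polar:
  obtains h where "h \<in> herz_polar" "\<not> (AE x in lebesgue. h x = 0)"
proof -
  let ?d = "dual_norm (indicator (ball 0 (2 powi 0)))"
  have d: "?d < \<infinity>" by (rule dual_norm_ball_finite) simp
  define D where "D = enn2real ?d"
  have D: "?d = ennreal D" "0 \<le> D" using d by (simp_all add: D_def)
  define c where "c = 1 / (D + 1)"
  have c: "0 < c" using D(2) by (simp add: c_def)
  have cd: "ennreal c * ?d \<le> 1"
  proof -
    have "ennreal c * ?d = ennreal (c * D)" unfolding D(1) using D(2) c by (simp add: ennreal_mult)
    also have "\<dots> \<le> 1" using D(2) by (simp add: c_def)
    finally show ?thesis .
  qed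
  define h :: "real^'n \<Rightarrow> ennreal" where "h x = ennreal c * indicator (annulus 0) x" for x
  have h_meas [measurable]: "h \<in> borel_measurable lebesgue"
    unfolding h_def by (intro borel_measurable_times_ennreal borel_measurable_indicator measurable_annulus) simp
  have "h \<in> herz_polar"
    unfolding herz_polar_def
  proof (rule polarI[OF h_meas])
    fix f assume f: "f \<in> herz_ball"
    then have f_nn: "f \<in> nonneg_measurable lebesgue" and fE: "energy f \<le> 1" by (auto simp: herz_ball_def)
    note [measurable] = nonneg_measurableD(1)[OF piece_nonneg_measurable[OF f_nn]]
    have "pairing f h = (\<integral>\<^sup>+x. ennreal c * ennreal (piece 0 f x) \<partial>lebesgue)"
      by (intro nn_integral_cong) (simp add: h_def piece_def indicator_def mult.commute)
    also have "\<dots> = ennreal c * (\<integral>\<^sup>+x. ennreal (piece 0 f x) \<partial>lebesgue)"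
      by (rule nn_integral_cmult) measurable
    also have "\<dots> \<le> ennreal c * (\<rho> (piece 0 f) * ?d)"
      by (intro mult_left_mono piece_integral_le f_nn rho_piece_finite fE) simp
    also have "\<dots> \<le> ennreal c * (1 * ?d)"
      using rho_piece_le[OF fE, of 0] by (intro mult_left_mono mult_right_mono) (simp_all add: weight_def)
    also have "\<dots> \<le> 1" using cd by simp
    finally show "pairing f h \<le> 1" .
  qed
  moreover have "\<not> (AE x in lebesgue. h x = 0)"
  proof
    assume "AE x in lebesgue. h x = 0"
    then have "AE x in lebesgue. (indicator (ball (0::real^'n) 1) x :: ennreal) = indicator (ball 0 (1/2)) x"
      by eventually_elim (use c in \<open>auto simp: h_def indicator_def annulus_def power_int_minus split: if_splits\<close>)
    then have "(\<integral>\<^sup>+x. indicator (ball (0::real^'n) 1) x \<partial>lebesgue) = (\<integral>\<^sup>+x. indicator (ball (0::real^'n) (1/2)) x \<partial>lebesgue)"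
      by (rule nn_integral_cong_AE)
    then have "emeasure lebesgue (ball (0::real^'n) 1) = emeasure lebesgue (ball (0::real^'n) (1/2))"
      by (simp del: emeasure_completion)
    then have "unit_ball_vol (real CARD('n)) = unit_ball_vol (real CARD('n)) * (1/2) ^ CARD('n)"
      by (subst (asm) (1 2) emeasure_lebesgue_ball) simp_all
    then have "(1/2::real) ^ CARD('n) = 1"
      using less_imp_neq[OF unit_ball_vol_pos[of "real CARD('n)"]] by simp
    moreover have "(1/2::real) ^ CARD('n) < 1" by (rule power_less_one_iff[THEN iffD2]) simp_all
    ultimately show False by simp
  qed
  ultimately show ?thesis by (rule that)
qed

text \<open>Rubio de Francia's algorithm. With \<open>M / L\<close> mapping the polar to itself, \<open>R\<close> is the
  series of the terms \<open>2\<^sup>-\<^sup>i\<^sup>-\<^sup>1 (M / L)\<^sup>i h0\<close>; applying \<open>M\<close> shifts the series by one place, so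
  \<open>M R \<le> 2L R\<close>. The weight is \<open>R\<close>, redefined on the null set where it is infinite. The factor \<open>4\<close> arises
  because half of \<open>h\<close> is a term of \<open>h0\<close>, and half of \<open>h0\<close> is a term of \<open>R\<close>.\<close>

lemma A1_majorant:
  assumes h: "h \<in> herz_polar"
  obtains w where "w \<in> A1_weights" "(\<lambda>x. ennreal (w x)) \<in> herz_polar" "\<And>x. 0 < w x"
    "AE x in lebesgue. h x \<le> 4 * ennreal (w x)"
proof -
  obtain L where L: "0 < L" "\<And>h. h \<in> herz_polar \<Longrightarrow> (\<lambda>x. ennreal (1 / L) * maximal h x) \<in> herz_polar"
    using maximal_bounded_on_polar by blast
  obtain e where e: "e \<in> herz_polar" "\<not> (AE x in lebesgue. e x = 0)" using nonzero_in_polar by blast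
  \<comment> \<open>\<open>e\<close> is mixed in to make \<open>R\<close> positive everywhere\<close>
  define h0 where "h0 x = (\<Sum>i. ennreal ((1/2) ^ Suc i) * (if i = (0::nat) then h else e) x)" for x
  have h0: "h0 \<in> herz_polar"
    unfolding h0_def using h e(1) by (intro polar_geometric_sum) auto
  have h0_ge: "ennreal (1/2) * h x \<le> h0 x" "ennreal (1/4) * e x \<le> h0 x" for x
    unfolding h0_def
    using geometric_sum_ge[of 0 "\<lambda>i. if i = 0 then h else e" x]
      geometric_sum_ge[of 1 "\<lambda>i. if i = 0 then h else e" x] by (simp_all add: power2_eq_square)
  have meas [measurable]: "g \<in> borel_measurable lebesgue" if "g \<in> herz_polar" for g
    using that by (auto simp: herz_polar_def dest: polarD)
  define W where "W = rec_nat h0 (\<lambda>_ g x. ennreal (1 / L) * maximal g x)"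
  have W0: "W 0 = h0" and WS: "W (Suc i) = (\<lambda>x. ennreal (1 / L) * maximal (W i) x)" for i
    by (simp_all add: W_def)
  have W: "W i \<in> herz_polar" for i by (induction i) (use h0 L(2) in \<open>simp_all add: W0 WS\<close>)
  note [measurable] = meas[OF W]
  define R where "R x = (\<Sum>i. ennreal ((1/2) ^ Suc i) * W i x)" for x
  have R: "R \<in> herz_polar" unfolding R_def by (rule polar_geometric_sum[OF W])
  note [measurable] = meas[OF R]
  have R_ge: "ennreal ((1/2) ^ Suc i) * W i x \<le> R x" for i x
    unfolding R_def by (rule geometric_sum_ge)
  have MR: "maximal R x \<le> ennreal (2 * L) * R x" for x
  proof -
    have "maximal R x = maximal (\<lambda>y. \<integral>\<^sup>+i. ennreal ((1/2) ^ Suc i) * W i y \<partial>count_space UNIV) x"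
      by (simp add: R_def [abs_def] nn_integral_count_space_nat)
    also have "\<dots> \<le> (\<integral>\<^sup>+i. maximal (\<lambda>y. ennreal ((1/2) ^ Suc i) * W i y) x \<partial>count_space UNIV)"
      by (rule maximal_countable_sum_le) simp_all
    also have "\<dots> \<le> (\<integral>\<^sup>+i. ennreal (2 * L) * (ennreal ((1/2) ^ Suc (Suc i)) * W (Suc i) x) \<partial>count_space UNIV)"
    proof (intro nn_integral_mono)
      fix i :: nat
      have "maximal (\<lambda>y. ennreal ((1/2) ^ Suc i) * W i y) x \<le> ennreal ((1/2) ^ Suc i) * maximal (W i) x"
        by (rule maximal_cmult_le) simp
      also have "ennreal ((1/2) ^ Suc i) * maximal (W i) x
          = ennreal (2 * L) * (ennreal ((1/2) ^ Suc (Suc i)) * ennreal (1 / L)) * maximal (W i) x"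
        using L(1) by (simp add: ennreal_mult [symmetric] field_simps del: ennreal_power)
      finally show "maximal (\<lambda>y. ennreal ((1/2) ^ Suc i) * W i y) x
          \<le> ennreal (2 * L) * (ennreal ((1/2) ^ Suc (Suc i)) * W (Suc i) x)"
        by (simp only: WS mult.assoc)
    qed
    also have "\<dots> = ennreal (2 * L) * (\<Sum>i. ennreal ((1/2) ^ Suc (Suc i)) * W (Suc i) x)"
      by (simp add: nn_integral_cmult nn_integral_count_space_nat del: power_Suc)
    also have "\<dots> \<le> ennreal (2 * L) * R x"
    proof (rule mult_left_mono)
      have "R x = ennreal ((1/2) ^ Suc 0) * W 0 x + (\<Sum>i. ennreal ((1/2) ^ Suc (Suc i)) * W (Suc i) x)"
        unfolding R_def by (subst suminf_offset[where i = 1, OF summableI]) (simp del: power_Suc)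
      then show "(\<Sum>i. ennreal ((1/2) ^ Suc (Suc i)) * W (Suc i) x) \<le> R x" by simp
    qed simp
    finally show ?thesis .
  qed
  have R_pos: "0 < R x" for x
  proof -
    have "\<not> (AE x in lebesgue. h0 x = 0)"
    proof
      assume "AE x in lebesgue. h0 x = 0"
      then have "AE x in lebesgue. e x = 0"
      proof eventually_elim
        case (elim x)
        then show ?case using h0_ge(2)[of x] by simp
      qed
      with e(2) show False ..
    qed
    then have "0 < maximal h0 x" by (intro maximal_pos meas h0)
    then have "0 < ennreal ((1/2) ^ Suc 1) * W 1 x"
      using L(1) by (simp add: WS W0 ennreal_zero_less_mult_iff)
    then show ?thesis using R_ge[of 1 x] by (rule less_le_trans)
  qed
  define w where "w x = (if R x = \<infinity> then 1 else enn2real (R x))" for x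
  have w_pos: "0 < w x" for x
    using R_pos[of x] by (auto simp: w_def enn2real_positive_iff less_top)
  have w_eq: "AE x in lebesgue. ennreal (w x) = R x"
    using polar_finite_AE[OF R] by eventually_elim (simp add: w_def)
  have w_meas [measurable]: "w \<in> borel_measurable lebesgue" unfolding w_def by measurable
  show ?thesis
  proof (rule that[of w])
    have "AE x in lebesgue. maximal (\<lambda>x. ennreal (w x)) x \<le> ennreal (2 * L * w x)"
      using w_eq
    proof eventually_elim
      case (elim x)
      have "maximal (\<lambda>x. ennreal (w x)) x = maximal R x" by (rule maximal_cong_AE[OF w_eq])
      also have "\<dots> \<le> ennreal (2 * L) * ennreal (w x)" using MR[of x] elim by simp
      finally show ?case using L(1) w_pos[of x] by (simp add: ennreal_mult less_imp_le)
    qed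
    then show "w \<in> A1_weights"
      using L(1) w_pos by (intro A1_weightI[of w "2 * L"]) auto
    show "(\<lambda>x. ennreal (w x)) \<in> herz_polar"
      unfolding herz_polar_def
    proof (rule polarI)
      fix f assume f: "f \<in> herz_ball"
      have "(\<integral>\<^sup>+x. ennreal (f x) * ennreal (w x) \<partial>lebesgue) = pairing f R"
        using w_eq by (intro nn_integral_cong_AE) (auto elim!: eventually_mono)
      also have "\<dots> \<le> 1" using R f unfolding herz_polar_def by (rule polarD(2))
      finally show "(\<integral>\<^sup>+x. ennreal (f x) * ennreal (w x) \<partial>lebesgue) \<le> 1" .
    qed simp
    show "AE x in lebesgue. h x \<le> 4 * ennreal (w x)"
      using w_eq
    proof eventually_elim
      case (elim x)
      have "ennreal (1/4) = ennreal (1/2) * ennreal (1/2)"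
        by (subst ennreal_mult [symmetric]) simp_all
      then have "ennreal (1/4) * h x = ennreal (1/2) * (ennreal (1/2) * h x)"
        by (simp only: mult.assoc)
      also have "\<dots> \<le> ennreal (1/2) * h0 x" by (intro mult_left_mono h0_ge) simp
      also have "\<dots> \<le> R x" using R_ge[of 0 x] by (simp add: W0)
      finally have "ennreal 4 * (ennreal (1/4) * h x) \<le> ennreal 4 * R x" by (rule mult_left_mono) simp
      also have "ennreal 4 * (ennreal (1/4) * h x) = h x"
        by (simp add: mult.assoc [symmetric] ennreal_mult [symmetric] del: ennreal_numeral)
      finally show ?case using elim by simp
    qed
  qed (rule w_pos)
qed

text \<open>The weighted constants need not be bounded when \<open>w\<close> varies, not even for a bounded \<open>A\<^sub>1\<close>
  constant. Suppose that the ratios of the norms of \<open>g j\<close> and \<open>f j\<close> exceed \<open>4\<^sup>j\<close>, and that \<open>h j\<close> in the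
  polar witnesses this. A single majorant of \<open>\<Sum> 2\<^sup>-\<^sup>j\<^sup>-\<^sup>1 h j\<close> loses a factor of order \<open>2\<^sup>j\<close> against each
  \<open>h j\<close>, and the remaining \<open>2\<^sup>j\<close> exceeds the constant of this one weight for large \<open>j\<close>.\<close>

theorem extrapolation:
  assumes P: "\<And>f g. (f, g) \<in> P \<Longrightarrow> f \<in> nonneg_measurable lebesgue \<and> g \<in> nonneg_measurable lebesgue"
    and weighted: "\<And>w. w \<in> A1_weights \<Longrightarrow> \<exists>c>0. \<forall>(f, g)\<in>P.
      (\<integral>\<^sup>+x. ennreal (f x) * ennreal (w x) \<partial>lebesgue) < \<infinity> \<longrightarrow>
      (\<integral>\<^sup>+x. ennreal (g x) * ennreal (w x) \<partial>lebesgue)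
        \<le> ennreal c * (\<integral>\<^sup>+x. ennreal (f x) * ennreal (w x) \<partial>lebesgue)"
  obtains C where "0 < C" "\<And>f g. (f, g) \<in> P \<Longrightarrow> energy f < \<infinity> \<Longrightarrow> energy g \<le> ennreal C * energy f"
proof -
  have "\<exists>C>0. \<forall>f g t. (f, g) \<in> P \<longrightarrow> 0 < t \<longrightarrow> energy f \<le> ennreal (t powr q) \<longrightarrow>
      energy g \<le> ennreal ((C * t) powr q)"
  proof (rule ccontr)
    assume none: "\<not> ?thesis"
    have "\<exists>f g t. (f, g) \<in> P \<and> 0 < t \<and> energy f \<le> ennreal (t powr q) \<and>
        \<not> energy g \<le> ennreal ((4 ^ j * t) powr q)" for j :: nat
    proof -
      have "(0::real) < 4 ^ j" by simp
      with none show ?thesis by blast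
    qed
    then obtain f g t where fg: "\<And>j::nat. (f j, g j) \<in> P" and t: "\<And>j. 0 < t j"
      and f: "\<And>j. energy (f j) \<le> ennreal (t j powr q)"
      and g: "\<And>j. \<not> energy (g j) \<le> ennreal ((4 ^ j * t j) powr q)"
      by metis
    have f_nn: "f j \<in> nonneg_measurable lebesgue" and g_nn: "g j \<in> nonneg_measurable lebesgue" for j
      using P[OF fg[of j]] by auto
    interpret B: solid_convex_set lebesgue herz_ball by (rule herz_ball_solid_convex)
    have "\<exists>h\<in>herz_polar. 1 < (\<integral>\<^sup>+x. ennreal ((1 / (4 ^ j * t j)) * g j x) * h x \<partial>lebesgue)" for j
    proof -
      have pos: "0 < 4 ^ j * t j" using t[of j] by simp
      have "(\<lambda>x. (1 / (4 ^ j * t j)) * g j x) \<notin> herz_ball"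
        using scaled_in_herz_ball_iff[OF g_nn pos] g by blast
      moreover have "(\<lambda>x. (1 / (4 ^ j * t j)) * g j x) \<in> nonneg_measurable lebesgue"
        using pos by (intro nonneg_measurable_cmult g_nn) simp
      ultimately show ?thesis
        using B.bipolar[OF sigma_finite_lebesgue] unfolding herz_polar_def by metis
    qed
    then obtain h where h: "\<And>j. h j \<in> herz_polar"
      and big: "\<And>j. 1 < (\<integral>\<^sup>+x. ennreal ((1 / (4 ^ j * t j)) * g j x) * h j x \<partial>lebesgue)"
      by metis
    define H where "H x = (\<Sum>j. ennreal ((1/2) ^ Suc j) * h j x)" for x
    have H: "H \<in> herz_polar" unfolding H_def by (rule polar_geometric_sum[OF h])
    obtain w where w: "w \<in> A1_weights" "(\<lambda>x. ennreal (w x)) \<in> herz_polar" "\<And>x. 0 < w x"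
      and Hw: "AE x in lebesgue. H x \<le> 4 * ennreal (w x)"
      using A1_majorant[OF H] by blast
    have [measurable]: "(\<lambda>x. ennreal (w x)) \<in> borel_measurable lebesgue"
      using w(2) by (auto simp: herz_polar_def dest: polarD)
    obtain c where c: "0 < c" and wc: "\<And>j. (\<integral>\<^sup>+x. ennreal (f j x) * ennreal (w x) \<partial>lebesgue) < \<infinity> \<Longrightarrow>
      (\<integral>\<^sup>+x. ennreal (g j x) * ennreal (w x) \<partial>lebesgue)
        \<le> ennreal c * (\<integral>\<^sup>+x. ennreal (f j x) * ennreal (w x) \<partial>lebesgue)"
      using weighted[OF w(1)] fg by fastforce
    have "2 ^ j \<le> 8 * c" for j :: nat
    proof -
      note [measurable] = nonneg_measurableD(1)[OF g_nn[of j]]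
      let ?K = "(1 / (4 ^ j * t j)) * (4 * 2 ^ Suc j)"
      have K: "0 < ?K" using t[of j] by simp
      have fw: "(\<integral>\<^sup>+x. ennreal (f j x) * ennreal (w x) \<partial>lebesgue) \<le> ennreal (t j)"
        by (rule polar_pairing_le[OF f_nn t f w(2)])
      have "1 < (\<integral>\<^sup>+x. ennreal ((1 / (4 ^ j * t j)) * g j x) * h j x \<partial>lebesgue)" by (rule big)
      also have "\<dots> \<le> (\<integral>\<^sup>+x. ennreal ?K * (ennreal (g j x) * ennreal (w x)) \<partial>lebesgue)"
      proof (rule nn_integral_mono_AE)
        show "AE x in lebesgue. ennreal ((1 / (4 ^ j * t j)) * g j x) * h j x
            \<le> ennreal ?K * (ennreal (g j x) * ennreal (w x))"
          using Hw
        proof eventually_elim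
          case (elim x)
          have "ennreal ((1/2) ^ Suc j) * h j x \<le> 4 * ennreal (w x)"
            unfolding H_def using geometric_sum_ge[of j h x] elim unfolding H_def by (rule order_trans)
          then have "ennreal (2 ^ Suc j) * (ennreal ((1/2) ^ Suc j) * h j x) \<le> ennreal (2 ^ Suc j) * (4 * ennreal (w x))"
            by (rule mult_left_mono) simp
          also have "ennreal (2 ^ Suc j) * (ennreal ((1/2) ^ Suc j) * h j x) = h j x"
          proof -
            have "(2::real) ^ Suc j * (1/2) ^ Suc j = 1" by (simp only: power_mult_distrib [symmetric]) simp
            then have "ennreal (2 ^ Suc j) * ennreal ((1/2) ^ Suc j) = 1"
              by (metis ennreal_1 ennreal_mult zero_le_power zero_le_numeral zero_le_divide_1_iff)
            then show ?thesis by (simp only: mult.assoc [symmetric] mult_1)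
          qed
          also have "ennreal (2 ^ Suc j) * (4 * ennreal (w x)) = ennreal (4 * 2 ^ Suc j) * ennreal (w x)"
          proof -
            have "ennreal (4 * 2 ^ Suc j) = ennreal (2 ^ Suc j) * ennreal 4"
              by (subst ennreal_mult [symmetric]) (simp_all add: mult.commute)
            then show ?thesis by (simp only: ennreal_numeral mult.assoc)
          qed
          finally have hw: "h j x \<le> ennreal (4 * 2 ^ Suc j) * ennreal (w x)" .
          have "ennreal ((1 / (4 ^ j * t j)) * g j x) * h j x
              \<le> ennreal ((1 / (4 ^ j * t j)) * g j x) * (ennreal (4 * 2 ^ Suc j) * ennreal (w x))"
            by (rule mult_left_mono[OF hw]) simp
          also have "\<dots> = ennreal ((1 / (4 ^ j * t j)) * g j x * (4 * 2 ^ Suc j) * w x)"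
            using t[of j] nonneg_measurableD(2)[OF g_nn, of j x] w(3)[of x]
            by (simp add: ennreal_mult [symmetric] less_imp_le mult.assoc del: power_Suc)
          also have "\<dots> = ennreal (?K * (g j x * w x))" by (simp add: ac_simps)
          also have "\<dots> = ennreal ?K * (ennreal (g j x) * ennreal (w x))"
            using K nonneg_measurableD(2)[OF g_nn, of j x] w(3)[of x]
            by (simp only: ennreal_mult less_imp_le mult_nonneg_nonneg)
          finally show ?case .
        qed
      qed
      also have "\<dots> = ennreal ?K * (\<integral>\<^sup>+x. ennreal (g j x) * ennreal (w x) \<partial>lebesgue)"
        by (rule nn_integral_cmult) measurable
      also have "\<dots> \<le> ennreal ?K * (ennreal c * ennreal (t j))"
      proof (rule mult_left_mono)
        have "(\<integral>\<^sup>+x. ennreal (g j x) * ennreal (w x) \<partial>lebesgue)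
            \<le> ennreal c * (\<integral>\<^sup>+x. ennreal (f j x) * ennreal (w x) \<partial>lebesgue)"
          by (rule wc) (rule le_less_trans[OF fw], simp)
        also have "\<dots> \<le> ennreal c * ennreal (t j)" by (rule mult_left_mono[OF fw]) simp
        finally show "(\<integral>\<^sup>+x. ennreal (g j x) * ennreal (w x) \<partial>lebesgue) \<le> ennreal c * ennreal (t j)" .
      qed simp
      also have "\<dots> = ennreal (?K * (c * t j))"
        using K c t[of j] by (simp only: ennreal_mult less_imp_le mult_nonneg_nonneg)
      finally have "1 < ?K * (c * t j)"
        by (simp flip: ennreal_1 add: ennreal_less_iff del: power_Suc)
      also have "?K * (c * t j) = 8 * c * (2 ^ j / 4 ^ j)"
        using t[of j] by (simp add: field_simps)
      also have "(2::real) ^ j / 4 ^ j = 1 / 2 ^ j"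
      proof -
        have "(4::real) ^ j = 2 ^ j * 2 ^ j" by (simp flip: power_mult_distrib)
        then show ?thesis by simp
      qed
      finally show ?thesis by (simp add: field_simps)
    qed
    moreover obtain j :: nat where "8 * c < 2 ^ j" using real_arch_pow[of 2 "8 * c"] by auto
    ultimately show False by (meson not_le)
  qed
  then obtain C where C: "0 < C" "\<And>f g t. (f, g) \<in> P \<Longrightarrow> 0 < t \<Longrightarrow> energy f \<le> ennreal (t powr q) \<Longrightarrow>
      energy g \<le> ennreal ((C * t) powr q)"
    by blast
  show ?thesis
  proof (rule that[of "C powr q"])
    show "0 < C powr q" using C(1) by simp
    fix f g assume fg: "(f, g) \<in> P" and fin: "energy f < \<infinity>"
    define e where "e = enn2real (energy f)"
    have e: "energy f = ennreal e" "0 \<le> e" using fin by (simp_all add: e_def)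
    \<comment> \<open>values \<open>r > e\<close> cover the case \<open>e = 0\<close>, in which \<open>r = e\<close> is excluded\<close>
    have le: "energy g \<le> ennreal (C powr q * r)" if r: "0 < r" "e \<le> r" for r
    proof -
      have root: "(r powr (1 / q)) powr q = r" using r q by (simp add: powr_powr)
      have "energy g \<le> ennreal ((C * r powr (1 / q)) powr q)"
        using r by (intro C(2)[OF fg]) (simp_all add: root e ennreal_leI)
      also have "(C * r powr (1 / q)) powr q = C powr q * r"
        using C(1) r root by (simp add: powr_mult)
      finally show ?thesis .
    qed
    show "energy g \<le> ennreal (C powr q) * energy f"
    proof (rule ennreal_le_epsilon)
      fix d :: real assume d: "0 < d"
      have "energy g \<le> ennreal (C powr q * (e + d / C powr q))"
        using C(1) d e by (intro le) (auto intro!: add_nonneg_pos)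
      also have "C powr q * (e + d / C powr q) = C powr q * e + d"
        using C(1) by (simp add: distrib_left)
      also have "ennreal (C powr q * e + d) = ennreal (C powr q) * energy f + ennreal d"
        using e d by (simp add: ennreal_mult)
      finally show "energy g \<le> ennreal (C powr q) * energy f + ennreal d" .
    qed
  qed
qed

text \<open>A compact set without the origin meets finitely many annuli only.\<close>

lemma rho_compact_finite:
  assumes f: "f \<in> nonneg_measurable lebesgue" and e: "energy f < \<infinity>"
    and F: "compact F" "0 \<notin> F"
  shows "\<rho> (\<lambda>x. f x * indicator F x) < \<infinity>"
proof -
  have fin: "\<rho> (piece k f) < \<infinity>" for k
  proof (rule ccontr)
    assume "\<not> \<rho> (piece k f) < \<infinity>"
    then have "\<rho> (piece k f) = top" by (simp add: not_less top_unique)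
    then have "ennreal (weight k powr q) * \<rho> (piece k f) epowr q = \<infinity>"
      using weight_pos[of k] by (simp add: top_epowr ennreal_mult_top)
    moreover have "ennreal (weight k powr q) * \<rho> (piece k f) epowr q \<le> energy f"
      unfolding energy_def by (rule nn_integral_ge_point) simp
    ultimately show False using e by simp
  qed
  obtain b where b: "\<And>x. x \<in> F \<Longrightarrow> norm x \<le> b"
    using compact_imp_bounded[OF F(1)] unfolding bounded_iff by blast
  obtain a where a: "0 < a" "\<And>x. x \<in> F \<Longrightarrow> a \<le> norm x"
    using separate_point_closed[OF compact_imp_closed[OF F(1)] F(2)] by (auto simp: dist_norm)
  obtain m1 :: nat where m1: "b < 2 ^ m1" using real_arch_pow[of 2 b] by auto
  obtain m2 :: nat where m2: "1 / a < 2 ^ m2" using real_arch_pow[of 2 "1 / a"] by auto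
  let ?I = "{- int m2..int m1 + 1}"
  have cover: "\<exists>k\<in>?I. x \<in> annulus k" if x: "x \<in> F" for x
  proof -
    have "x \<noteq> 0" using x F(2) by auto
    then obtain k where k: "x \<in> annulus k" by (rule annulus_exists)
    have "(2::real) powi (k - 1) < 2 powi (int m1)"
      using k b[OF x] m1 by (simp add: annulus_iff)
    then have "k - 1 < int m1" by (metis linorder_not_le one_le_numeral power_int_increasing)
    moreover have "(2::real) powi (- int m2) < 2 powi k"
    proof -
      have "2 powi (- int m2) < a" using m2 a(1) by (simp add: power_int_minus field_simps)
      then show ?thesis using k a(2)[OF x] by (simp add: annulus_iff)
    qed
    then have "- int m2 < k" by (metis linorder_not_le one_le_numeral power_int_increasing)
    ultimately have "k \<in> ?I" by auto
    with k show ?thesis by blast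
  qed
  have F_meas: "F \<in> sets lebesgue" using F(1) by (simp add: compact_imp_closed)
  have "\<rho> (\<lambda>x. f x * indicator F x) \<le> \<rho> (\<lambda>x. \<Sum>k\<in>?I. piece k f x)"
  proof (rule mono)
    show "(\<lambda>x. \<Sum>k\<in>?I. piece k f x) \<in> nonneg_measurable lebesgue"
      by (intro nonneg_measurable_sum piece_nonneg_measurable f)
    show "(\<lambda>x. f x * indicator F x) \<in> nonneg_measurable lebesgue"
      by (intro nonneg_measurable_mult f nonneg_measurable_indicator F_meas)
    show "AE x in lebesgue. f x * indicator F x \<le> (\<Sum>k\<in>?I. piece k f x)"
    proof (rule AE_I2)
      fix x
      have nn: "0 \<le> piece k f x" for k
        using nonneg_measurableD(2)[OF f] by (simp add: piece_def)
      show "f x * indicator F x \<le> (\<Sum>k\<in>?I. piece k f x)"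
      proof (cases "x \<in> F")
        case True
        then obtain k where k: "k \<in> ?I" "x \<in> annulus k" using cover by blast
        then have "f x * indicator F x = piece k f x" using True by (simp add: piece_def)
        also have "\<dots> \<le> (\<Sum>k\<in>?I. piece k f x)" using k(1) nn by (intro member_le_sum) auto
        finally show ?thesis .
      qed (use nn in \<open>auto intro: sum_nonneg\<close>)
    qed
  qed
  also have "\<dots> \<le> (\<Sum>k\<in>?I. \<rho> (piece k f))"
    by (intro rho_sum_le piece_nonneg_measurable f) simp
  also have "\<dots> < \<infinity>" using fin by (simp add: less_top)
  finally show ?thesis .
qed

end


section \<open>Herz spaces over a ball Banach function space\<close>

definition real_fnorm :: "('n::finite, 'b::{real_normed_field,euclidean_space}) fnorm \<Rightarrow> (real^'n \<Rightarrow> real) \<Rightarrow> ennreal"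
  where "real_fnorm X g = X (\<lambda>x. of_real (g x))"

lemma ball_quasi_banachD:
  assumes "ball_quasi_banach_function_space X"
  shows "f \<in> borel_measurable lebesgue \<Longrightarrow> X (\<lambda>x. c * f x) = ennreal (norm c) * X f"
    and "f \<in> borel_measurable lebesgue \<Longrightarrow> g \<in> borel_measurable lebesgue \<Longrightarrow>
      AE x in lebesgue. norm (g x) \<le> norm (f x) \<Longrightarrow> X g \<le> X f"
    and "(\<And>m. u m \<in> borel_measurable lebesgue) \<Longrightarrow> v \<in> borel_measurable lebesgue \<Longrightarrow>
      AE x in lebesgue. (\<forall>m::nat. 0 \<le> (u m x::real)) \<and> incseq (\<lambda>m. u m x) \<and> (\<lambda>m. u m x) \<longlonglongrightarrow> v x \<Longrightarrow>
      (\<lambda>m. X (\<lambda>x. of_real (u m x))) \<longlonglongrightarrow> X (\<lambda>x. of_real (v x))"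
    and "0 < r \<Longrightarrow> X (indicator (ball a r)) < \<infinity>"
  using assms unfolding ball_quasi_banach_function_space_def quasi_banach_norm_def fspace_def
  by (blast, blast, blast, blast)

lemma ball_quasi_banach_cong_norm:
  assumes "ball_quasi_banach_function_space X" "f \<in> borel_measurable lebesgue" "g \<in> borel_measurable lebesgue"
    and "\<And>x. norm (g x) = norm (f x)"
  shows "X g = X f"
  using assms by (intro antisym ball_quasi_banachD(2)[OF assms(1)]) auto

lemma ball_banachD:
  assumes "ball_banach_function_space X"
  shows "ball_quasi_banach_function_space X"
    and "f \<in> fspace X \<Longrightarrow> g \<in> fspace X \<Longrightarrow> X (\<lambda>x. f x + g x) \<le> X f + X g"
    and "0 < r \<Longrightarrow> \<exists>C>0. \<forall>f\<in>fspace X. (\<integral>\<^sup>+x\<in>ball c r. ennreal (norm (f x)) \<partial>lebesgue) \<le> ennreal C * X f"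
  using assms unfolding ball_banach_function_space_def by (blast, blast, blast)

lemma of_real_indicator_eq: "(\<lambda>x. of_real (indicator A x)) = indicator A"
  by (auto simp: indicator_def)

lemma ball_function_norm_real_fnorm:
  fixes X :: "('n::finite, 'b::{real_normed_field,euclidean_space}) fnorm"
  assumes X: "ball_banach_function_space X"
  shows "ball_function_norm (real_fnorm X)"
proof
  note Q = ball_banachD(1)[OF X]
  have of_real_meas [measurable]: "(\<lambda>x. of_real (f x) :: 'b) \<in> borel_measurable lebesgue"
    if "f \<in> nonneg_measurable lebesgue" for f :: "real^'n \<Rightarrow> real"
    using nonneg_measurableD(1)[OF that] by simp
  fix f g :: "real^'n \<Rightarrow> real" and c :: real
  assume f: "f \<in> nonneg_measurable lebesgue"
  {
    assume "0 \<le> c"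
    then show "real_fnorm X (\<lambda>x. c * f x) = ennreal c * real_fnorm X f"
      using ball_quasi_banachD(1)[OF Q of_real_meas[OF f], of "of_real c"] by (simp add: real_fnorm_def)
  }
  assume g: "g \<in> nonneg_measurable lebesgue"
  show "real_fnorm X (\<lambda>x. f x + g x) \<le> real_fnorm X f + real_fnorm X g"
  proof (cases "real_fnorm X f < \<infinity> \<and> real_fnorm X g < \<infinity>")
    case True
    then show ?thesis
      using ball_banachD(2)[OF X, of "\<lambda>x. of_real (f x)" "\<lambda>x. of_real (g x)"] f g
      by (simp add: real_fnorm_def fspace_def of_real_meas)
  next
    case False
    then have "real_fnorm X f = top \<or> real_fnorm X g = top" by (metis infinity_ennreal_def less_top)
    then have "real_fnorm X f + real_fnorm X g = top" by auto
    then show ?thesis by (simp only: top_greatest)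
  qed
  assume "AE x in lebesgue. g x \<le> f x"
  then have "AE x in lebesgue. norm (of_real (g x) :: 'b) \<le> norm (of_real (f x) :: 'b)"
    using nonneg_measurableD(2)[OF f] nonneg_measurableD(2)[OF g] by (auto elim!: eventually_mono)
  then show "real_fnorm X g \<le> real_fnorm X f"
    unfolding real_fnorm_def by (intro ball_quasi_banachD(2)[OF Q] of_real_meas f g)
next
  fix u :: "nat \<Rightarrow> real^'n \<Rightarrow> real" and v
  assume u: "\<And>m. u m \<in> nonneg_measurable lebesgue" and v: "v \<in> nonneg_measurable lebesgue"
    and lim: "AE x in lebesgue. incseq (\<lambda>m. u m x) \<and> (\<lambda>m. u m x) \<longlonglongrightarrow> v x"
  show "(\<lambda>m. real_fnorm X (u m)) \<longlonglongrightarrow> real_fnorm X v"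
    unfolding real_fnorm_def
  proof (rule ball_quasi_banachD(3)[OF ball_banachD(1)[OF X]])
    show "AE x in lebesgue. (\<forall>m. 0 \<le> u m x) \<and> incseq (\<lambda>m. u m x) \<and> (\<lambda>m. u m x) \<longlonglongrightarrow> v x"
      using lim nonneg_measurableD(2)[OF u] by (auto elim!: eventually_mono)
  qed (use u v in \<open>auto dest: nonneg_measurableD\<close>)
next
  fix c :: "real^'n" and r :: real assume r: "0 < r"
  show "real_fnorm X (indicator (ball c r)) < \<infinity>"
    using ball_quasi_banachD(4)[OF ball_banachD(1)[OF X] r, of c] by (simp add: real_fnorm_def of_real_indicator_eq)
  obtain C where C: "0 < C" "\<And>f. f \<in> fspace X \<Longrightarrow>
      (\<integral>\<^sup>+x\<in>ball c r. ennreal (norm (f x)) \<partial>lebesgue) \<le> ennreal C * X f"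
    using ball_banachD(3)[OF X r] by blast
  show "\<exists>C>0. \<forall>f\<in>nonneg_measurable lebesgue. real_fnorm X f < \<infinity> \<longrightarrow>
      (\<integral>\<^sup>+x\<in>ball c r. ennreal (f x) \<partial>lebesgue) \<le> ennreal C * real_fnorm X f"
  proof (intro exI[of _ C] conjI C(1) ballI impI)
    fix f :: "real^'n \<Rightarrow> real" assume f: "f \<in> nonneg_measurable lebesgue" "real_fnorm X f < \<infinity>"
    then have "(\<lambda>x. of_real (f x)) \<in> fspace X"
      using nonneg_measurableD(1)[OF f(1)] by (simp add: fspace_def real_fnorm_def)
    from C(2)[OF this] show "(\<integral>\<^sup>+x\<in>ball c r. ennreal (f x) \<partial>lebesgue) \<le> ennreal C * real_fnorm X f"
      using nonneg_measurableD(2)[OF f(1)] by (simp add: real_fnorm_def)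
  qed
qed

text \<open>The integrals in both norms see a test function \<open>g\<close> through \<open>\<bar>g\<bar>\<close> only, and \<open>g\<close> and \<open>\<bar>g\<bar>\<close>
  have the same norm.\<close>

lemma associate_eq_dual_norm:
  fixes X :: "('n::finite, 'b::{real_normed_field,euclidean_space}) fnorm"
  assumes X: "ball_banach_function_space X"
  shows "associate X f = ball_function_norm.dual_norm (real_fnorm X) (\<lambda>x. ennreal (norm (f x)))"
proof -
  interpret ball_function_norm "real_fnorm X" by (rule ball_function_norm_real_fnorm[OF X])
  note Q = ball_banachD(1)[OF X]
  show ?thesis
  proof (rule antisym)
    show "associate X f \<le> dual_norm (\<lambda>x. ennreal (norm (f x)))"
      unfolding associate_def
    proof (rule SUP_least)
      fix g :: "real^'n \<Rightarrow> 'b" assume "g \<in> {g \<in> borel_measurable lebesgue. X g \<le> 1}"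
      then have g [measurable]: "g \<in> borel_measurable lebesgue" and g1: "X g \<le> 1" by auto
      have "real_fnorm X (\<lambda>x. norm (g x)) = X g"
        unfolding real_fnorm_def by (intro ball_quasi_banach_cong_norm[OF Q]) auto
      then have "(\<integral>\<^sup>+x. ennreal (norm (g x)) * ennreal (norm (f x)) \<partial>lebesgue) \<le> dual_norm (\<lambda>x. ennreal (norm (f x)))"
        using g1 by (intro dual_normD nonneg_measurableI) auto
      then show "(\<integral>\<^sup>+x. ennreal (norm (f x * g x)) \<partial>lebesgue) \<le> dual_norm (\<lambda>x. ennreal (norm (f x)))"
        by (simp add: norm_mult ennreal_mult mult.commute)
    qed
    show "dual_norm (\<lambda>x. ennreal (norm (f x))) \<le> associate X f"
    proof (rule dual_normI)
      fix g :: "real^'n \<Rightarrow> real" assume g: "g \<in> nonneg_measurable lebesgue" "real_fnorm X g \<le> 1"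
      have "(\<integral>\<^sup>+x. ennreal (g x) * ennreal (norm (f x)) \<partial>lebesgue)
          = (\<integral>\<^sup>+x. ennreal (norm (f x * of_real (g x))) \<partial>lebesgue)"
        using nonneg_measurableD(2)[OF g(1)] by (simp add: norm_mult ennreal_mult mult.commute)
      also have "\<dots> \<le> associate X f"
        unfolding associate_def using g nonneg_measurableD(1)[OF g(1)]
        by (intro SUP_upper) (simp add: real_fnorm_def)
      finally show "(\<integral>\<^sup>+x. ennreal (g x) * ennreal (norm (f x)) \<partial>lebesgue) \<le> associate X f" .
    qed
  qed
qed

lemma (in ball_function_norm) finite_AE_if_dual_norm_finite:
  assumes [measurable]: "h \<in> borel_measurable lebesgue" and fin: "dual_norm h < \<infinity>"
  shows "AE x in lebesgue. h x < \<infinity>"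
proof -
  have "AE x in lebesgue. ennreal (indicator (ball 0 (real (Suc n))) x) * h x \<noteq> \<infinity>" for n
  proof -
    have iB: "indicator (ball 0 (real (Suc n))) \<in> nonneg_measurable lebesgue"
      by (intro nonneg_measurable_indicator) simp
    note [measurable] = nonneg_measurableD(1)[OF iB]
    have rB: "\<rho> (indicator (ball 0 (real (Suc n)))) < \<infinity>" by (rule ball_finite) simp
    have "(\<integral>\<^sup>+x. ennreal (indicator (ball 0 (real (Suc n))) x) * h x \<partial>lebesgue)
        \<le> \<rho> (indicator (ball 0 (real (Suc n)))) * dual_norm h"
      by (intro Hoelder iB rB fin) simp
    also have "\<dots> < \<infinity>" using rB fin by (simp add: ennreal_mult_less_top del: of_nat_Suc)
    finally show ?thesis by (intro nn_integral_PInf_AE) (simp_all del: of_nat_Suc)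
  qed
  then have "AE x in lebesgue. \<forall>n. ennreal (indicator (ball 0 (real (Suc n))) x) * h x \<noteq> \<infinity>"
    unfolding AE_all_countable by blast
  then show ?thesis
  proof eventually_elim
    case (elim x)
    obtain n where "norm x < real n" using reals_Archimedean2 by blast
    then have "x \<in> ball 0 (real (Suc n))" by simp
    then show ?case using elim[rule_format, of n] by (simp add: less_top)
  qed
qed

text \<open>The volumes of the dyadic balls \<open>j\<close> and \<open>k\<close> have the ratio \<open>2 powr (n (j - k))\<close>. Monotonicity is
  used if the denominator of the quotient of norms vanishes.\<close>

lemma delta_exponent_dyadic:
  fixes X :: "('n::finite, 'b::{real_normed_field,euclidean_space}) fnorm"
  assumes d: "delta_exponent X \<delta>"
    and fin: "\<And>k. X (indicator (dyadic_ball k)) < \<infinity>"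
    and mono: "\<And>j k. j \<le> k \<Longrightarrow> X (indicator (dyadic_ball j)) \<le> X (indicator (dyadic_ball k))"
  shows "\<exists>C>0. \<forall>j k. j \<le> k \<longrightarrow> X (indicator (dyadic_ball j))
    \<le> ennreal (C * 2 powr (real CARD('n) * \<delta> * of_int (j - k))) * X (indicator (dyadic_ball k))"
proof -
  obtain C where C: "0 < C" "\<And>c r E. 0 < r \<Longrightarrow> E \<in> sets lebesgue \<Longrightarrow> E \<subseteq> ball c r \<Longrightarrow>
      X (indicator E) / X (indicator (ball c r))
        \<le> ennreal (C * (measure lebesgue E / measure lebesgue (ball c r)) powr \<delta>)"
    using d unfolding delta_exponent_def by blast
  show ?thesis
  proof (intro exI[of _ C] conjI C(1) allI impI)
    fix j k :: int assume jk: "j \<le> k"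
    let ?a = "X (indicator (dyadic_ball j))" and ?b = "X (indicator (dyadic_ball k))"
    have m: "measure lebesgue (ball (0::real^'n) (2 powi i)) = unit_ball_vol (real CARD('n)) * (2 powi i) ^ CARD('n)" for i
      using emeasure_lebesgue_ball[of "2 powi i" "0::real^'n"] by (simp add: measure_def)
    have "measure lebesgue (ball (0::real^'n) (2 powi j)) / measure lebesgue (ball (0::real^'n) (2 powi k))
        = (2 powi j) ^ CARD('n) / (2 powi k) ^ CARD('n)"
      unfolding m using less_imp_neq[OF unit_ball_vol_pos[of "real CARD('n)"]] by simp
    also have "\<dots> = 2 powr (real CARD('n) * of_int (j - k))"
    proof -
      have "(2 powi i) ^ CARD('n) = (2::real) powr (real CARD('n) * of_int i)" for i
        by (simp add: powr_real_of_int' [symmetric] powr_realpow [symmetric] powr_powr mult.commute)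
      then show ?thesis by (simp add: powr_diff right_diff_distrib)
    qed
    finally have ratio: "(measure lebesgue (ball (0::real^'n) (2 powi j)) / measure lebesgue (ball (0::real^'n) (2 powi k))) powr \<delta>
        = 2 powr (real CARD('n) * \<delta> * of_int (j - k))"
      by (simp add: powr_powr ac_simps)
    have "ball (0::real^'n) (2 powi j) \<subseteq> dyadic_ball k"
      using jk by (intro subset_ball power_int_increasing) auto
    then have quot: "?a / ?b \<le> ennreal (C * 2 powr (real CARD('n) * \<delta> * of_int (j - k)))"
      unfolding ratio [symmetric] by (intro C(2)) simp_all
    show "?a \<le> ennreal (C * 2 powr (real CARD('n) * \<delta> * of_int (j - k))) * ?b"
    proof (cases "?b = 0")
      case True
      then show ?thesis using mono[OF jk] by simp
    next
      case False
      then have "?a = ?a / ?b * ?b"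
        using fin[of k] by (simp add: ennreal_divide_times ennreal_divide_self)
      also have "\<dots> \<le> ennreal (C * 2 powr (real CARD('n) * \<delta> * of_int (j - k))) * ?b"
        by (rule mult_right_mono[OF quot]) simp
      finally show ?thesis .
    qed
  qed
qed

lemma herz_frame_real_fnorm:
  fixes X :: "('n::finite, 'b::{real_normed_field,euclidean_space}) fnorm"
  assumes X: "ball_banach_function_space X"
    and M: "maximal_bounded_on (associate X)"
    and \<delta>: "delta_exponent X \<delta>" and \<delta>': "delta_exponent (associate X) \<delta>'"
    and q: "1 \<le> q" and \<beta>: "- (real CARD('n) * \<delta>) < \<beta>" "\<beta> < real CARD('n) * \<delta>'"
  shows "herz_frame (real_fnorm X) \<beta> q (real CARD('n) * \<delta>) (real CARD('n) * \<delta>')"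
proof -
  interpret ball_function_norm "real_fnorm X" by (rule ball_function_norm_real_fnorm[OF X])
  note assoc = associate_eq_dual_norm[OF X]
  have X_ind: "X (indicator A) = real_fnorm X (indicator A)" for A
    by (simp add: real_fnorm_def of_real_indicator_eq)
  have assoc_ind: "associate X (indicator A) = dual_norm (indicator A)" for A
    unfolding assoc by (intro arg_cong[of _ _ dual_norm]) (auto simp: indicator_def)
  have ball_mono: "ball (0::real^'n) (2 powi j) \<subseteq> dyadic_ball k" if "j \<le> k" for j k
    using that by (intro subset_ball power_int_increasing) auto
  show ?thesis
  proof
    show "0 < real CARD('n) * \<delta>" "0 < real CARD('n) * \<delta>'"
      using \<delta> \<delta>' by (simp_all add: delta_exponent_def)
    show "\<exists>A>0. \<forall>h\<in>borel_measurable lebesgue. dual_norm h < \<infinity> \<longrightarrow>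
        dual_norm (maximal h) \<le> ennreal A * dual_norm h"
    proof -
      obtain A where A: "0 < A" "\<And>f. f \<in> fspace (associate X) \<Longrightarrow>
          (AE x in lebesgue. maximal_function f x < \<infinity>) \<and>
          associate X (\<lambda>x. of_real (enn2real (maximal_function f x))) \<le> ennreal A * associate X f"
        using M unfolding maximal_bounded_on_def by blast
      show ?thesis
      proof (intro exI[of _ A] conjI A(1) ballI impI)
        fix h :: "real^'n \<Rightarrow> ennreal"
        assume h [measurable]: "h \<in> borel_measurable lebesgue" and fin: "dual_norm h < \<infinity>"
        define f :: "real^'n \<Rightarrow> 'b" where "f x = of_real (enn2real (h x))" for x
        have f_meas: "f \<in> borel_measurable lebesgue" unfolding f_def by measurable
        have fh: "AE x in lebesgue. ennreal (norm (f x)) = h x"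
          using finite_AE_if_dual_norm_finite[OF h fin] by eventually_elim (simp add: f_def)
        have dual_cong: "dual_norm g = dual_norm g'" if "AE x in lebesgue. g x = g' x" for g g'
          using that by (intro antisym dual_norm_mono_AE) (auto elim: eventually_mono)
        have f_assoc: "associate X f = dual_norm h"
          unfolding assoc by (rule dual_cong[OF fh])
        have Mf: "maximal_function f x = maximal h x" for x
          unfolding maximal_function_eq by (rule maximal_cong_AE[OF fh])
        have "f \<in> fspace (associate X)" using f_meas fin by (simp add: fspace_def f_assoc)
        from A(2)[OF this] have M_fin: "AE x in lebesgue. maximal h x < \<infinity>"
          and M_le: "associate X (\<lambda>x. of_real (enn2real (maximal h x))) \<le> ennreal A * dual_norm h"
          by (simp_all add: Mf f_assoc)
        have "AE x in lebesgue. ennreal (norm (of_real (enn2real (maximal h x)) :: 'b)) = maximal h x"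
          using M_fin by eventually_elim simp
        then have "associate X (\<lambda>x. of_real (enn2real (maximal h x))) = dual_norm (maximal h)"
          unfolding assoc by (rule dual_cong)
        then show "dual_norm (maximal h) \<le> ennreal A * dual_norm h" using M_le by simp
      qed
    qed
    show "\<exists>C>0. \<forall>j k. j \<le> k \<longrightarrow> real_fnorm X (indicator (dyadic_ball j))
        \<le> ennreal (C * 2 powr (real CARD('n) * \<delta> * of_int (j - k))) * real_fnorm X (indicator (dyadic_ball k))"
      unfolding X_ind [symmetric]
    proof (rule delta_exponent_dyadic[OF \<delta>])
      show "X (indicator (dyadic_ball k)) < \<infinity>" for k unfolding X_ind by (rule ball_finite) simp
      show "X (indicator (dyadic_ball j)) \<le> X (indicator (dyadic_ball k))" if "j \<le> k" for j k
        unfolding X_ind using ball_mono[OF that]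
        by (intro mono nonneg_measurable_indicator AE_I2) (auto simp: indicator_def)
    qed
    show "\<exists>C>0. \<forall>j k. j \<le> k \<longrightarrow> dual_norm (indicator (dyadic_ball j))
        \<le> ennreal (C * 2 powr (real CARD('n) * \<delta>' * of_int (j - k))) * dual_norm (indicator (dyadic_ball k))"
      unfolding assoc_ind [symmetric]
    proof (rule delta_exponent_dyadic[OF \<delta>'])
      show "associate X (indicator (dyadic_ball k)) < \<infinity>" for k
        unfolding assoc_ind by (rule dual_norm_ball_finite) simp
      show "associate X (indicator (dyadic_ball j)) \<le> associate X (indicator (dyadic_ball k))" if "j \<le> k" for j k
        unfolding assoc_ind using ball_mono[OF that]
        by (intro dual_norm_mono_AE AE_I2) (auto simp: indicator_def)
    qed
  qed (use q \<beta> in auto)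
qed

text \<open>The identity \<open>\<parallel>\<bar>f\<bar>\<^sup>s\<parallel>\<^sub>Y = \<parallel>f\<parallel>\<^sub>X\<^sup>s\<close> for \<open>Y = X\<^sup>1\<^sup>/\<^sup>s\<close>, which links the Herz norms over \<open>X\<close> and \<open>Y\<close>.\<close>

lemma real_fnorm_convexification:
  fixes N :: "('n::finite, 'b::{real_normed_field,euclidean_space}) fnorm"
  assumes N: "ball_quasi_banach_function_space N" and s: "0 < s"
    and f: "f \<in> borel_measurable lebesgue" and A: "A \<in> sets lebesgue"
  shows "real_fnorm (convexification N (1 / s)) (\<lambda>x. norm (f x) powr s * indicator A x)
    = N (\<lambda>x. f x * indicator A x) epowr s"
proof -
  note [measurable] = f A
  have "N (\<lambda>x. of_real (norm (of_real (norm (f x) powr s * indicator A x) :: 'b) powr (1 / s)))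
      = N (\<lambda>x. f x * indicator A x)"
  proof (rule ball_quasi_banach_cong_norm[OF N])
    show "(\<lambda>x. f x * indicator A x) \<in> borel_measurable lebesgue" by measurable
    show "(\<lambda>x. of_real (norm (of_real (norm (f x) powr s * indicator A x) :: 'b) powr (1 / s)) :: 'b) \<in> borel_measurable lebesgue"
      by measurable
    show "norm (of_real (norm (of_real (norm (f x) powr s * indicator A x) :: 'b) powr (1 / s)) :: 'b)
        = norm (f x * indicator A x)" for x
      using s by (simp add: indicator_def powr_powr norm_mult)
  qed
  then show ?thesis by (simp add: real_fnorm_def convexification_def)
qed

theorem theorem4p1:
  fixes N :: "(real^'n::finite \<Rightarrow> 'b::{real_normed_field,euclidean_space}) \<Rightarrow> ennreal"
    and T :: "(real^'n \<Rightarrow> 'b) \<Rightarrow> (real^'n \<Rightarrow> 'b)"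
    and \<alpha> p s \<delta> \<delta>' :: real
  assumes "0 < p"
    and "ball_quasi_banach_function_space N"
    and "0 < s" and "s < p"
    and "ball_banach_function_space (convexification N (1 / s))"
    and "maximal_bounded_on (associate (convexification N (1 / s)))"
    and "associate_is_dual (convexification N (1 / s))"
    and "delta_exponent (convexification N (1 / s)) \<delta>"
    and "delta_exponent (associate (convexification N (1 / s))) \<delta>'"
    and "- (real CARD('n) * \<delta>) < s * \<alpha>" and "s * \<alpha> < real CARD('n) * \<delta>'"
    and T_bounded: "\<exists>\<Phi> :: real \<Rightarrow> real. (\<forall>t. 0 < \<Phi> t) \<and>
      (\<forall>w\<in>A1_weights. \<forall>f\<in>fspace (weighted_Lp_norm s w).
         T f \<in> borel_measurable lebesgue \<and>
         weighted_Lp_norm s w (T f) \<le> ennreal (\<Phi> (A1_const w)) * weighted_Lp_norm s w f)"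
  shows "\<exists>C'>0. \<forall>f\<in>herz_space \<alpha> p N.
    T f \<in> herz_space \<alpha> p N \<and> herz_norm \<alpha> p N (T f) \<le> ennreal C' * herz_norm \<alpha> p N f"
proof -
  note N = \<open>ball_quasi_banach_function_space N\<close> and s = \<open>0 < s\<close> and p = \<open>0 < p\<close>
  define q where "q = p / s"
  have pq: "1 < q" "s * q = p" using s \<open>s < p\<close> by (simp_all add: q_def)
  let ?Y = "convexification N (1 / s)"
  interpret herz_frame "real_fnorm ?Y" "s * \<alpha>" q "real CARD('n) * \<delta>" "real CARD('n) * \<delta>'"
    by (rule herz_frame_real_fnorm) (use assms pq in auto)
  define pw where "pw f x = norm (f x) powr s" for f :: "real^'n \<Rightarrow> 'b" and x
  have pw: "pw f \<in> nonneg_measurable lebesgue" if [measurable]: "f \<in> borel_measurable lebesgue" for f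
    unfolding pw_def by (intro nonneg_measurableI) auto
  have herz_eq: "herz_norm \<alpha> p N f = energy (pw f) epowr (1 / p)" if f: "f \<in> borel_measurable lebesgue" for f
  proof -
    have "real_fnorm ?Y (piece k (pw f)) epowr q = N (\<lambda>x. f x * indicator (annulus k) x) epowr p" for k
      unfolding piece_def pw_def using s pq
      by (simp add: real_fnorm_convexification[OF N s f measurable_annulus] epowr_epowr)
    moreover have "weight k powr q = 2 powr (of_int k * p * \<alpha>)" for k
      unfolding weight_def pq(2) [symmetric] by (simp add: powr_powr ac_simps)
    ultimately show ?thesis
      unfolding herz_norm_def energy_def infsum_int_eq_nn_integral by simp
  qed
  have weighted_eq: "weighted_Lp_norm s w f = (\<integral>\<^sup>+x. ennreal (pw f x) * ennreal (w x) \<partial>lebesgue) epowr (1 / s)"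
    if "w \<in> A1_weights" for w f
    using that by (simp add: weighted_Lp_norm_def pw_def ennreal_mult A1_weights_def less_imp_le)
  obtain \<Phi> where \<Phi>: "\<And>t. 0 < \<Phi> t" and T: "\<And>w f. w \<in> A1_weights \<Longrightarrow> f \<in> fspace (weighted_Lp_norm s w) \<Longrightarrow>
      T f \<in> borel_measurable lebesgue \<and>
      weighted_Lp_norm s w (T f) \<le> ennreal (\<Phi> (A1_const w)) * weighted_Lp_norm s w f"
    using T_bounded by blast
  have weighted_T: "T f \<in> borel_measurable lebesgue \<and>
      (\<integral>\<^sup>+x. ennreal (pw (T f) x) * ennreal (w x) \<partial>lebesgue)
        \<le> ennreal (\<Phi> (A1_const w) powr s) * (\<integral>\<^sup>+x. ennreal (pw f x) * ennreal (w x) \<partial>lebesgue)"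
    if w: "w \<in> A1_weights" and f: "f \<in> borel_measurable lebesgue"
      and fin: "(\<integral>\<^sup>+x. ennreal (pw f x) * ennreal (w x) \<partial>lebesgue) < \<infinity>" for w f
  proof -
    let ?I = "\<lambda>f. \<integral>\<^sup>+x. ennreal (pw f x) * ennreal (w x) \<partial>lebesgue"
    have "f \<in> fspace (weighted_Lp_norm s w)"
      unfolding fspace_def weighted_eq[OF w] using f epowr_less_top[OF fin] by blast
    from T[OF w this] have meas: "T f \<in> borel_measurable lebesgue"
      and le: "?I (T f) epowr (1 / s) \<le> ennreal (\<Phi> (A1_const w)) * ?I f epowr (1 / s)"
      unfolding weighted_eq[OF w] by auto
    have "?I (T f) = (?I (T f) epowr (1 / s)) epowr s" using s by (simp add: epowr_epowr epowr_one)
    also have "\<dots> \<le> (ennreal (\<Phi> (A1_const w)) * ?I f epowr (1 / s)) epowr s"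
      using s by (intro epowr_mono le) simp
    also have "\<dots> = ennreal (\<Phi> (A1_const w) powr s) * ?I f"
      using s less_imp_le[OF \<Phi>] by (simp add: epowr_mult epowr_epowr epowr_one)
    finally show ?thesis using meas by blast
  qed
  have energy_fin: "f \<in> borel_measurable lebesgue \<and> energy (pw f) < \<infinity>" if f: "f \<in> herz_space \<alpha> p N" for f
  proof -
    have meas: "f \<in> borel_measurable lebesgue" and fin: "herz_norm \<alpha> p N f < \<infinity>"
      using f by (auto simp: herz_space_def L_loc_punctured_def)
    have "energy (pw f) = herz_norm \<alpha> p N f epowr p"
      unfolding herz_eq[OF meas] using p by (simp add: epowr_epowr epowr_one)
    then show ?thesis using epowr_less_top[OF fin] meas by simp
  qed
  \<comment> \<open>measurability of \<open>T f\<close> only requires \<open>f\<close> to lie in one of the weighted spaces\<close>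
  have T_meas: "T f \<in> borel_measurable lebesgue" if f: "f \<in> herz_space \<alpha> p N" for f
  proof -
    have f_meas: "f \<in> borel_measurable lebesgue" and fin: "energy (pw f) < \<infinity>" using energy_fin[OF f] by auto
    obtain h where "h \<in> herz_polar" using nonzero_in_polar by blast
    then obtain w where w: "w \<in> A1_weights" "(\<lambda>x. ennreal (w x)) \<in> herz_polar" using A1_majorant by blast
    define t where "t = (enn2real (energy (pw f)) + 1) powr (1 / q)"
    have base: "0 < enn2real (energy (pw f)) + 1" by (rule add_nonneg_pos) simp_all
    then have t: "0 < t" and tq: "t powr q = enn2real (energy (pw f)) + 1"
      using pq by (simp_all add: t_def powr_powr)
    have "energy (pw f) = ennreal (enn2real (energy (pw f)))" using fin by simp
    also have "\<dots> \<le> ennreal (t powr q)" unfolding tq by (intro ennreal_leI) simp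
    finally have "(\<integral>\<^sup>+x. ennreal (pw f x) * ennreal (w x) \<partial>lebesgue) \<le> ennreal t"
      by (intro polar_pairing_le pw f_meas t w(2))
    then show ?thesis
      using weighted_T[OF w(1) f_meas] by (simp add: le_less_trans[OF _ ennreal_less_top])
  qed
  let ?P = "(\<lambda>f. (pw f, pw (T f))) ` herz_space \<alpha> p N"
  obtain C where C: "0 < C" "\<And>f g. (f, g) \<in> ?P \<Longrightarrow> energy f < \<infinity> \<Longrightarrow> energy g \<le> ennreal C * energy f"
  proof (rule extrapolation[of ?P])
    show "f \<in> nonneg_measurable lebesgue \<and> g \<in> nonneg_measurable lebesgue" if "(f, g) \<in> ?P" for f g
      using that energy_fin T_meas by (auto intro!: pw)
    fix w :: "real^'n \<Rightarrow> real" assume w: "w \<in> A1_weights"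
    show "\<exists>c>0. \<forall>(f, g)\<in>?P. (\<integral>\<^sup>+x. ennreal (f x) * ennreal (w x) \<partial>lebesgue) < \<infinity> \<longrightarrow>
        (\<integral>\<^sup>+x. ennreal (g x) * ennreal (w x) \<partial>lebesgue)
          \<le> ennreal c * (\<integral>\<^sup>+x. ennreal (f x) * ennreal (w x) \<partial>lebesgue)"
    proof (intro exI[of _ "\<Phi> (A1_const w) powr s"] conjI)
      show "0 < \<Phi> (A1_const w) powr s" using \<Phi>[of "A1_const w"] by simp
    qed (use weighted_T[OF w] energy_fin in auto)
  qed blast
  have energy_T: "energy (pw (T f)) \<le> ennreal C * energy (pw f)" if f: "f \<in> herz_space \<alpha> p N" for f
    using C(2)[of "pw f" "pw (T f)"] f energy_fin[OF f] by blast
  show ?thesis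
  proof (intro exI[of _ "C powr (1 / p)"] conjI ballI)
    show "0 < C powr (1 / p)" using C(1) by simp
    fix f assume f: "f \<in> herz_space \<alpha> p N"
    have f_meas: "f \<in> borel_measurable lebesgue" and fin: "energy (pw f) < \<infinity>" using energy_fin[OF f] by auto
    note Tf = T_meas[OF f]
    have "herz_norm \<alpha> p N (T f) \<le> (ennreal C * energy (pw f)) epowr (1 / p)"
      unfolding herz_eq[OF Tf] using p by (intro epowr_mono energy_T f) simp
    also have "\<dots> = ennreal (C powr (1 / p)) * herz_norm \<alpha> p N f"
      unfolding herz_eq[OF f_meas] using C(1) p by (simp add: epowr_mult)
    finally show le: "herz_norm \<alpha> p N (T f) \<le> ennreal (C powr (1 / p)) * herz_norm \<alpha> p N f" .
    have "energy (pw (T f)) < \<infinity>"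
      using fin by (intro le_less_trans[OF energy_T[OF f]]) (simp add: ennreal_mult_less_top)
    then have loc: "real_fnorm ?Y (\<lambda>x. pw (T f) x * indicator F x) < \<infinity>" if "compact F" "0 \<notin> F" for F
      using that by (intro rho_compact_finite pw Tf)
    have "T f \<in> L_loc_punctured N"
      unfolding L_loc_punctured_def
    proof (intro CollectI conjI allI impI Tf)
      fix F :: "(real^'n) set" assume F: "compact F \<and> 0 \<notin> F"
      then have F_meas [measurable]: "F \<in> sets lebesgue" by (simp add: compact_imp_closed)
      note [measurable] = Tf
      have "N (\<lambda>x. T f x * indicator F x) epowr s < \<infinity>"
        using loc[of F] F real_fnorm_convexification[OF N s Tf F_meas] by (simp add: pw_def)
      from epowr_less_top[OF this, of "1 / s"] have "N (\<lambda>x. T f x * indicator F x) < \<infinity>"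
        using s by (simp add: epowr_epowr epowr_one)
      then show "(\<lambda>x. T f x * indicator F x) \<in> fspace N" by (simp add: fspace_def)
    qed
    moreover have "herz_norm \<alpha> p N (T f) < \<infinity>"
      using f by (intro le_less_trans[OF le]) (auto simp: herz_space_def ennreal_mult_less_top)
    ultimately show "T f \<in> herz_space \<alpha> p N" by (simp add: herz_space_def)
  qed
qed

end
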